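(* Let $l\ge 5$ be a prime number and let $F$ be a field such that the cyclotomic polynomial $\Phi_l(x)$ is irreducible in $F[x]$. Let $n$ be a positive integer with $n\le \frac{l-3}{2}$, and let $\mathfrak{G}_l(n;F)$ be any subgroup of $K_2(F(x))$ generated by $n$ pairwise essentially distinct nontrivial elements of $GG_l(F(x))$. Let $c(\mathfrak{G}_l(n;F))$ and $cs(\mathfrak{G}_l(n;F))$ denote respectively the number of nontrivial cyclotomic elements (i.e. elements $\neq 1$ of $G_l(F(x))$) and the number of nontrivial cyclotomic subgroups (i.e. subgroups $\ne\{1\}$ contained in the set $G_l(F(x))$) contained in $\mathfrak{G}_l(n;F)$. Then: (i) If $\mathrm{ch}(F)=0$, then $c(\mathfrak{G}_l(n;F))=2n$, and so $cs(\mathfrak{G}_l(n;F))=0$. (ii) If $\mathrm{ch}(F)=p\neq 0$, then $c(\mathfrak{G}_l(n;F))=n(2+|\mathfrak{Z}(l,p)|)$, where $$\mathfrak{Z}(l,p)=\{t\in\mathbb{Z} \mid 2\le t\le l-2,\ t\equiv p^{2m}\text{ or } -p^{2m}\ (\mathrm{mod}\ l)\text{ for some } m\in\mathbb{N}\}.$$ (iii) If $\mathrm{ch}(F)=p\neq 0$, then $cs(\mathfrak{G}_l(n;F))>0$ if and only if $l\equiv 3\ (\mathrm{mod}\ 4)$ and $p$ is a primitive root of $l$ (i.e. modulo $l$). In this case $cs(\mathfrak{G}_l(n;F))=n$, i.e. $\mathfrak{G}_l(n;F)$ contains exactly $n$ nontrivial cyclotomic subgroups. (iv) Every nontrivial cyclotomic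 subgroup of $\mathfrak{G}_l(n;F)$ is a cyclic subgroup of order $l$, i.e. every nontrivial cyclotomic subgroup has the form $\mathfrak{G}_l(1;F)$ (a subgroup generated by one nontrivial element of $GG_l(F(x))$).
   Context: For a field $E$, $K_2(E)$ is the Milnor $K_2$-group (written multiplicatively, generated by symbols $\{a,b\}$, $a,b\in E^*$). For $a\in E^*$ with $\Phi_l(a)\neq 0$ put $c_l(a)=\{a,\Phi_l(a)\}\in K_2(E)$, and $G_l(E)=\{c_l(a)\mid a,\Phi_l(a)\in E^*\}$. Elements of $G_l(E)$ are called cyclotomic elements; a subgroup of $K_2(E)$ contained in $G_l(E)$ is called cyclotomic. Here these notions are applied to $E=F(x)$, the rational function field. $GG_l(F(x))=\{c_l(\frac{ax+b}{cx+d}) \mid \begin{pmatrix}a&b\\c&d\end{pmatrix}\in GL(2,F)\}$. Let $W(F)$ be the group of roots of unity in $F$. Matrices $A,B\in GL(2,F)$ are essentially distinct if $B\neq \alpha\begin{pmatrix}\mu&0\\0&1\end{pmatrix}\begin{pmatrix}0&1\\1&0\end{pmatrix}^{\epsilon}A$ for every $\alpha\in F^*$, $\mu\in W(F)$, $\epsilon\in\{0,1\}$. Elements $c_l(\frac{a_1x+b_1}{c_1x+d_1})$ and $c_l(\frac{a_2x+b_2}{c_2x+d_2})$ of $GG_l(F(x))$ are essentially distinct if the matrices $\begin{pmatrix}a_1&b_1\\c_1&d_1\end{pmatrix}$ and $\begin{pmatrix}a_2&b_2\\c_2&d_2\end{pmatrix}$ are essentially distinct. *)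

theory Defs
  imports
    "HOL-Analysis.Analysis"
    "HOL-Algebra.Free_Abelian_Groups"
    "HOL-Algebra.Elementary_Groups"
    "HOL-Computational_Algebra.Computational_Algebra"
    "HOL-Number_Theory.Number_Theory"
begin

definition primitive_roots_of_unity :: "nat \<Rightarrow> complex set" where
  "primitive_roots_of_unity n = {z. z ^ n = 1 \<and> (\<forall>m. 0 < m \<and> m < n \<longrightarrow> z ^ m \<noteq> 1)}"

definition cyclotomic_int :: "nat \<Rightarrow> int poly" where
  "cyclotomic_int n =
     (THE p. map_poly of_int p = (\<Prod>z\<in>primitive_roots_of_unity n. [:- z, 1:]))"

lemma primitive_roots_of_unity_prime:
  assumes "prime l"
  shows "primitive_roots_of_unity l = {z. z ^ l = 1} - {1}"
proof -
  have l: "l > 1" using assms by (rule prime_gt_1_nat)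
  have "z = 1" if z: "z ^ l = 1" and m: "0 < m" "m < l" "z ^ m = 1" for z :: complex and m
  proof -
    have "coprime m l"
      using m assms by (metis coprime_commute nat_dvd_not_less prime_imp_coprime)
    then obtain x y where "m * x = l * y + 1"
      using coprime_bezout_strong[of m l] l by auto
    then have "(z ^ m) ^ x = (z ^ l) ^ y * z"
      by (metis power_mult power_add power_one_right)
    then show "z = 1" using z m by simp
  qed
  then show ?thesis
    using l unfolding primitive_roots_of_unity_def
    by (auto dest: spec[of _ 1])
qed

lemma cyclotomic_int_prime:
  assumes "prime l"
  shows "cyclotomic_int l = (\<Sum>i<l. Polynomial.monom 1 i)"
proof -
  have l: "l > 1" using assms by (rule prime_gt_1_nat)
  define q :: "complex poly" where "q = (\<Sum>i<l. Polynomial.monom 1 i)"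
  define R where "R = {z::complex. z ^ l = 1}"
  have fin: "finite R" unfolding R_def using l by (intro finite_roots_unity) auto
  have "[:- 1, 1:] * q = Polynomial.monom 1 l - 1"
  proof -
    have "[:- 1, 1:] * (\<Sum>i<n. Polynomial.monom 1 i) = Polynomial.monom 1 n - (1 :: complex poly)" for n
    proof (induction n)
      case (Suc n)
      have "[:- 1, 1:] * Polynomial.monom 1 n = Polynomial.monom 1 (Suc n) - (Polynomial.monom 1 n :: complex poly)"
        by (simp add: monom_Suc)
      then show ?case using Suc by (simp add: distrib_left del: mult_pCons_left)
    qed simp
    then show ?thesis by (simp add: q_def)
  qed
  also have "(Polynomial.monom 1 l - 1 :: complex poly) = (\<Prod>z\<in>R. [:- z, 1:])"
  proof -
    let ?P = "Polynomial.monom 1 l - 1 :: complex poly"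
    have deg: "Polynomial.degree ?P = l"
      using l degree_add_eq_left[of "- 1 :: complex poly" "Polynomial.monom 1 l"]
      by (simp add: Polynomial.degree_monom_eq)
    have lc: "lead_coeff ?P = 1"
      using l by (simp add: deg)
    have "rsquarefree ?P"
    proof (subst rsquarefree_roots, intro allI notI)
      fix z assume "poly ?P z = 0 \<and> poly (pderiv ?P) z = 0"
      then have "z ^ l = 1" "of_nat l * z ^ (l - 1) = 0"
        by (auto simp: poly_monom pderiv_diff pderiv_monom)
      then show False using l by (auto simp: zero_power)
    qed
    from complex_poly_decompose_rsquarefree[OF this] lc
    show ?thesis by (simp add: poly_monom R_def)
  qed
  also have "\<dots> = [:- 1, 1:] * (\<Prod>z\<in>R - {1}. [:- z, 1:])"
    using fin by (subst prod.remove[of R 1]) (auto simp: R_def)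
  finally have q: "q = (\<Prod>z\<in>R - {1}. [:- z, 1:])"
    by (subst (asm) mult_cancel_left) auto
  have map: "map_poly of_int (\<Sum>i<n. Polynomial.monom 1 i) = (\<Sum>i<n. Polynomial.monom (1::complex) i)" for n
    by (rule poly_eqI) (simp add: coeff_map_poly coeff_sum)
  show ?thesis
    unfolding cyclotomic_int_def primitive_roots_of_unity_prime[OF assms] R_def[symmetric]
  proof (rule the_equality)
    show "map_poly of_int (\<Sum>i<l. Polynomial.monom 1 i) = (\<Prod>z\<in>R - {1}. [:- z, 1:])"
      using map q by (simp add: q_def)
  next
    fix p :: "int poly"
    assume "map_poly of_int p = (\<Prod>z\<in>R - {1}. [:- z, 1:])"
    then have "map_poly of_int p = (map_poly of_int (\<Sum>i<l. Polynomial.monom 1 i) :: complex poly)"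
      using map q by (simp add: q_def)
    then have "(of_int (Polynomial.coeff p k) :: complex) = of_int (Polynomial.coeff (\<Sum>i<l. Polynomial.monom 1 i) k)" for k
      by (metis coeff_map_poly of_int_0)
    then show "p = (\<Sum>i<l. Polynomial.monom 1 i)"
      by (intro poly_eqI) (simp only: of_int_eq_iff)
  qed
qed

text \<open>The image of the integral cyclotomic polynomial in \<open>E[x]\<close>.\<close>

definition cyclotomic_poly :: "nat \<Rightarrow> 'e::field poly" where
  "cyclotomic_poly n = map_poly of_int (cyclotomic_int n)"

text \<open>
  \<open>K\<^sub>2(E)\<close> is presented as the free abelian group on the pairs of nonzero elements
  (written additively) modulo bimultiplicativity and the Steinberg relation. Its elements
  are cosets, and its group operation is the multiplication of cosets.
\<close>

definition K2_free :: "('e::field \<times> 'e \<Rightarrow>\<^sub>0 int) monoid" where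
  "K2_free = free_Abelian_group ((- {0}) \<times> (- {0}))"

definition K2_relators :: "('e::field \<times> 'e \<Rightarrow>\<^sub>0 int) set" where
  "K2_relators =
     {frag_of (a * b, c) - frag_of (a, c) - frag_of (b, c) | a b c. a \<noteq> 0 \<and> b \<noteq> 0 \<and> c \<noteq> 0}
   \<union> {frag_of (a, b * c) - frag_of (a, b) - frag_of (a, c) | a b c. a \<noteq> 0 \<and> b \<noteq> 0 \<and> c \<noteq> 0}
   \<union> {frag_of (a, 1 - a) | a. a \<noteq> 0 \<and> a \<noteq> 1}"

definition K2 :: "('e::field \<times> 'e \<Rightarrow>\<^sub>0 int) set monoid" where
  "K2 = K2_free Mod (generate K2_free K2_relators)"

text \<open>The symbol \<open>{a, b}\<close>; it is an element of \<open>K\<^sub>2(E)\<close> only for nonzero \<open>a\<close>, \<open>b\<close>.\<close>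

definition K2_symbol :: "'e::field \<Rightarrow> 'e \<Rightarrow> ('e \<times> 'e \<Rightarrow>\<^sub>0 int) set" where
  "K2_symbol a b = generate K2_free K2_relators #>\<^bsub>K2_free\<^esub> frag_of (a, b)"

definition cyc :: "nat \<Rightarrow> 'e::field \<Rightarrow> ('e \<times> 'e \<Rightarrow>\<^sub>0 int) set" where
  "cyc l a = K2_symbol a (poly (cyclotomic_poly l) a)"

definition cyclotomic_elements :: "nat \<Rightarrow> ('e::field \<times> 'e \<Rightarrow>\<^sub>0 int) set set" where
  "cyclotomic_elements l = {cyc l a | a. a \<noteq> 0 \<and> poly (cyclotomic_poly l) a \<noteq> 0}"

definition cyclotomic_subgroup :: "nat \<Rightarrow> ('e::field \<times> 'e \<Rightarrow>\<^sub>0 int) set set \<Rightarrow> bool" where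
  "cyclotomic_subgroup l H \<longleftrightarrow> subgroup H K2 \<and> H \<subseteq> cyclotomic_elements l"

text \<open>
  The field \<open>F(x)\<close> is \<^typ>\<open>'a poly fract\<close>. The matrix with rows \<open>(a, b)\<close> and \<open>(c, d)\<close>
  gives \<open>(a x + b) / (c x + d)\<close>; coefficients are listed with the constant term first.
\<close>

definition mobius :: "'a::field ^ 2 ^ 2 \<Rightarrow> 'a poly fract" where
  "mobius A = Fract [:A $ 1 $ 2, A $ 1 $ 1:] [:A $ 2 $ 2, A $ 2 $ 1:]"

definition GG :: "nat \<Rightarrow> ('a::field poly fract \<times> 'a poly fract \<Rightarrow>\<^sub>0 int) set set" where
  "GG l = {cyc l (mobius A) | A. invertible A}"

definition roots_of_unity :: "'a::field set" where
  "roots_of_unity = {\<mu>. \<exists>m>0. \<mu> ^ m = 1}"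

definition essentially_distinct :: "'a::field ^ 2 ^ 2 \<Rightarrow> 'a ^ 2 ^ 2 \<Rightarrow> bool" where
  "essentially_distinct A B \<longleftrightarrow>
     (\<forall>\<alpha>. \<forall>\<mu>\<in>roots_of_unity. \<forall>J\<in>{mat 1, vector [vector [0, 1], vector [1, 0]]}.
        \<alpha> \<noteq> 0 \<longrightarrow> B \<noteq> mat \<alpha> ** vector [vector [\<mu>, 0], vector [0, 1]] ** J ** A)"

text \<open>
  The subgroups generated by \<open>n\<close> pairwise essentially distinct nontrivial elements of
  \<^term>\<open>GG l\<close>. As essential distinctness of elements refers to matrices representing them,
  the generators are given by a family of such matrices.
\<close>

definition generated_subgroups ::
    "nat \<Rightarrow> nat \<Rightarrow> ('a::field poly fract \<times> 'a poly fract \<Rightarrow>\<^sub>0 int) set set set" where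
  "generated_subgroups l n =
     {generate K2 ((\<lambda>i. cyc l (mobius (A i))) ` {..<n}) | A :: nat \<Rightarrow> 'a ^ 2 ^ 2.
        (\<forall>i<n. invertible (A i) \<and> cyc l (mobius (A i)) \<noteq> \<one>\<^bsub>K2\<^esub>) \<and>
        (\<forall>i<n. \<forall>j<n. i \<noteq> j \<longrightarrow> essentially_distinct (A i) (A j))}"

definition nontrivial_cyclotomic_elements_in ::
    "nat \<Rightarrow> ('e::field \<times> 'e \<Rightarrow>\<^sub>0 int) set set \<Rightarrow> ('e \<times> 'e \<Rightarrow>\<^sub>0 int) set set" where
  "nontrivial_cyclotomic_elements_in l G = {u \<in> G. u \<in> cyclotomic_elements l \<and> u \<noteq> \<one>\<^bsub>K2\<^esub>}"

definition nontrivial_cyclotomic_subgroups_in ::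
    "nat \<Rightarrow> ('e::field \<times> 'e \<Rightarrow>\<^sub>0 int) set set \<Rightarrow> ('e \<times> 'e \<Rightarrow>\<^sub>0 int) set set set" where
  "nontrivial_cyclotomic_subgroups_in l G =
     {H. H \<subseteq> G \<and> cyclotomic_subgroup l H \<and> H \<noteq> {\<one>\<^bsub>K2\<^esub>}}"

definition num_cyclotomic_elements :: "nat \<Rightarrow> ('e::field \<times> 'e \<Rightarrow>\<^sub>0 int) set set \<Rightarrow> nat" where
  "num_cyclotomic_elements l G = card (nontrivial_cyclotomic_elements_in l G)"

definition num_cyclotomic_subgroups :: "nat \<Rightarrow> ('e::field \<times> 'e \<Rightarrow>\<^sub>0 int) set set \<Rightarrow> nat" where
  "num_cyclotomic_subgroups l G = card (nontrivial_cyclotomic_subgroups_in l G)"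

definition Z_set :: "nat \<Rightarrow> nat \<Rightarrow> int set" where
  "Z_set l p = {t. 2 \<le> t \<and> t \<le> int l - 2 \<and>
     (\<exists>m::nat. [t = int p ^ (2 * m)] (mod int l) \<or> [t = - (int p ^ (2 * m))] (mod int l))}"

end

theory Submission
  imports "HOL-Algebra.Algebraic_Closure_Type" Defs
begin

text \<open>
  Let \<open>K\<close> be the algebraic closure of \<open>F\<close>. For \<open>y \<in> K\<close>, expanding rational functions at \<open>y\<close>
  and taking the tame symbol gives a homomorphism \<open>\<partial>\<^sub>y\<close> from \<open>K\<^sub>2(F(x))\<close> to the multiplicative
  group of \<open>K\<close>. At zeros of \<open>f\<close> one has \<open>\<Phi>\<^sub>l(f) \<equiv> 1\<close>, and poles reduce to zeros, so \<open>\<partial>\<^sub>y\<close> sees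
  of \<open>c\<^sub>l(f)\<close> only the points where \<open>f(y)\<close> is a root of \<open>\<Phi>\<^sub>l\<close>, and there its value is \<open>f(y)\<close>
  to the power of the multiplicity of \<open>y\<close> in its fibre (\<open>tame_symbol_at\<close>). The symbol is
  therefore nontrivial exactly at fibre points whose multiplicity is prime to \<open>l\<close>.

  For a Moebius transformation these are \<open>l - 1\<close> conjugate points, all of multiplicity one,
  and for essentially distinct transformations they are disjoint. As \<open>c\<^sub>l(f)\<^sup>l = 1\<close> always,
  the generators \<open>u\<^sub>1, \<dots>, u\<^sub>n\<close> are a basis of an elementary abelian \<open>l\<close>-group, with tame
  symbols as coordinates.

  Suppose now that \<open>c\<^sub>l(f) \<noteq> 1\<close> lies in this group. Off the fibres of the given
  transformations \<open>A\<^sub>i\<close>, the function \<open>f\<close> takes each root of \<open>\<Phi>\<^sub>l\<close> with multiplicity divisible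
  by \<open>l\<close>. After stripping off Frobenius, the Wronskian of numerator and denominator is nonzero
  and bounds the total ramification; since \<open>2 n \<le> l - 3\<close>, this forces the degree of the
  remaining function \<open>f\<close> to be at most \<open>n\<close> (\<open>wronskian_degree_bound\<close>). A fibre point \<open>z\<close> of
  \<open>f\<close> with \<open>A\<^sub>i(z) = s\<close> (up to a Frobenius twist of \<open>A\<^sub>i\<close>) then satisfies \<open>f(z) = s\<^sup>k\<close>, which
  up to replacing \<open>f\<close> by its inverse is a polynomial relation over \<open>F\<close> of degree at most \<open>l -
  2\<close>; but \<open>z\<close> has degree \<open>l - 1\<close> over \<open>F\<close> because \<open>\<Phi>\<^sub>l\<close> is irreducible. Hence the relation is
  an identity and, undoing Frobenius, the original function is a power \<open>A\<^sub>i\<^sup>k\<close> or its inverse.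
  All fibre points of \<open>A\<^sub>i\<^sup>k\<close> must in turn belong to some \<open>A\<^sub>j\<close>, and essential distinctness
  leaves only \<open>j = i\<close>, so each fibre is a single point and \<open>k\<close> is a power of the
  characteristic \<open>p\<close> (or \<open>k = 1\<close>). This is \<open>mobius_fibre_classification\<close>, the heart of the
  proof. Since \<open>c\<^sub>l(a\<^sup>p) = c\<^sub>l(a)\<^bsup>p\<^sup>2\<^esup>\<close> and \<open>c\<^sub>l(1/a) = c\<^sub>l(a)\<^bsup>-1\<^esup>\<close>, the nontrivial cyclotomic
  elements of the group are exactly the powers \<open>u\<^sub>i\<^sup>t\<close> with \<open>t \<equiv> \<plusminus>p\<^sup>2\<^sup>m\<close> modulo \<open>l\<close>, where \<open>p\<close>
  stands for 1 in characteristic 0, and they are pairwise different. This gives the counts.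

  A product \<open>u\<^sub>i u\<^sub>j\<close> with \<open>i \<noteq> j\<close> is not of this form, so a nontrivial cyclotomic subgroup is
  generated by one \<open>u\<^sub>i\<close>, and that group is cyclotomic iff every residue prime to \<open>l\<close> is of
  the form \<open>\<plusminus>p\<^sup>2\<^sup>m\<close>. In characteristic 0 this fails because \<open>l \<ge> 5\<close>. In positive
  characteristic, irreducibility of \<open>\<Phi>\<^sub>l\<close> over \<open>F\<close> already makes \<open>p\<close> a primitive root modulo
  \<open>l\<close> (\<open>CHAR_primroot\<close>), so the powers \<open>p\<^sup>2\<^sup>m\<close> are the squares, and the condition says that
  \<open>-1\<close> is not a square, that is \<open>l \<equiv> 3\<close> modulo 4.
\<close>

(* The dollar sign denotes matrix entries below, never coefficients of power series. *)
no_notation fps_nth (infixl \<open>$\<close> 75)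

section \<open>Symbols in \<open>K\<^sub>2\<close>\<close>

definition K2_relations :: "('e::field \<times> 'e \<Rightarrow>\<^sub>0 int) set" where
  "K2_relations = generate K2_free K2_relators"

lemma comm_group_K2_free: "comm_group (K2_free :: ('e::field \<times> 'e \<Rightarrow>\<^sub>0 int) monoid)"
  unfolding K2_free_def by (rule abelian_free_Abelian_group)

interpretation K2_free: comm_group "K2_free :: ('e::field \<times> 'e \<Rightarrow>\<^sub>0 int) monoid"
  by (rule comm_group_K2_free)

lemma frag_of_in_K2_free [simp]:
  "frag_of (a, b) \<in> carrier K2_free \<longleftrightarrow> a \<noteq> 0 \<and> b \<noteq> (0::'e::field)"
  by (simp add: K2_free_def)

lemma K2_free_add_closed:
  "\<lbrakk>x \<in> carrier K2_free; y \<in> carrier K2_free\<rbrakk> \<Longrightarrow> x + y \<in> carrier (K2_free :: ('e::field \<times> 'e \<Rightarrow>\<^sub>0 int) monoid)"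
  using K2_free.m_closed[of x y] by (simp add: K2_free_def)

lemma K2_free_minus_closed:
  "x \<in> carrier K2_free \<Longrightarrow> - x \<in> carrier (K2_free :: ('e::field \<times> 'e \<Rightarrow>\<^sub>0 int) monoid)"
  by (simp add: K2_free_def)

lemma K2_free_diff_closed:
  "\<lbrakk>x \<in> carrier K2_free; y \<in> carrier K2_free\<rbrakk> \<Longrightarrow> x - y \<in> carrier (K2_free :: ('e::field \<times> 'e \<Rightarrow>\<^sub>0 int) monoid)"
  using K2_free_add_closed[of x "-y"] K2_free_minus_closed[of y] by simp

lemma K2_relators_subset: "K2_relators \<subseteq> carrier (K2_free :: ('e::field \<times> 'e \<Rightarrow>\<^sub>0 int) monoid)"
  unfolding K2_relators_def by (auto intro!: K2_free_diff_closed)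

lemma subgroup_K2_relations: "subgroup K2_relations (K2_free :: ('e::field \<times> 'e \<Rightarrow>\<^sub>0 int) monoid)"
  unfolding K2_relations_def by (rule K2_free.generate_is_subgroup[OF K2_relators_subset])

lemma normal_K2_relations: "K2_relations \<lhd> (K2_free :: ('e::field \<times> 'e \<Rightarrow>\<^sub>0 int) monoid)"
  using K2_free.normal_iff_subgroup subgroup_K2_relations by blast

lemma K2_eq: "K2 = K2_free Mod K2_relations"
  by (simp add: K2_def K2_relations_def)

lemma comm_group_K2: "comm_group (K2 :: ('e::field \<times> 'e \<Rightarrow>\<^sub>0 int) set monoid)"
  unfolding K2_eq by (rule K2_free.abelian_FactGroup[OF subgroup_K2_relations])

interpretation K2: comm_group "K2 :: ('e::field \<times> 'e \<Rightarrow>\<^sub>0 int) set monoid"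
  by (rule comm_group_K2)

lemma K2_coset_mult:
  assumes "x \<in> carrier K2_free" "y \<in> carrier (K2_free :: ('e::field \<times> 'e \<Rightarrow>\<^sub>0 int) monoid)"
  shows "(K2_relations #>\<^bsub>K2_free\<^esub> x) \<otimes>\<^bsub>K2\<^esub> (K2_relations #>\<^bsub>K2_free\<^esub> y) = K2_relations #>\<^bsub>K2_free\<^esub> (x + y)"
  using normal.rcos_sum[OF normal_K2_relations assms] by (simp add: K2_eq) (simp add: K2_free_def)

lemma K2_coset_one:
  assumes "x \<in> K2_relations"
  shows "K2_relations #>\<^bsub>K2_free\<^esub> x = \<one>\<^bsub>(K2 :: ('e::field \<times> 'e \<Rightarrow>\<^sub>0 int) set monoid)\<^esub>"
  using K2_free.coset_join2[OF subgroup.mem_carrier[OF subgroup_K2_relations assms] subgroup_K2_relations assms]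
  by (simp add: K2_eq)

lemma K2_symbol_closed [simp, intro]:
  assumes "a \<noteq> 0" "b \<noteq> (0::'e::field)"
  shows "K2_symbol a b \<in> carrier K2"
  using assms by (auto simp: K2_symbol_def K2_eq carrier_FactGroup K2_relations_def)

lemma K2_coset_eq:
  assumes "x \<in> carrier K2_free" "y \<in> carrier (K2_free :: ('e::field \<times> 'e \<Rightarrow>\<^sub>0 int) monoid)"
    and "x - y \<in> K2_relations"
  shows "K2_relations #>\<^bsub>K2_free\<^esub> x = K2_relations #>\<^bsub>K2_free\<^esub> y"
proof -
  have c: "x - y \<in> carrier K2_free" using K2_free_diff_closed assms by blast
  have "K2_relations #>\<^bsub>K2_free\<^esub> x = (K2_relations #>\<^bsub>K2_free\<^esub> (x - y)) \<otimes>\<^bsub>K2\<^esub> (K2_relations #>\<^bsub>K2_free\<^esub> y)"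
    using K2_coset_mult[OF c assms(2)] by simp
  also have "\<dots> = K2_relations #>\<^bsub>K2_free\<^esub> y"
    unfolding K2_coset_one[OF assms(3)] using assms(2)
    by (intro K2.l_one) (simp add: K2_eq carrier_FactGroup)
  finally show ?thesis .
qed

lemma K2_relator_in_sub: "x \<in> K2_relators \<Longrightarrow> x \<in> K2_relations"
  unfolding K2_relations_def by (rule generate.incl)

lemma K2_relator_left:
  assumes "a \<noteq> 0" "b \<noteq> 0" "c \<noteq> (0::'e::field)"
  shows "frag_of (a * b, c) - frag_of (a, c) - frag_of (b, c) \<in> K2_relators"
  using assms unfolding K2_relators_def by blast

lemma K2_relator_right:
  assumes "a \<noteq> 0" "b \<noteq> 0" "c \<noteq> (0::'e::field)"
  shows "frag_of (a, b * c) - frag_of (a, b) - frag_of (a, c) \<in> K2_relators"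
  using assms unfolding K2_relators_def by blast

lemma K2_symbol_mult_left:
  assumes "a \<noteq> 0" "b \<noteq> 0" "c \<noteq> (0::'e::field)"
  shows "K2_symbol (a * b) c = K2_symbol a c \<otimes>\<^bsub>K2\<^esub> K2_symbol b c"
  unfolding K2_symbol_def K2_relations_def[symmetric] using assms
  by (subst K2_coset_mult, simp, simp, intro K2_coset_eq K2_free_add_closed K2_relator_in_sub)
    (use K2_relator_left[OF assms] in \<open>auto simp: diff_diff_eq[symmetric]\<close>)

lemma K2_symbol_mult_right:
  assumes "a \<noteq> 0" "b \<noteq> 0" "c \<noteq> (0::'e::field)"
  shows "K2_symbol a (b * c) = K2_symbol a b \<otimes>\<^bsub>K2\<^esub> K2_symbol a c"
  unfolding K2_symbol_def K2_relations_def[symmetric] using assms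
  by (subst K2_coset_mult, simp, simp, intro K2_coset_eq K2_free_add_closed K2_relator_in_sub)
    (use K2_relator_right[OF assms] in \<open>auto simp: diff_diff_eq[symmetric]\<close>)

lemma K2_symbol_steinberg:
  assumes "a \<noteq> 0" "a \<noteq> (1::'e::field)"
  shows "K2_symbol a (1 - a) = \<one>\<^bsub>K2\<^esub>"
  unfolding K2_symbol_def K2_relations_def[symmetric] using assms
  by (intro K2_coset_one K2_relator_in_sub) (auto simp: K2_relators_def)

lemma K2_symbol_one_left [simp]: "b \<noteq> 0 \<Longrightarrow> K2_symbol 1 (b::'e::field) = \<one>\<^bsub>K2\<^esub>"
  using K2_symbol_mult_left[of 1 1 b] K2.l_cancel_one'[of "K2_symbol 1 b" "K2_symbol 1 b"] by simp

lemma K2_symbol_one_right [simp]: "a \<noteq> 0 \<Longrightarrow> K2_symbol (a::'e::field) 1 = \<one>\<^bsub>K2\<^esub>"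
  using K2_symbol_mult_right[of a 1 1] K2.l_cancel_one'[of "K2_symbol a 1" "K2_symbol a 1"] by simp

lemma K2_symbol_power_left:
  assumes "a \<noteq> 0" "b \<noteq> (0::'e::field)"
  shows "K2_symbol (a ^ n) b = K2_symbol a b [^]\<^bsub>K2\<^esub> (n::nat)"
  using assms by (induction n) (simp_all add: K2_symbol_mult_left K2.m_comm)

lemma K2_symbol_power_right:
  assumes "a \<noteq> 0" "b \<noteq> (0::'e::field)"
  shows "K2_symbol a (b ^ n) = K2_symbol a b [^]\<^bsub>K2\<^esub> (n::nat)"
  using assms by (induction n) (simp_all add: K2_symbol_mult_right K2.m_comm)

lemma K2_symbol_inverse_left:
  assumes "a \<noteq> 0" "b \<noteq> (0::'e::field)"
  shows "K2_symbol (inverse a) b = inv\<^bsub>K2\<^esub> (K2_symbol a b)"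
  using assms K2_symbol_mult_left[of "inverse a" a b]
  by (intro K2.inv_equality[symmetric]) auto

lemma K2_symbol_inverse_right:
  assumes "a \<noteq> 0" "b \<noteq> (0::'e::field)"
  shows "K2_symbol a (inverse b) = inv\<^bsub>K2\<^esub> (K2_symbol a b)"
  using assms K2_symbol_mult_right[of a "inverse b" b]
  by (intro K2.inv_equality[symmetric]) auto

text \<open>
  Write \<open>-a = (1 - a) / (1 - 1/a)\<close> and use the Steinberg relation for \<open>a\<close> and for \<open>1/a\<close>.
\<close>

lemma K2_symbol_neg:
  assumes "a \<noteq> (0::'e::field)"
  shows "K2_symbol a (- a) = \<one>\<^bsub>K2\<^esub>"
proof (cases "a = 1")
  case False
  have eq: "- a = (1 - a) * inverse (1 - inverse a)"
    using assms False by (simp add: field_simps)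
  have "1 - inverse a \<noteq> 0" using False by auto
  moreover have "K2_symbol a (1 - inverse a) = \<one>\<^bsub>K2\<^esub>"
    using K2_symbol_steinberg[of "inverse a"] assms False
      K2_symbol_inverse_left[of "inverse a" "1 - inverse a"] by auto
  ultimately show ?thesis
    using assms False K2_symbol_steinberg[of a]
    by (subst eq, subst K2_symbol_mult_right) (auto simp: K2_symbol_inverse_right)
qed (use assms in auto)

text \<open>
  By the previous lemma \<open>{a, a} = {a, -a} {a, -1} = {a, -1}\<close>, and \<open>{a, -1}\<^sup>2 = {a, 1} = 1\<close>.
\<close>

lemma K2_symbol_self_even:
  assumes "a \<noteq> (0::'e::field)" "even n"
  shows "K2_symbol a a [^]\<^bsub>K2\<^esub> (n::nat) = \<one>\<^bsub>K2\<^esub>"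
proof -
  have "K2_symbol a a = K2_symbol a (- a) \<otimes>\<^bsub>K2\<^esub> K2_symbol a (- 1)"
    using assms K2_symbol_mult_right[of a "- a" "- 1"] by simp
  then have "K2_symbol a a = K2_symbol a (- 1)" using assms by (simp add: K2_symbol_neg)
  then have "K2_symbol a a [^]\<^bsub>K2\<^esub> n = K2_symbol a ((- 1) ^ n)"
    using assms by (simp only: K2_symbol_power_right neg_equal_0_iff_equal one_neq_zero not_False_eq_True)
  then show ?thesis using assms by simp
qed

section \<open>Relations between cyclotomic elements\<close>

text \<open>
  For prime \<open>l\<close> this is \<open>\<Phi>\<^sub>l(a)\<close>; it makes sense in every commutative ring.
\<close>

definition Phi_val :: "nat \<Rightarrow> 'e::comm_ring_1 \<Rightarrow> 'e" where
  "Phi_val l a = (\<Sum>i<l. a ^ i)"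

lemma cyclotomic_poly_prime:
  assumes "prime l"
  shows "cyclotomic_poly l = (\<Sum>i<l. monom (1::'e::field) i)"
  unfolding cyclotomic_poly_def cyclotomic_int_prime[OF assms]
  by (rule poly_eqI) (simp add: coeff_map_poly coeff_sum)

lemma poly_cyclotomic_poly_prime:
  assumes "prime l"
  shows "poly (cyclotomic_poly l) a = Phi_val l (a::'e::field)"
  by (simp add: cyclotomic_poly_prime[OF assms] poly_sum poly_monom Phi_val_def)

lemma cyc_prime: "prime l \<Longrightarrow> cyc l a = K2_symbol a (Phi_val l (a::'e::field))"
  by (simp add: cyc_def poly_cyclotomic_poly_prime)

lemma Phi_val_mult: "(1 - a) * Phi_val l a = 1 - (a::'e::comm_ring_1) ^ l"
  unfolding Phi_val_def by (simp add: one_diff_power_eq)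

lemma cyc_closed [simp, intro]:
  assumes "prime l" "a \<noteq> 0" "Phi_val l (a::'e::field) \<noteq> 0"
  shows "cyc l a \<in> carrier K2"
  using assms by (auto simp: cyc_prime)

text \<open>For \<open>a \<noteq> 1\<close>, from \<open>\<Phi>\<^sub>l(a) = (1 - a\<^sup>l) / (1 - a)\<close> and the Steinberg relation:
  \<open>{a, \<Phi>\<^sub>l(a)}\<^sup>l = {a\<^sup>l, 1 - a\<^sup>l} {a, 1 - a}\<^sup>-\<^sup>l = 1\<close>.\<close>

lemma cyc_pow_l:
  assumes l: "prime l" and a: "a \<noteq> 0" "Phi_val l (a::'e::field) \<noteq> 0"
  shows "cyc l a [^]\<^bsub>K2\<^esub> l = \<one>\<^bsub>K2\<^esub>"
proof (cases "a = 1")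
  case False
  have "a ^ l \<noteq> 1" using Phi_val_mult[of a l] a False by auto
  have eq: "Phi_val l a = (1 - a ^ l) * inverse (1 - a)"
    using Phi_val_mult[of a l] False by (simp add: field_simps)
  have "cyc l a [^]\<^bsub>K2\<^esub> l = K2_symbol (a ^ l) ((1 - a ^ l) * inverse (1 - a))"
    using a by (simp add: cyc_prime[OF l] K2_symbol_power_left flip: eq)
  also have "\<dots> = K2_symbol (a ^ l) (inverse (1 - a))"
    using a False \<open>a ^ l \<noteq> 1\<close> K2_symbol_steinberg[of "a ^ l"] by (subst K2_symbol_mult_right) auto
  also have "\<dots> = inv\<^bsub>K2\<^esub> (K2_symbol a (1 - a) [^]\<^bsub>K2\<^esub> l)"
    using a False by (simp add: K2_symbol_power_left K2_symbol_inverse_right)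
  finally show ?thesis using a False by (simp add: K2_symbol_steinberg)
qed (use a in \<open>simp add: cyc_prime[OF l]\<close>)

lemma Phi_val_inverse:
  assumes "a \<noteq> (0::'e::field)" "l \<ge> 1"
  shows "Phi_val l (inverse a) = Phi_val l a * inverse (a ^ (l - 1))"
proof -
  have "Phi_val l a * inverse (a ^ (l - 1)) = (\<Sum>i<l. a ^ i * inverse (a ^ (l - 1)))"
    by (simp add: Phi_val_def sum_distrib_right)
  also have "\<dots> = (\<Sum>i<l. a ^ (l - 1 - i) * inverse (a ^ (l - 1)))"
    by (rule sum.reindex_bij_witness[of _ "\<lambda>i. l - 1 - i" "\<lambda>i. l - 1 - i"]) auto
  also have "\<dots> = (\<Sum>i<l. inverse a ^ i)"
  proof (rule sum.cong)
    fix i assume "i \<in> {..<l}"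
    then have "a ^ (l - 1) = a ^ (l - 1 - i) * a ^ i" by (simp flip: power_add)
    then show "a ^ (l - 1 - i) * inverse (a ^ (l - 1)) = inverse a ^ i"
      using assms by (simp add: field_simps)
  qed simp
  finally show ?thesis by (simp add: Phi_val_def)
qed

text \<open>
  Here \<open>\<Phi>\<^sub>l(1/a) = \<Phi>\<^sub>l(a) / a\<^bsup>l-1\<^esup>\<close>, and \<open>{a, a}\<^bsup>l-1\<^esup> = 1\<close> because \<open>l - 1\<close> is even.
\<close>

lemma cyc_inverse:
  assumes l: "prime l" "odd l" and a: "a \<noteq> 0" "Phi_val l (a::'e::field) \<noteq> 0"
  shows "Phi_val l (inverse a) \<noteq> 0" and "cyc l (inverse a) = inv\<^bsub>K2\<^esub> (cyc l a)"
proof -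
  have l1: "l \<ge> 1" using prime_ge_1_nat[OF l(1)] by simp
  show "Phi_val l (inverse a) \<noteq> 0" using a l1 by (simp add: Phi_val_inverse)
  have "cyc l (inverse a) = inv\<^bsub>K2\<^esub> (K2_symbol a (Phi_val l a * inverse a ^ (l - 1)))"
    using a l1 by (simp add: cyc_prime[OF l(1)] K2_symbol_inverse_left Phi_val_inverse power_inverse)
  also have "\<dots> = inv\<^bsub>K2\<^esub> (K2_symbol a (Phi_val l a) \<otimes>\<^bsub>K2\<^esub> inv\<^bsub>K2\<^esub> (K2_symbol a a [^]\<^bsub>K2\<^esub> (l - 1)))"
    using a by (simp add: K2_symbol_mult_right K2_symbol_power_right K2_symbol_inverse_right K2.nat_pow_inv)
  finally show "cyc l (inverse a) = inv\<^bsub>K2\<^esub> (cyc l a)"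
    using a l l1 by (simp add: K2_symbol_self_even cyc_prime[OF l(1)])
qed

text \<open>
  The characteristic exponent \<open>e\<close>, so that \<open>x \<mapsto> x^(e^s)\<close> is additive in every characteristic.
\<close>

definition char_exp :: "'e::field itself \<Rightarrow> nat" where
  "char_exp _ = (if CHAR('e) = 0 then 1 else CHAR('e))"

lemma char_exp_pos: "char_exp TYPE('e::field) > 0"
  by (simp add: char_exp_def)

lemma prime_CHAR: "CHAR('e::field) \<noteq> 0 \<Longrightarrow> prime CHAR('e)"
  using prime_CHAR_semidom[where 'a = 'e] by simp

lemma frobenius_add:
  fixes x y :: "'e::comm_ring_1"
  assumes "CHAR('e) = 0 \<or> prime CHAR('e)"
  defines "e \<equiv> (if CHAR('e) = 0 then 1 else CHAR('e))"
  shows "(x + y) ^ e ^ s = x ^ e ^ s + y ^ e ^ s"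
  using assms by (auto simp: freshmans_dream')

lemma frobenius_add_field:
  "(x + y :: 'e::field) ^ char_exp TYPE('e) ^ s = x ^ char_exp TYPE('e) ^ s + y ^ char_exp TYPE('e) ^ s"
  using frobenius_add[of x y s] prime_CHAR[where 'e = 'e] by (auto simp: char_exp_def)

lemma frobenius_sum_field:
  "(\<Sum>i\<in>A. f i :: 'e::field) ^ char_exp TYPE('e) ^ s = (\<Sum>i\<in>A. f i ^ char_exp TYPE('e) ^ s)"
  by (induction A rule: infinite_finite_induct)
    (auto simp: frobenius_add_field char_exp_pos power_0_left)

lemma Phi_val_frobenius:
  "Phi_val l (a ^ char_exp TYPE('e) ^ s) = Phi_val l (a :: 'e::field) ^ char_exp TYPE('e) ^ s"
  by (simp add: Phi_val_def frobenius_sum_field mult.commute flip: power_mult)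

text \<open>
  The Frobenius map raises both entries of the symbol to the power \<open>e^s\<close>, whence the square.
\<close>

lemma cyc_frobenius:
  assumes l: "prime l" and a: "a \<noteq> 0" "Phi_val l (a::'e::field) \<noteq> 0"
  shows "cyc l (a ^ char_exp TYPE('e) ^ s) = cyc l a [^]\<^bsub>K2\<^esub> (char_exp TYPE('e) ^ (2 * s))"
  using a by (simp add: cyc_prime[OF l] Phi_val_frobenius K2_symbol_power_left K2_symbol_power_right
      K2.nat_pow_pow mult_2 flip: power_add)

section \<open>Homomorphisms out of \<open>K\<^sub>2\<close>\<close>

text \<open>
  Bimultiplicativity and the Steinberg condition say that the homomorphism induced by \<open>f\<close> on the free
  abelian group kills the three kinds of relators.
\<close>

lemma K2_universal:
  fixes H (structure) and f :: "'e::field \<Rightarrow> 'e \<Rightarrow> 'h"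
  assumes H: "comm_group H"
    and cl: "\<And>a b. a \<noteq> 0 \<Longrightarrow> b \<noteq> 0 \<Longrightarrow> f a b \<in> carrier H"
    and left: "\<And>a b c. a \<noteq> 0 \<Longrightarrow> b \<noteq> 0 \<Longrightarrow> c \<noteq> 0 \<Longrightarrow> f (a * b) c = f a c \<otimes> f b c"
    and right: "\<And>a b c. a \<noteq> 0 \<Longrightarrow> b \<noteq> 0 \<Longrightarrow> c \<noteq> 0 \<Longrightarrow> f a (b * c) = f a b \<otimes> f a c"
    and steinberg: "\<And>a. a \<noteq> 0 \<Longrightarrow> a \<noteq> 1 \<Longrightarrow> f a (1 - a) = \<one>"
  obtains h where "h \<in> hom K2 H" "\<And>a b. a \<noteq> 0 \<Longrightarrow> b \<noteq> 0 \<Longrightarrow> h (K2_symbol a b) = f a b"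
proof -
  interpret H: comm_group H by fact
  have sub: "case_prod f ` ((- {0}) \<times> (- {0})) \<subseteq> carrier H" using cl by auto
  obtain g where g: "g \<in> hom K2_free H"
    and g_of: "\<And>x. x \<in> (- {0}) \<times> (- {0}) \<Longrightarrow> g (frag_of x) = case_prod f x"
    using H.free_Abelian_group_universal[OF sub] unfolding K2_free_def by blast
  interpret g: group_hom K2_free H g by unfold_locales (rule g)
  have g_ab: "g (frag_of (a, b)) = f a b" if "a \<noteq> 0" "b \<noteq> 0" for a b
    using g_of[of "(a, b)"] that by simp
  have g_add: "g (x + y) = g x \<otimes> g y" if "x \<in> carrier K2_free" "y \<in> carrier K2_free" for x y
    using g.hom_mult[OF that] by (simp add: K2_free_def)
  have g_minus: "g (- x) = inv (g x)" if "x \<in> carrier K2_free" for x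
    using g.hom_inv[OF that] that by (simp add: K2_free_def)
  have g_diff: "g (x - y) = g x \<otimes> inv (g y)" if "x \<in> carrier K2_free" "y \<in> carrier K2_free" for x y
    using g_add[of x "- y"] g_minus that by (simp add: K2_free_minus_closed)
  have cancel: "inv y \<otimes> (inv x \<otimes> (x \<otimes> y)) = \<one>" if "x \<in> carrier H" "y \<in> carrier H" for x y
    using that by (simp flip: H.m_assoc)
  have "K2_relators \<subseteq> kernel K2_free H g"
    using K2_relators_subset
    by (auto simp: K2_relators_def kernel_def g_diff g_ab K2_free_diff_closed cl left right steinberg
        H.inv_mult_group H.m_assoc H.m_comm cancel)
  then have "K2_relations \<subseteq> kernel K2_free H g"
    unfolding K2_relations_def by (intro K2_free.generate_subgroup_incl g.subgroup_kernel)
  from g.FactGroup_universal_kernel[OF normal_K2_relations this]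
  obtain h where h: "h \<in> hom (K2_free Mod K2_relations) H"
    "\<And>x. x \<in> carrier K2_free \<Longrightarrow> h (K2_relations #>\<^bsub>K2_free\<^esub> x) = g x" by blast
  show ?thesis
  proof (rule that)
    show "h \<in> hom K2 H" using h(1) by (simp add: K2_eq)
    show "h (K2_symbol a b) = f a b" if "a \<noteq> 0" "b \<noteq> 0" for a b
      using h(2)[of "frag_of (a, b)"] that by (simp add: K2_symbol_def K2_relations_def g_ab)
  qed
qed

definition mult_group :: "'k::field monoid" where
  "mult_group = \<lparr>carrier = - {0}, monoid.mult = (*), one = 1\<rparr>"

lemma mult_group_simps [simp]:
  "carrier mult_group = - {0}" "x \<otimes>\<^bsub>mult_group\<^esub> y = x * y" "\<one>\<^bsub>mult_group\<^esub> = 1"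
  by (simp_all add: mult_group_def)

lemma comm_group_mult_group: "comm_group (mult_group :: 'k::field monoid)"
  by (rule comm_groupI) (auto intro!: exI[of _ "inverse _"] bexI[of _ "inverse _"])

section \<open>The tame symbol of formal Laurent series\<close>

abbreviation lc :: "'k::field fls \<Rightarrow> 'k" where
  "lc u \<equiv> fls_nth u (fls_subdegree u)"

text \<open>
  This is the residue of \<open>(-1)\<^bsup>v(a) v(b)\<^esup> a\<^bsup>v(b)\<^esup> / b\<^bsup>v(a)\<^esup>\<close>, a series of order zero; only the
  leading coefficients contribute to its constant term.
\<close>

definition tame :: "'k::field fls \<Rightarrow> 'k fls \<Rightarrow> 'k" where
  "tame u v = (- 1) powi (fls_subdegree u * fls_subdegree v)
     * lc u powi fls_subdegree v / lc v powi fls_subdegree u"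

lemma lc_mult: "u \<noteq> 0 \<Longrightarrow> v \<noteq> 0 \<Longrightarrow> lc (u * v) = lc u * lc (v :: 'k::field fls)"
  by simp

lemma tame_nonzero: "u \<noteq> 0 \<Longrightarrow> v \<noteq> 0 \<Longrightarrow> tame u v \<noteq> 0"
  by (simp add: tame_def)

lemma tame_mult_left:
  "u \<noteq> 0 \<Longrightarrow> v \<noteq> 0 \<Longrightarrow> w \<noteq> 0 \<Longrightarrow> tame (u * v) w = tame u w * tame v w"
  by (simp add: tame_def lc_mult power_int_mult_distrib power_int_add distrib_right divide_simps)

lemma tame_mult_right:
  "u \<noteq> 0 \<Longrightarrow> v \<noteq> 0 \<Longrightarrow> w \<noteq> 0 \<Longrightarrow> tame u (v * w) = tame u v * tame u w"
  by (simp add: tame_def lc_mult power_int_mult_distrib power_int_add distrib_left divide_simps)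

lemma tame_steinberg:
  assumes u: "u \<noteq> 0" "u \<noteq> (1 :: 'k::field fls)"
  shows "tame u (1 - u) = 1"
proof -
  let ?m = "fls_subdegree u"
  consider "?m > 0" | "?m < 0" | "?m = 0" "fls_nth u 0 \<noteq> 1" | "?m = 0" "fls_nth u 0 = 1" by linarith
  then show ?thesis
  proof cases
    case 1
    then have "fls_subdegree (1 - u) = 0" by (intro fls_subdegree_eqI) auto
    then show ?thesis using 1 by (simp add: tame_def)
  next
    case 2
    then have sd: "fls_subdegree (1 - u) = ?m" using u by (intro fls_subdegree_eqI) auto
    have "even (?m * ?m) \<longleftrightarrow> even ?m" by simp
    then have "(- 1 :: 'k) powi (?m * ?m) = (- 1) powi ?m"
      by (simp add: power_int_minus_left)
    moreover have "(- 1 :: 'k) powi ?m * lc u powi ?m = (- lc u) powi ?m"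
      by (simp flip: power_int_mult_distrib)
    ultimately show ?thesis using 2 u by (simp add: tame_def sd)
  next
    case 3
    then have "fls_subdegree (1 - u) = 0" by (intro fls_subdegree_eqI) auto
    then show ?thesis using 3 by (simp add: tame_def)
  next
    case 4
    then show ?thesis by (simp add: tame_def)
  qed
qed

lemma tame_one_right [simp]: "tame u 1 = 1"
  by (simp add: tame_def)

lemma tame_power_right: "u \<noteq> 0 \<Longrightarrow> v \<noteq> 0 \<Longrightarrow> tame u (v ^ n) = tame u v ^ n"
  by (induction n) (simp_all add: tame_mult_right)

text \<open>
  If \<open>u\<close> has positive order then \<open>\<Phi>\<^sub>l(u)\<close> has constant term 1. A pole is reduced to this case by
  \<open>\<Phi>\<^sub>l(u) = \<Phi>\<^sub>l(1/u) u\<^bsup>l-1\<^esup>\<close>, since \<open>l - 1\<close> is even and the tame symbol of \<open>u\<close> with itself is a sign.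
\<close>

lemma tame_Phi_val:
  assumes l: "odd l" and u: "u \<noteq> 0" "Phi_val l (u :: 'k::field fls) \<noteq> 0"
  shows "tame u (Phi_val l u) =
    (if fls_subdegree u = 0 then fls_nth u 0 powi fls_subdegree (Phi_val l u) else 1)"
proof -
  have pos: "fls_subdegree (Phi_val l w) = 0 \<and> fls_nth (Phi_val l w) 0 = 1" if "fls_subdegree w > 0" for w :: "'k fls"
  proof -
    have nth: "fls_nth (Phi_val l w) k = (if k = 0 then 1 else 0)" if "k \<le> 0" for k
    proof -
      have "fls_nth (w ^ i) k = (if i = 0 \<and> k = 0 then 1 else 0)" for i
      proof (cases "i = 0")
        case False
        then have "int i * fls_subdegree w > 0" using \<open>fls_subdegree w > 0\<close> by simp
        then show ?thesis using False \<open>k \<le> 0\<close> by (simp add: fls_pow_nth_below_subdegree)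
      qed simp
      then have "fls_nth (Phi_val l w) k = (\<Sum>i<l. if i = 0 \<and> k = 0 then 1 else 0)"
        by (simp add: Phi_val_def fls_nth_sum)
      also have "\<dots> = (\<Sum>i\<in>{0::nat}. if i = 0 \<and> k = 0 then 1 else 0)"
        using l odd_pos[of l] by (intro sum.mono_neutral_right) auto
      finally show ?thesis by simp
    qed
    have "fls_subdegree (Phi_val l w) = 0" by (intro fls_subdegree_eqI) (simp_all add: nth)
    then show ?thesis by (simp add: nth)
  qed
  consider "fls_subdegree u > 0" | "fls_subdegree u = 0" | "fls_subdegree u < 0" by linarith
  then show ?thesis
  proof cases
    case 1
    then show ?thesis using pos[OF 1] by (simp add: tame_def)
  next
    case 2
    then show ?thesis by (simp add: tame_def)
  next
    case 3
    let ?w = "inverse u"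
    have "fls_subdegree ?w > 0" using 3 by simp
    note pos = pos[OF this]
    have "Phi_val l ?w \<noteq> 0" using pos by auto
    have "Phi_val l u = Phi_val l ?w * u ^ (l - 1)"
      using u odd_pos[OF l] by (simp add: Phi_val_inverse)
    then have "tame u (Phi_val l u) = tame u (Phi_val l ?w) * tame u u ^ (l - 1)"
      using u \<open>Phi_val l ?w \<noteq> 0\<close> by (simp add: tame_mult_right tame_power_right)
    also have "tame u (Phi_val l ?w) = 1" using pos by (simp add: tame_def)
    also have "tame u u ^ (l - 1) = 1"
      using u l by (simp add: tame_def power_int_power' power_int_minus_left)
    finally show ?thesis using 3 by simp
  qed
qed

section \<open>Polynomials over the algebraic closure\<close>

text \<open>
  Rational functions are evaluated at points of the algebraic closure: \<open>mp p\<close> is \<open>p\<close> with its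
  coefficients embedded there, and \<open>ev p y\<close> its value at \<open>y\<close>.
\<close>

abbreviation mp :: "'a::field poly \<Rightarrow> 'a alg_closure poly" where
  "mp \<equiv> map_poly to_ac"

definition ev :: "'a::field poly \<Rightarrow> 'a alg_closure \<Rightarrow> 'a alg_closure" where
  "ev p y = poly (mp p) y"

lemma mp_1 [simp]: "mp 1 = 1" by simp

lemma mp_add [simp]: "mp (p + q) = mp p + mp q"
  by (rule poly_eqI) (simp add: coeff_map_poly)

lemma mp_uminus [simp]: "mp (- p) = - mp p"
  by (rule poly_eqI) (simp add: coeff_map_poly)

lemma mp_diff [simp]: "mp (p - q) = mp p - mp q"
  by (rule poly_eqI) (simp add: coeff_map_poly)

lemma mp_mult [simp]: "mp (p * q) = mp p * mp q"
  by (rule poly_eqI) (simp add: coeff_map_poly coeff_mult to_ac_sum)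

lemma mp_power [simp]: "mp (p ^ n) = mp p ^ n"
  by (induction n) simp_all

lemma mp_sum [simp]: "mp (\<Sum>i\<in>A. f i) = (\<Sum>i\<in>A. mp (f i))"
  by (induction A rule: infinite_finite_induct) simp_all

lemma mp_pCons [simp]: "mp (pCons a p) = pCons (to_ac a) (mp p)"
  by (simp add: map_poly_pCons)

lemma mp_monom [simp]: "mp (monom c n) = monom (to_ac c) n"
  by (simp add: map_poly_monom)

lemma mp_pcompose [simp]: "mp (pcompose p q) = pcompose (mp p) (mp q)"
  by (induction p) (simp_all add: pcompose_pCons)

lemma mp_pderiv [simp]: "mp (pderiv p) = pderiv (mp p)"
  by (rule poly_eqI) (simp add: coeff_map_poly coeff_pderiv)

lemma mp_eq_0_iff [simp]: "mp p = 0 \<longleftrightarrow> p = 0"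
  by (rule map_poly_eq_0_iff) simp_all

lemma degree_mp [simp]: "degree (mp p) = degree p"
  by (rule degree_map_poly) simp

lemma ev_simps [simp]:
  "ev 0 y = 0" "ev 1 y = 1" "ev (p + q) y = ev p y + ev q y" "ev (p - q) y = ev p y - ev q y"
  "ev (p * q) y = ev p y * ev q y" "ev (p ^ n) y = ev p y ^ n" "ev (- p) y = - ev p y"
  "ev (pCons a p) y = to_ac a + y * ev p y"
  "ev (pcompose p q) y = ev p (ev q y)"
  "ev (monom c n) y = to_ac c * y ^ n"
  "ev (\<Sum>i\<in>A. f i) y = (\<Sum>i\<in>A. ev (f i) y)"
  by (simp_all add: ev_def poly_pcompose poly_monom poly_sum)

lemma to_ac_of_nat_eq_0_iff: "(of_nat n :: 'a::field alg_closure) = 0 \<longleftrightarrow> (of_nat n :: 'a) = 0"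
  using to_ac_eq_0_iff[of "of_nat n"] by simp

text \<open>
  Otherwise the polynomial \<open>1 + \<Prod> (X - x)\<close> would have no root.
\<close>

lemma infinite_alg_closed: "infinite (UNIV :: 'a::field alg_closure set)"
proof
  assume fin: "finite (UNIV :: 'a alg_closure set)"
  define p :: "'a alg_closure poly" where "p = (\<Prod>x\<in>UNIV. [:- x, 1:]) + 1"
  have "poly p x = 1" for x
  proof -
    have "(\<Prod>y\<in>UNIV. poly [:- y, 1:] x) = 0" by (rule prod_zero[OF fin]) (auto intro!: exI[of _ x])
    then show ?thesis by (simp add: p_def poly_prod)
  qed
  moreover have "degree p > 0"
  proof -
    have "degree (\<Prod>x\<in>(UNIV :: 'a alg_closure set). [:- x, 1:]) = card (UNIV :: 'a alg_closure set)"
      by (subst degree_prod_eq_sum_degree) auto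
    then have "degree (\<Prod>x\<in>(UNIV :: 'a alg_closure set). [:- x, 1:]) > 0"
      using fin by (simp add: card_gt_0_iff)
    then show ?thesis unfolding p_def by (subst degree_add_eq_left) auto
  qed
  ultimately show False using alg_closed_imp_poly_has_root[of p] by auto
qed

lemma poly_zero_cofinite:
  assumes "\<And>y. poly (b::'a::field alg_closure poly) y \<noteq> 0 \<Longrightarrow> poly p y = 0" "b \<noteq> 0"
  shows "p = 0"
proof -
  have "poly (p * b) y = 0" for y using assms(1)[of y] by auto
  then have "{y. poly (p * b) y = 0} = UNIV" by blast
  then have "p * b = 0" using poly_roots_finite[of "p * b"] infinite_alg_closed by metis
  then show ?thesis using assms by simp
qed

lemma ev_eq_0_cofinite:
  assumes "\<And>y. ev b y \<noteq> 0 \<Longrightarrow> ev p y = 0" "b \<noteq> 0"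
  shows "p = 0"
  using poly_zero_cofinite[of "mp b" "mp p"] assms by (simp add: ev_def)

text \<open>
  Coprimality, stated in terms of points because this form passes directly through substitutions
  \<open>x \<mapsto> x\<^sup>q\<close>; it is equivalent to a Bezout identity over the base field.
\<close>

definition no_common_root :: "'a::field poly \<Rightarrow> 'a poly \<Rightarrow> bool" where
  "no_common_root g h \<longleftrightarrow> (\<forall>y. ev g y \<noteq> 0 \<or> ev h y \<noteq> 0)"

text \<open>Division with remainder: an element of least degree of the ideal \<open>(g, h)\<close> generates it.\<close>

lemma bezout_poly:
  fixes g h :: "'a::field poly"
  assumes "g \<noteq> 0 \<or> h \<noteq> 0"
  obtains D u v where "D \<noteq> 0" "D dvd g" "D dvd h" "D = u * g + v * h"
proof -
  define I where "I = {D. D \<noteq> 0 \<and> (\<exists>u v. D = u * g + v * h)}"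
  have "g = 1 * g + 0 * h" "h = 0 * g + 1 * h" by simp_all
  then have "g \<noteq> 0 \<Longrightarrow> g \<in> I" "h \<noteq> 0 \<Longrightarrow> h \<in> I" unfolding I_def by blast+
  then have "\<exists>D. D \<in> I" using assms by blast
  then obtain D where D: "D \<in> I" and min: "\<And>E. E \<in> I \<Longrightarrow> degree D \<le> degree E"
    using ex_has_least_nat[of "\<lambda>D. D \<in> I" _ degree] by blast
  obtain u v where uv: "D \<noteq> 0" "D = u * g + v * h" using D by (auto simp: I_def)
  have *: "D dvd f" if f: "f = s * g + t * h" for f s t
  proof (rule ccontr)
    assume "\<not> D dvd f"
    then have nz: "f mod D \<noteq> 0" by (simp add: dvd_eq_mod_eq_0)
    have "f mod D = f - (f div D) * D" by (rule minus_div_mult_eq_mod[symmetric])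
    also have "\<dots> = (s * g + t * h) - (f div D) * (u * g + v * h)" using f uv(2) by simp
    also have "\<dots> = (s - (f div D) * u) * g + (t - (f div D) * v) * h"
      by (simp add: algebra_simps)
    finally have "f mod D \<in> I" using nz unfolding I_def by blast
    from min[OF this] show False using degree_mod_less'[OF uv(1) nz] by simp
  qed
  show ?thesis
    using that[OF uv(1) _ _ uv(2)] *[of g 1 0] *[of h 0 1] by simp
qed

lemma no_common_root_bezout:
  fixes g h :: "'a::field poly"
  assumes "no_common_root g h"
  obtains u v where "u * g + v * h = 1"
proof -
  have "g \<noteq> 0 \<or> h \<noteq> 0" using assms by (auto simp: no_common_root_def)
  then obtain D u v where D: "D \<noteq> 0" "D dvd g" "D dvd h" "D = u * g + v * h"
    by (rule bezout_poly)
  have "degree D = 0"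
  proof (rule ccontr)
    assume "degree D \<noteq> 0"
    then obtain y where "poly (mp D) y = 0"
      using alg_closed_imp_poly_has_root[of "mp D"] by auto
    then have "ev D y = 0" by (simp add: ev_def)
    then have "ev g y = 0" "ev h y = 0" using D(2,3) by (auto simp: dvd_def)
    then show False using assms by (auto simp: no_common_root_def)
  qed
  then obtain c where c: "D = [:c:]" by (rule degree_eq_zeroE)
  then have "c \<noteq> 0" using D by auto
  have "([:inverse c:] * u) * g + ([:inverse c:] * v) * h = [:inverse c:] * D"
    by (simp add: D(4) algebra_simps)
  also have "\<dots> = 1" using \<open>c \<noteq> 0\<close> by (simp add: c)
  finally show ?thesis by (rule that)
qed

lemma coprime_fraction:
  fixes f :: "'a::field poly fract"
  obtains g h where "f = Fract g h" "h \<noteq> 0" "no_common_root g h"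
proof -
  obtain g0 h0 where f: "f = Fract g0 h0" "h0 \<noteq> 0" by (cases f) auto
  obtain D u v where D: "D \<noteq> 0" "D dvd g0" "D dvd h0" "D = u * g0 + v * h0"
    using bezout_poly[of g0 h0] f by blast
  obtain g h where gh: "g0 = D * g" "h0 = D * h" using D(2,3) unfolding dvd_def by blast
  have "D * (u * g + v * h) = D * 1" using D(4) by (simp add: gh algebra_simps)
  then have 1: "u * g + v * h = 1" using D(1) by (subst (asm) mult_cancel_left) simp
  have "ev u y * ev g y + ev v y * ev h y = 1" for y
    using arg_cong[OF 1, of "\<lambda>p. ev p y"] by simp
  then have "no_common_root g h" unfolding no_common_root_def
    by (metis add.right_neutral mult_zero_right zero_neq_one)
  moreover have "f = Fract g h" "h \<noteq> 0" using f gh D(1) by (auto simp: eq_fract)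
  ultimately show ?thesis using that by blast
qed

lemma order_mp_pos_iff: "p \<noteq> 0 \<Longrightarrow> order y (mp p) > 0 \<longleftrightarrow> ev p y = 0"
  by (simp add: ev_def order_root)

section \<open>Tame symbols of the rational function field\<close>

definition taylor :: "'k::field \<Rightarrow> 'k poly \<Rightarrow> 'k fls" where
  "taylor y p = fps_to_fls (fps_of_poly (pcompose p [:y, 1:]))"

lemma taylor_simps [simp]:
  "taylor y 0 = 0" "taylor y 1 = 1" "taylor y (p + q) = taylor y p + taylor y q"
  "taylor y (p * q) = taylor y p * taylor y q"
  by (simp_all add: taylor_def pcompose_add pcompose_mult pcompose_1 fps_of_poly_add fps_of_poly_mult
      fls_times_fps_to_fls)

lemma taylor_power [simp]: "taylor y (p ^ n) = taylor y p ^ n"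
  by (induction n) simp_all

lemma taylor_eq_0_iff [simp]: "taylor y p = 0 \<longleftrightarrow> p = 0"
  using pcompose_eq_0[of p "[:y, 1:]"] fps_of_poly_eq_iff[of "pcompose p [:y, 1:]" 0]
  by (auto simp: taylor_def)

lemma taylor_nonroot:
  assumes "poly p y \<noteq> 0"
  shows "fls_subdegree (taylor y p) = 0" "fls_nth (taylor y p) 0 = poly p y"
proof -
  show *: "fls_nth (taylor y p) 0 = poly p y" by (simp add: taylor_def)
  have "fls_subdegree (taylor y p) \<le> 0" using assms * by (intro fls_subdegree_leI) auto
  moreover have "fls_subdegree (taylor y p) \<ge> 0"
    unfolding taylor_def by (rule fls_subdegree_fls_to_fps_gt0)
  ultimately show "fls_subdegree (taylor y p) = 0" by simp
qed

lemma fls_subdegree_taylor: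
  assumes "p \<noteq> 0"
  shows "fls_subdegree (taylor y p) = int (order y p)"
proof -
  let ?n = "order y p"
  obtain q where q: "p = [:- y, 1:] ^ ?n * q" "\<not> [:- y, 1:] dvd q"
    using order_decomp[OF assms] by blast
  then have q0: "q \<noteq> 0" "poly q y \<noteq> 0" by (auto simp: poly_eq_0_iff_dvd)
  have X: "taylor y [:- y, 1:] = fls_X" by (simp add: taylor_def pcompose_pCons)
  have "taylor y p = fls_X ^ ?n * taylor y q" by (subst q(1)) (simp add: X)
  then show ?thesis using q0 taylor_nonroot(1)[OF q0(2)] by simp
qed

text \<open>
  The field embedding of \<open>F(x)\<close> into \<open>K((t))\<close> that sends \<open>x\<close> to \<open>y + t\<close>. All ways of writing \<open>u\<close> as a
  fraction give the same quotient, so the description is definite.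
\<close>

definition expand_at :: "'a::field alg_closure \<Rightarrow> 'a poly fract \<Rightarrow> 'a alg_closure fls" where
  "expand_at y u = (THE z. \<exists>g h. h \<noteq> 0 \<and> u = Fract g h \<and> z = taylor y (mp g) / taylor y (mp h))"

lemma expand_at_Fract:
  assumes "h \<noteq> 0"
  shows "expand_at y (Fract g h) = taylor y (mp g) / taylor y (mp h)"
  unfolding expand_at_def
proof (rule the_equality)
  fix z assume "\<exists>g' h'. h' \<noteq> 0 \<and> Fract g h = Fract g' h' \<and> z = taylor y (mp g') / taylor y (mp h')"
  then obtain g' h' where gh: "h' \<noteq> 0" "g * h' = g' * h" "z = taylor y (mp g') / taylor y (mp h')"
    using assms by (auto simp: eq_fract)
  have "taylor y (mp g) * taylor y (mp h') = taylor y (mp g') * taylor y (mp h)"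
    using arg_cong[OF gh(2), of "\<lambda>p. taylor y (mp p)"] by simp
  then show "z = taylor y (mp g) / taylor y (mp h)" using gh assms by (simp add: frac_eq_eq)
qed (use assms in blast)

lemma expand_at_hom [simp]:
  "expand_at y 0 = 0" "expand_at y 1 = 1" "expand_at y (u + v) = expand_at y u + expand_at y v" "expand_at y (u * v) = expand_at y u * expand_at y v"
proof -
  show "expand_at y 0 = 0" "expand_at y 1 = 1" by (simp_all add: Zero_fract_def One_fract_def expand_at_Fract)
  obtain a b where u: "u = Fract a b" "b \<noteq> 0" by (cases u) auto
  obtain c d where v: "v = Fract c d" "d \<noteq> 0" by (cases v) auto
  show "expand_at y (u + v) = expand_at y u + expand_at y v" "expand_at y (u * v) = expand_at y u * expand_at y v"
    using u(2) v(2) by (simp_all add: u(1) v(1) expand_at_Fract add_frac_eq)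
qed

lemma expand_at_eq_0_iff [simp]: "expand_at y u = 0 \<longleftrightarrow> u = 0"
proof
  assume *: "expand_at y u = 0"
  show "u = 0"
  proof (rule ccontr)
    assume "u \<noteq> 0"
    then have "expand_at y u * expand_at y (inverse u) = 1" by (simp flip: expand_at_hom(4))
    then show False using * by simp
  qed
qed simp

lemma expand_at_minus [simp]: "expand_at y (u - v) = expand_at y u - expand_at y v"
  using expand_at_hom(3)[of y "u - v" v] by (simp add: algebra_simps)

lemma expand_at_power [simp]: "expand_at y (u ^ n) = expand_at y u ^ n"
  by (induction n) simp_all

lemma expand_at_Phi_val: "expand_at y (Phi_val l u) = Phi_val l (expand_at y u)"
proof -
  have "expand_at y (\<Sum>i\<in>A. u ^ i) = (\<Sum>i\<in>A. expand_at y u ^ i)" for A :: "nat set"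
    by (induction A rule: infinite_finite_induct) simp_all
  then show ?thesis by (simp add: Phi_val_def)
qed

text \<open>
  \<open>\<Phi>\<^sub>l\<close> as a binary form: for \<open>b \<noteq> 0\<close> it is \<open>b\<^bsup>l-1\<^esup> \<Phi>\<^sub>l(a/b)\<close>. Its zeros on the numerator and
  denominator of \<open>f\<close> are the points where \<open>f\<close> takes a root of \<open>\<Phi>\<^sub>l\<close> as value.
\<close>

definition Phi_form :: "nat \<Rightarrow> 'e::comm_ring_1 \<Rightarrow> 'e \<Rightarrow> 'e" where
  "Phi_form l a b = (\<Sum>i<l. a ^ i * b ^ (l - 1 - i))"

lemma Phi_form_mult: "(a - b) * Phi_form l a b = a ^ l - b ^ l"
proof (cases l)
  case (Suc n)
  then show ?thesis by (simp add: Phi_form_def diff_power_eq_sum del: power_Suc)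
qed (simp add: Phi_form_def)

lemma Phi_form_divide:
  assumes "b \<noteq> (0 :: 'e::field)"
  shows "Phi_form l a b = b ^ (l - 1) * Phi_val l (a / b)"
proof -
  have "a ^ i * b ^ (l - 1 - i) = b ^ (l - 1) * (a / b) ^ i" if "i < l" for i
  proof -
    have "b ^ (l - 1) = b ^ (l - 1 - i) * b ^ i" using that by (simp flip: power_add)
    then show ?thesis using assms by (simp add: power_divide)
  qed
  then show ?thesis by (simp add: Phi_form_def Phi_val_def sum_distrib_left)
qed

lemma Phi_form_zero_right: "l \<ge> 1 \<Longrightarrow> Phi_form l a (0 :: 'e::comm_ring_1) = a ^ (l - 1)"
proof -
  assume l: "l \<ge> 1"
  have "Phi_form l a 0 = (\<Sum>i\<in>{l - 1}. a ^ i * 0 ^ (l - 1 - i))"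
    unfolding Phi_form_def using l by (intro sum.mono_neutral_right) (auto simp: power_0_left)
  then show ?thesis by simp
qed

lemma Fract_power: "Fract g h ^ n = Fract (g ^ n) (h ^ n)"
  by (induction n) (simp_all add: One_fract_def)

lemma Phi_val_Fract:
  assumes "h \<noteq> 0" "l \<ge> 1"
  shows "Phi_val l (Fract g h) = Fract (Phi_form l g h) (h ^ (l - 1))"
proof -
  let ?e = "\<lambda>p. Fract p 1"
  have h: "?e h \<noteq> 0" using assms by (simp add: eq_fract Zero_fract_def)
  have gh: "Fract g h = ?e g / ?e h" by simp
  have add: "?e (p + q) = ?e p + ?e q" for p q by simp
  have sum: "?e (\<Sum>i\<in>A. f i) = (\<Sum>i\<in>A. ?e (f i))" for A and f :: "nat \<Rightarrow> _"
    by (induction A rule: infinite_finite_induct) (simp_all add: Zero_fract_def add del: add_fract)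
  have "?e (Phi_form l g h) = Phi_form l (?e g) (?e h)"
    by (simp add: Phi_form_def sum Fract_power)
  also have "\<dots> = ?e h ^ (l - 1) * Phi_val l (Fract g h)" unfolding gh by (rule Phi_form_divide[OF h])
  finally have "Phi_val l (Fract g h) = ?e (Phi_form l g h) / ?e h ^ (l - 1)" using h by simp
  then show ?thesis by (simp add: Fract_power)
qed

lemma ev_Phi_form [simp]: "ev (Phi_form l g h) y = Phi_form l (ev g y) (ev h y)"
  by (simp add: Phi_form_def)

lemma Phi_form_root_nonzero:
  assumes "Phi_form l (ev g y) (ev h y) = 0" "no_common_root g h" "l \<ge> 1"
  shows "ev g y \<noteq> 0" "ev h y \<noteq> 0"
proof -
  have "ev g y ^ l = ev h y ^ l" using Phi_form_mult[of "ev g y" "ev h y" l] assms by simp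
  then have "ev g y = 0 \<longleftrightarrow> ev h y = 0" using assms(3) by (metis power_eq_0_iff zero_less_one order_less_le_trans)
  then show "ev g y \<noteq> 0" "ev h y \<noteq> 0" using assms(2) by (auto simp: no_common_root_def)
qed

text \<open>
  At a root of the form, coprimality makes \<open>g\<close> and \<open>h\<close> nonzero, so that \<open>g/h\<close> is a unit there.
  Elsewhere either \<open>g/h\<close> and \<open>\<Phi>\<^sub>l(g/h)\<close> are both units, or \<open>g/h\<close> has a zero or a pole, where the
  symbol is trivial.
\<close>

lemma tame_expand_at_Phi_val:
  assumes l: "odd l" and gh: "g \<noteq> 0" "h \<noteq> 0" "no_common_root g h" and Q: "Phi_form l g h \<noteq> 0"
  shows "tame (expand_at y (Fract g h)) (expand_at y (Phi_val l (Fract g h))) =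
    (if ev (Phi_form l g h) y = 0 then (ev g y / ev h y) ^ order y (mp (Phi_form l g h)) else 1)"
proof -
  have l1: "l \<ge> 1" using odd_pos[OF l] by simp
  let ?Q = "Phi_form l g h" and ?f = "Fract g h"
  let ?u = "expand_at y ?f"
  let ?ord = "\<lambda>p. order y (mp p)"
  have f0: "?f \<noteq> 0" using gh by (simp add: Zero_fract_def eq_fract)
  have Phi_val: "Phi_val l ?f = Fract ?Q (h ^ (l - 1))" using gh l1 by (intro Phi_val_Fract)
  have Phi_val0: "Phi_val l ?f \<noteq> 0" using gh Q by (simp add: Phi_val Zero_fract_def eq_fract)
  have u: "?u = taylor y (mp g) / taylor y (mp h)" using gh by (intro expand_at_Fract)
  have sdu: "fls_subdegree ?u = int (?ord g) - int (?ord h)"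
    using gh by (simp add: u fls_divide_subdegree fls_subdegree_taylor)
  have sdg: "fls_subdegree (Phi_val l ?u) = int (?ord ?Q) - int (l - 1) * int (?ord h)"
  proof -
    have "Phi_val l ?u = taylor y (mp ?Q) / taylor y (mp h) ^ (l - 1)"
      unfolding expand_at_Phi_val[symmetric] Phi_val using gh by (simp add: expand_at_Fract del: mp_sum)
    then show ?thesis using gh Q by (simp add: fls_divide_subdegree fls_subdegree_pow fls_subdegree_taylor)
  qed
  have eq: "tame ?u (expand_at y (Phi_val l ?f)) =
      (if fls_subdegree ?u = 0 then fls_nth ?u 0 powi fls_subdegree (Phi_val l ?u) else 1)"
    using l f0 Phi_val0 by (subst expand_at_Phi_val, intro tame_Phi_val) (simp_all flip: expand_at_Phi_val)
  show ?thesis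
  proof (cases "fls_subdegree ?u = 0")
    case True
    have nz: "ev g y \<noteq> 0" "ev h y \<noteq> 0"
      using True sdu gh order_mp_pos_iff[of g y] order_mp_pos_iff[of h y]
      by (auto simp: no_common_root_def)
    then have 0: "?ord h = 0" "?ord g = 0" using gh by (auto simp: ev_def order_root)
    have "?u * taylor y (mp h) = taylor y (mp g)" using gh by (simp add: u)
    then have "fls_nth ?u 0 * ev h y = ev g y"
      using lc_mult[of ?u "taylor y (mp h)"] True nz gh f0 by (simp add: taylor_nonroot ev_def)
    then have "fls_nth ?u 0 = ev g y / ev h y" using nz by (simp add: field_simps)
    then show ?thesis using eq True sdg 0 Q order_mp_pos_iff[of ?Q y] by (cases "ev ?Q y = 0") auto
  next
    case False
    then have "ev g y = 0 \<or> ev h y = 0" using sdu gh by (auto simp: ev_def order_root)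
    then have "ev ?Q y \<noteq> 0" using Phi_form_root_nonzero[OF _ gh(3) l1, of y] by auto
    then show ?thesis using eq False by simp
  qed
qed

text \<open>
  The exponent is the multiplicity of \<open>y\<close> in the fibre of \<open>g/h\<close> over a root of \<open>\<Phi>\<^sub>l\<close>; as such a
  root has order \<open>l\<close>, the homomorphism detects the fibre points whose multiplicity is prime to \<open>l\<close>.
\<close>

lemma tame_symbol_at:
  fixes y :: "'a::field alg_closure"
  assumes l: "prime l" "odd l"
  obtains tm where "tm \<in> hom K2 (mult_group :: 'a alg_closure monoid)"
    "\<And>g h. \<lbrakk>g \<noteq> 0; h \<noteq> 0; no_common_root g h; Phi_form l g h \<noteq> 0\<rbrakk> \<Longrightarrow>
      tm (cyc l (Fract g h)) =
        (if ev (Phi_form l g h) y = 0 then (ev g y / ev h y) ^ order y (mp (Phi_form l g h)) else 1)"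
proof -
  obtain tm where h: "tm \<in> hom K2 (mult_group :: 'a alg_closure monoid)"
    and td: "\<And>a b. a \<noteq> 0 \<Longrightarrow> b \<noteq> 0 \<Longrightarrow> tm (K2_symbol a b) = tame (expand_at y a) (expand_at y b)"
    by (rule K2_universal[OF comm_group_mult_group, of "\<lambda>a b. tame (expand_at y a) (expand_at y b)"])
      (auto simp: tame_nonzero tame_mult_left tame_mult_right intro!: tame_steinberg,
       metis eq_iff_diff_eq_0 expand_at_eq_0_iff expand_at_hom(2) expand_at_minus)
  show ?thesis
  proof (rule that[OF h])
    fix g h :: "'a poly"
    assume gh: "g \<noteq> 0" "h \<noteq> 0" "no_common_root g h" "Phi_form l g h \<noteq> 0"
    have "Fract g h \<noteq> 0" using gh by (simp add: Zero_fract_def eq_fract)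
    moreover have "Phi_val l (Fract g h) \<noteq> 0"
      using gh prime_ge_1_nat[OF l(1)] by (simp add: Phi_val_Fract Zero_fract_def eq_fract)
    ultimately show "tm (cyc l (Fract g h)) =
        (if ev (Phi_form l g h) y = 0 then (ev g y / ev h y) ^ order y (mp (Phi_form l g h)) else 1)"
      using td[of "Fract g h" "Phi_val l (Fract g h)"] tame_expand_at_Phi_val[OF l(2) gh, of y] by (simp add: cyc_prime[OF l(1)])
  qed
qed

section \<open>Irreducibility of the cyclotomic polynomial\<close>

lemma coeff_mult_top:
  assumes "degree p \<le> m" "degree q \<le> n"
  shows "coeff (p * q) (m + n) = coeff p m * coeff q n"
proof -
  have "coeff p i * coeff q (m + n - i) = 0" if "i \<le> m + n" "i \<noteq> m" for i
  proof (cases "i < m")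
    case True
    then have "coeff q (m + n - i) = 0" using assms by (intro coeff_eq_0) simp
    then show ?thesis by simp
  next
    case False
    then have "coeff p i = 0" using assms that by (intro coeff_eq_0) simp
    then show ?thesis by simp
  qed
  then have "coeff (p * q) (m + n) = (\<Sum>i\<in>{m}. coeff p i * coeff q (m + n - i))"
    unfolding coeff_mult by (intro sum.mono_neutral_right) auto
  then show ?thesis by simp
qed

lemma coeff_power_top:
  assumes "degree p \<le> m"
  shows "coeff (p ^ k) (k * m) = coeff p m ^ k" "degree (p ^ k) \<le> k * m"
proof -
  show deg: "degree (p ^ k) \<le> k * m" for k
    using degree_power_le[of p k] assms by (metis mult.commute mult_le_mono2 order_trans)
  show "coeff (p ^ k) (k * m) = coeff p m ^ k"
    by (induction k) (simp_all add: coeff_mult_top[OF assms deg])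
qed

locale irreducible_cyclotomic =
  fixes l :: nat and field_type :: "'a::field itself"
  assumes prime_l: "prime l" and l_ge_5: "l \<ge> 5"
    and irreducible_Phi: "irreducible (cyclotomic_poly l :: 'a poly)"
begin

definition roots_Phi :: "'a alg_closure set" where
  "roots_Phi = {s. Phi_val l s = 0}"

lemma l_ge_1: "l \<ge> 1" using l_ge_5 by simp

lemma odd_l: "odd l"
  using prime_l l_ge_5 by (simp add: prime_odd_nat)

lemma degree_Phi: "degree (cyclotomic_poly l :: 'a poly) = l - 1"
  and coeff_Phi: "coeff (cyclotomic_poly l :: 'a poly) k = (if k < l then 1 else 0)"
proof -
  show c: "coeff (cyclotomic_poly l :: 'a poly) k = (if k < l then 1 else 0)" for k
    by (simp add: cyclotomic_poly_prime[OF prime_l] coeff_sum)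
  show "degree (cyclotomic_poly l :: 'a poly) = l - 1"
    using l_ge_1 by (intro antisym degree_le le_degree) (auto simp: c)
qed

lemma ev_Phi: "ev (cyclotomic_poly l :: 'a poly) s = Phi_val l s"
  by (simp add: cyclotomic_poly_prime[OF prime_l] Phi_val_def)

text \<open>
  \<open>\<Phi>\<^sub>l\<close> is irreducible, hence the minimal polynomial of each of its roots.
\<close>

lemma roots_Phi_min_degree:
  fixes N :: "'a poly"
  assumes s: "s \<in> roots_Phi" and N: "ev N s = 0" "degree N < l - 1"
  shows "N = 0"
proof (rule ccontr)
  assume N0: "N \<noteq> 0"
  let ?Phi = "cyclotomic_poly l :: 'a poly"
  obtain D u v where D: "D \<noteq> 0" "D dvd ?Phi" "D dvd N" "D = u * ?Phi + v * N"
    using bezout_poly[of ?Phi N] N0 by blast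
  have evD: "ev D s = 0" using s N by (simp add: D(4) ev_Phi roots_Phi_def)
  obtain q where q: "?Phi = D * q" using D(2) by (auto simp: dvd_def)
  then have "D dvd 1 \<or> q dvd 1" using irreducible_Phi by (auto simp: irreducible_def)
  then show False
  proof
    assume "D dvd 1"
    then obtain c where "D = [:c:]" "c \<noteq> 0" using D(1) by (auto simp: is_unit_poly_iff)
    then show False using evD by simp
  next
    assume "q dvd 1"
    then have "q \<noteq> 0" "degree q = 0" by (auto simp: is_unit_poly_iff)
    then have "degree D = l - 1" using q D(1) degree_Phi by (simp add: degree_mult_eq)
    then show False using dvd_imp_degree_le[OF D(3) N0] N(2) by simp
  qed
qed

lemma roots_Phi_not_in_base: "to_ac r \<notin> roots_Phi"
proof
  assume "to_ac r \<in> roots_Phi"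
  moreover have "1 < l - 1" using l_ge_5 by linarith
  ultimately show False using roots_Phi_min_degree[of "to_ac r" "[:- r, 1:]"] by simp
qed

text \<open>
  If \<open>l = 0\<close> in \<open>F\<close>, then \<open>1\<close> would be a root of \<open>\<Phi>\<^sub>l\<close>.
\<close>

lemma of_nat_l: "of_nat l \<noteq> (0 :: 'a)"
proof
  assume *: "of_nat l = (0 :: 'a)"
  have "to_ac 1 \<in> roots_Phi" using arg_cong[OF *, of to_ac] by (simp add: roots_Phi_def Phi_val_def)
  then show False using roots_Phi_not_in_base by blast
qed

lemma of_nat_l_ac: "of_nat l \<noteq> (0 :: 'a alg_closure)"
  using of_nat_l by (simp add: to_ac_of_nat_eq_0_iff)

lemma roots_Phi_iff: "s \<in> roots_Phi \<longleftrightarrow> s ^ l = 1 \<and> s \<noteq> 1"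
proof -
  have "1 \<notin> roots_Phi" using roots_Phi_not_in_base[of 1] by simp
  then show ?thesis using Phi_val_mult[of s l] by (auto simp: roots_Phi_def)
qed

lemma roots_Phi_nonzero: "s \<in> roots_Phi \<Longrightarrow> s \<noteq> 0"
  using l_ge_1 by (auto simp: roots_Phi_iff power_0_left)

lemma roots_Phi_power_eq_1_iff:
  assumes "s \<in> roots_Phi"
  shows "s ^ k = 1 \<longleftrightarrow> l dvd k"
proof
  assume k: "s ^ k = 1"
  show "l dvd k"
  proof (rule ccontr)
    assume "\<not> l dvd k"
    then have "coprime k l" using prime_l by (metis coprime_commute prime_imp_coprime)
    then obtain x y where "k * x = l * y + 1"
      using coprime_bezout_strong[of k l] l_ge_5 by auto
    then have "(s ^ k) ^ x = (s ^ l) ^ y * s" by (metis power_mult power_add power_one_right)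
    then show False using k assms by (simp add: roots_Phi_iff)
  qed
next
  assume "l dvd k"
  then show "s ^ k = 1" using assms by (auto simp: dvd_def roots_Phi_iff power_mult)
qed

lemma roots_Phi_power_iff:
  assumes "s \<in> roots_Phi"
  shows "s ^ k \<in> roots_Phi \<longleftrightarrow> \<not> l dvd k"
proof -
  have "(s ^ k) ^ l = (s ^ l) ^ k" by (simp add: mult.commute flip: power_mult)
  then have "(s ^ k) ^ l = 1" using assms by (simp add: roots_Phi_iff)
  then show ?thesis using roots_Phi_power_eq_1_iff[OF assms, of k] by (simp add: roots_Phi_iff)
qed

lemma roots_Phi_power_eq_iff:
  assumes "s \<in> roots_Phi"
  shows "s ^ i = s ^ j \<longleftrightarrow> [i = j] (mod l)"
proof -
  have *: "s ^ i = s ^ j \<longleftrightarrow> [i = j] (mod l)" if "i \<le> j" for i j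
  proof -
    have "s ^ j = s ^ i * s ^ (j - i)" using that by (simp flip: power_add)
    then have "s ^ i = s ^ j \<longleftrightarrow> s ^ (j - i) = 1" using roots_Phi_nonzero[OF assms] by auto
    also have "\<dots> \<longleftrightarrow> [i = j] (mod l)"
      unfolding roots_Phi_power_eq_1_iff[OF assms] using that by (metis cong_altdef_nat cong_sym)
    finally show ?thesis .
  qed
  show ?thesis
    using *[of i j] *[of j i] by (metis cong_sym_eq nat_le_linear)
qed

lemma card_roots_Phi_powers:
  assumes "s \<in> roots_Phi"
  shows "roots_Phi = (\<lambda>k. s ^ k) ` {1..<l}" "inj_on (\<lambda>k. s ^ k) {1..<l}"
proof -
  show inj: "inj_on (\<lambda>k. s ^ k) {1..<l}"
    using assms by (auto simp: inj_on_def roots_Phi_power_eq_iff cong_def)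
  have sub: "(\<lambda>k. s ^ k) ` {1..<l} \<subseteq> roots_Phi"
    using assms nat_dvd_not_less by (auto simp: roots_Phi_power_iff)
  have "cyclotomic_poly l \<noteq> (0 :: 'a poly)" using irreducible_Phi by auto
  then have Phi0: "mp (cyclotomic_poly l) \<noteq> (0 :: 'a alg_closure poly)" by simp
  have Ueq: "roots_Phi = {s. poly (mp (cyclotomic_poly l :: 'a poly)) s = 0}"
    by (simp add: roots_Phi_def ev_Phi flip: ev_def)
  have "card roots_Phi \<le> l - 1" "finite roots_Phi"
    unfolding Ueq using card_poly_roots_bound[OF Phi0] poly_roots_finite[OF Phi0] by (simp_all add: degree_Phi)
  then show "roots_Phi = (\<lambda>k. s ^ k) ` {1..<l}"
    using card_seteq[of roots_Phi "(\<lambda>k. s ^ k) ` {1..<l}"] sub card_image[OF inj] by simp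
qed

lemma roots_Phi_obtain_power:
  assumes "s \<in> roots_Phi" "s' \<in> roots_Phi"
  obtains k where "1 \<le> k" "k < l" "s' = s ^ k"
  using card_roots_Phi_powers(1)[OF assms(1)] assms(2) by force

lemma roots_Phi_nonempty: "\<exists>s. s \<in> roots_Phi"
proof -
  have "degree (mp (cyclotomic_poly l :: 'a poly)) > 0" using l_ge_5 by (simp add: degree_Phi)
  from alg_closed_imp_poly_has_root[OF this] show ?thesis by (simp add: roots_Phi_def ev_Phi flip: ev_def)
qed

lemma finite_roots_Phi: "finite roots_Phi" and card_roots_Phi: "card roots_Phi = l - 1"
proof -
  obtain s where s: "s \<in> roots_Phi" using roots_Phi_nonempty by blast
  show "finite roots_Phi" by (subst card_roots_Phi_powers(1)[OF s]) simp
  show "card roots_Phi = l - 1" by (subst card_roots_Phi_powers(1)[OF s]) (use card_image[OF card_roots_Phi_powers(2)[OF s]] in simp)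
qed

lemma Phi_form_eq_0_imp:
  assumes "Phi_form l a b = 0" "b \<noteq> (0 :: 'a alg_closure)"
  shows "a / b \<in> roots_Phi"
  using assms by (simp add: Phi_form_divide roots_Phi_def)

lemma Phi_form_base_nonzero:
  assumes "a \<noteq> 0 \<or> b \<noteq> (0 :: 'a)"
  shows "Phi_form l a b \<noteq> 0"
proof (cases "b = 0")
  case True
  then show ?thesis using assms l_ge_1 by (simp add: Phi_form_zero_right)
next
  case False
  have "Phi_val l (a / b) \<noteq> 0"
  proof
    assume *: "Phi_val l (a / b) = 0"
    have "to_ac (Phi_val l (a / b)) = Phi_val l (to_ac (a / b))" unfolding Phi_val_def by (simp add: to_ac_sum)
    then have "to_ac (a / b) \<in> roots_Phi" using * by (simp add: roots_Phi_def)
    then show False using roots_Phi_not_in_base by blast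
  qed
  then show ?thesis using False by (simp add: Phi_form_divide)
qed

text \<open>
  The coefficient in top degree is the form at the top coefficients of \<open>g\<close> and \<open>h\<close>; it does not
  vanish because \<open>\<Phi>\<^sub>l\<close> has no root in \<open>F\<close>.
\<close>

lemma degree_Phi_form:
  fixes g h :: "'a poly"
  assumes "g \<noteq> 0 \<or> h \<noteq> 0"
  shows "degree (Phi_form l g h) = (l - 1) * max (degree g) (degree h)"
    and "Phi_form l g h \<noteq> 0"
proof -
  let ?d = "max (degree g) (degree h)"
  have g: "degree g \<le> ?d" and h: "degree h \<le> ?d" by simp_all
  have deg: "degree (g ^ i * h ^ (l - 1 - i)) \<le> (l - 1) * ?d" if "i < l" for i
  proof -
    have "degree (g ^ i * h ^ (l - 1 - i)) \<le> i * ?d + (l - 1 - i) * ?d"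
      using degree_mult_le[of "g ^ i" "h ^ (l - 1 - i)"] coeff_power_top(2)[OF g, of i]
        coeff_power_top(2)[OF h, of "l - 1 - i"] by linarith
    then show ?thesis using that by (simp flip: distrib_right)
  qed
  have co: "coeff (g ^ i * h ^ (l - 1 - i)) ((l - 1) * ?d) = coeff g ?d ^ i * coeff h ?d ^ (l - 1 - i)"
    if "i < l" for i
  proof -
    have "(l - 1) * ?d = i * ?d + (l - 1 - i) * ?d" using that by (simp flip: distrib_right)
    then show ?thesis
      by (simp only: coeff_mult_top[OF coeff_power_top(2)[OF g] coeff_power_top(2)[OF h]]
          coeff_power_top(1)[OF g] coeff_power_top(1)[OF h])
  qed
  have le: "degree (Phi_form l g h) \<le> (l - 1) * ?d"
    unfolding Phi_form_def by (intro degree_sum_le) (use deg in auto)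
  have "coeff (Phi_form l g h) ((l - 1) * ?d) = Phi_form l (coeff g ?d) (coeff h ?d)"
    unfolding Phi_form_def coeff_sum by (intro sum.cong refl co) simp
  moreover have "coeff g ?d \<noteq> 0 \<or> coeff h ?d \<noteq> 0"
  proof (cases "degree g < degree h")
    case True
    then have "h \<noteq> 0" by auto
    then show ?thesis using True by (simp add: max_def)
  next
    case False
    then have "?d = degree g" by simp
    moreover have "degree h = 0 \<Longrightarrow> h \<noteq> 0 \<Longrightarrow> coeff h 0 \<noteq> 0"
      by (metis leading_coeff_0_iff)
    ultimately show ?thesis using assms False by (cases "g = 0") auto
  qed
  ultimately have nz: "coeff (Phi_form l g h) ((l - 1) * ?d) \<noteq> 0" using Phi_form_base_nonzero by auto
  then show "Phi_form l g h \<noteq> 0" by auto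
  show "degree (Phi_form l g h) = (l - 1) * ?d" using le le_degree[OF nz] by simp
qed

lemma Phi_form_root_iff:
  assumes "no_common_root g h"
  shows "ev (Phi_form l g h) y = 0 \<longleftrightarrow> (\<exists>s\<in>roots_Phi. ev g y = s * ev h y)"
proof
  assume "ev (Phi_form l g h) y = 0"
  then have *: "Phi_form l (ev g y) (ev h y) = 0" by simp
  from Phi_form_root_nonzero[OF * assms l_ge_1] have "ev h y \<noteq> 0" by simp
  then show "\<exists>s\<in>roots_Phi. ev g y = s * ev h y"
    using Phi_form_eq_0_imp[OF *] by (intro bexI[of _ "ev g y / ev h y"]) auto
next
  assume "\<exists>s\<in>roots_Phi. ev g y = s * ev h y"
  then obtain s where s: "s \<in> roots_Phi" "ev g y = s * ev h y" by blast
  then have "ev h y \<noteq> 0" using assms by (auto simp: no_common_root_def)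
  then show "ev (Phi_form l g h) y = 0" using s by (simp add: Phi_form_divide roots_Phi_def)
qed

end

section \<open>Relations of small degree at the fibre points\<close>

context irreducible_cyclotomic
begin

text \<open>
  The point \<open>z\<close> is the image of \<open>s\<close> under a Moebius transformation over \<open>F\<close>, so it has the same
  degree \<open>l - 1\<close> over \<open>F\<close> as \<open>s\<close>. Concretely, clearing denominators in \<open>N\<close> composed with the inverse
  transformation gives a polynomial \<open>M\<close> of degree at most \<open>l - 2\<close> that kills \<open>s\<close>. Thus \<open>M = 0\<close>,
  and then \<open>N\<close> vanishes wherever \<open>c w + d \<noteq> 0\<close>.
\<close>

lemma mobius_min_degree:
  fixes a b c d :: 'a and N :: "'a poly"
  assumes det: "a * d - b * c \<noteq> 0" and s: "s \<in> roots_Phi" "ev [:b, a:] z = s * ev [:d, c:] z"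
    and N: "degree N \<le> l - 2" "ev N z = 0"
  shows "N = 0"
proof -
  define D where "D = l - 2"
  define M where "M = (\<Sum>k\<le>D. smult (coeff N k) ([:- b, d:] ^ k * [:a, - c:] ^ (D - k)))"
  have ev_smult: "ev (smult r p) t = to_ac r * ev p t" for r p and t :: "'a alg_closure"
    using ev_simps(5)[of "[:r:]" p t] by simp
  have evM: "ev M t = ev [:a, - c:] t ^ D * ev N w" if "ev [:b, a:] w = t * ev [:d, c:] w" for t w
  proof -
    \<comment> \<open>The inverse transformation \<open>t \<mapsto> (d t - b) / (a - c t)\<close>, without division.\<close>
    have w: "ev [:- b, d:] t = w * ev [:a, - c:] t" using that by (simp add: algebra_simps)
    have "ev M t = (\<Sum>k\<le>D. to_ac (coeff N k) * (ev [:- b, d:] t ^ k * ev [:a, - c:] t ^ (D - k)))"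
      by (simp only: M_def ev_simps ev_smult)
    also have "\<dots> = (\<Sum>k\<le>D. ev [:a, - c:] t ^ D * (to_ac (coeff N k) * w ^ k))"
    proof (rule sum.cong)
      fix k assume "k \<in> {..D}"
      then have "ev [:a, - c:] t ^ D = ev [:a, - c:] t ^ k * ev [:a, - c:] t ^ (D - k)"
        by (simp flip: power_add)
      then show "to_ac (coeff N k) * (ev [:- b, d:] t ^ k * ev [:a, - c:] t ^ (D - k))
          = ev [:a, - c:] t ^ D * (to_ac (coeff N k) * w ^ k)"
        unfolding w by (simp only: power_mult_distrib mult_ac)
    qed simp
    also have "\<dots> = ev [:a, - c:] t ^ D * (\<Sum>k\<le>D. to_ac (coeff N k) * w ^ k)"
      by (simp only: sum_distrib_left)
    also have "(\<Sum>k\<le>D. to_ac (coeff N k) * w ^ k) = ev N w"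
      unfolding ev_def poly_altdef using N(1)
      by (intro sum.mono_neutral_cong_right) (auto simp: coeff_map_poly D_def coeff_eq_0)
    finally show ?thesis .
  qed
  have "degree M \<le> D"
    unfolding M_def
  proof (intro degree_sum_le)
    fix k assume k: "k \<in> {..D}"
    have "degree ([:- b, d:] ^ k * [:a, - c:] ^ (D - k)) \<le> k + (D - k)"
      using coeff_power_top(2)[of "[:- b, d:]" 1 k] coeff_power_top(2)[of "[:a, - c:]" 1 "D - k"]
      by (intro degree_mult_le[THEN order_trans] add_mono) auto
    then show "degree (smult (coeff N k) ([:- b, d:] ^ k * [:a, - c:] ^ (D - k))) \<le> D"
      using k degree_smult_le order_trans by fastforce
  qed simp
  moreover have "D < l - 1" using l_ge_5 unfolding D_def by linarith
  moreover have "ev M s = 0" using evM[OF s(2)] N(2) by simp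
  ultimately have M: "M = 0" using roots_Phi_min_degree[OF s(1), of M] by simp
  have "ev N w = 0" if w: "ev [:d, c:] w \<noteq> 0" for w
  proof -
    define t where "t = ev [:b, a:] w / ev [:d, c:] w"
    have t: "ev [:b, a:] w = t * ev [:d, c:] w" using w by (simp add: t_def)
    have "ev [:a, - c:] t * ev [:d, c:] w = to_ac a * ev [:d, c:] w - to_ac c * (t * ev [:d, c:] w)"
      by (simp add: algebra_simps)
    also have "\<dots> = to_ac (a * d - b * c)" unfolding t[symmetric] by (simp add: algebra_simps)
    finally have "ev [:a, - c:] t \<noteq> 0" using det to_ac_eq_0_iff by (metis mult_zero_left)
    then show ?thesis using evM[OF t] M by simp
  qed
  moreover have "[:d, c:] \<noteq> 0" using det by auto
  ultimately show "N = 0" by (rule ev_eq_0_cofinite)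
qed

text \<open>
  The difference of the two sides vanishes at \<open>z\<close> and its degree is too small for \<open>z\<close>.
\<close>

lemma mobius_power_form_aux:
  fixes a b c d :: 'a and g h :: "'a poly"
  assumes det: "a * d - b * c \<noteq> 0" and s: "s \<in> roots_Phi" "ev [:b, a:] z = s * ev [:d, c:] z"
    and gh: "ev g z = s ^ k * ev h z" "degree g + k \<le> l - 2" "degree h + k \<le> l - 2"
  shows "g * [:d, c:] ^ k = h * [:b, a:] ^ k"
proof -
  let ?N = "g * [:d, c:] ^ k - h * [:b, a:] ^ k"
  have deg: "degree (p * [:u, v:] ^ k) \<le> l - 2" if "degree p + k \<le> l - 2" for p and u v :: 'a
  proof -
    have "degree ([:u, v:] ^ k) \<le> k" using coeff_power_top(2)[of "[:u, v:]" 1 k] by simp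
    then show ?thesis using degree_mult_le[of p "[:u, v:] ^ k"] that by linarith
  qed
  have "ev ?N z = ev g z * ev [:d, c:] z ^ k - ev h z * ev [:b, a:] z ^ k" by (simp only: ev_simps)
  also have "\<dots> = 0" unfolding s(2) gh(1) by (simp only: power_mult_distrib mult_ac) simp
  finally have "?N = 0"
    using mobius_min_degree[OF det s degree_diff_le[OF deg[OF gh(2)] deg[OF gh(3)]]] by simp
  then show ?thesis by simp
qed

text \<open>
  Writing \<open>s' = s\<^sup>k\<close> with \<open>1 \<le> k < l\<close>, either \<open>k\<close> or \<open>l - k\<close> is small enough for the preceding
  lemma. In the second case \<open>g\<close> and \<open>h\<close> are exchanged, as \<open>1 / s' = s\<^bsup>l-k\<^esup>\<close>.
\<close>

lemma mobius_power_form: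
  fixes a b c d :: 'a and g h :: "'a poly"
  assumes det: "a * d - b * c \<noteq> 0" and s: "s \<in> roots_Phi" "ev [:b, a:] z = s * ev [:d, c:] z"
    and gh: "s' \<in> roots_Phi" "ev g z = s' * ev h z"
    and deg: "degree g \<le> m" "degree h \<le> m" "2 * m \<le> l - 3"
  obtains k where "1 \<le> k" "k < l"
    "g * [:d, c:] ^ k = h * [:b, a:] ^ k \<or> h * [:d, c:] ^ k = g * [:b, a:] ^ k"
proof -
  obtain k where k: "1 \<le> k" "k < l" "s' = s ^ k" using roots_Phi_obtain_power[OF s(1) gh(1)] .
  show ?thesis
  proof (cases "2 * k < l")
    case True
    then have "m + k \<le> l - 2" using deg(3) l_ge_5 by linarith
    then show ?thesis
      using mobius_power_form_aux[OF det s, of g k h] gh k deg that by fastforce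
  next
    case False
    then have "m + (l - k) \<le> l - 2" using deg(3) l_ge_5 k by linarith
    moreover have "s ^ (l - k) * s ^ k = 1" using s(1) k by (simp add: roots_Phi_iff flip: power_add)
    then have "ev h z = s ^ (l - k) * ev g z" by (simp add: gh(2) k(3) mult.assoc[symmetric])
    ultimately show ?thesis
      using mobius_power_form_aux[OF det s, of h "l - k" g] k deg that[of "l - k"] by fastforce
  qed
qed

end

section \<open>Powers of Moebius transformations and essential distinctness\<close>

text \<open>
  Equal functions have equal zeros: compare values at the zero \<open>-b/a\<close> of the first factor, or the
  orders of vanishing at infinity (the degrees) when \<open>a = 0\<close>.
\<close>

lemma linear_power_root:
  fixes a b c d a' b' c' d' :: "'a::field"
  assumes det: "a * d - b * c \<noteq> 0" "a' * d' - b' * c' \<noteq> 0" and N: "N \<ge> 1" "N' \<ge> 1"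
    and eq: "[:b, a:] ^ N * [:d', c':] ^ N' = [:d, c:] ^ N * [:b', a':] ^ N'"
  shows "a' * b = a * b'"
proof (cases "a = 0")
  case False
  define r where "r = - b / a"
  have ar: "a * r = - b" using False by (simp add: r_def)
  have "poly [:d, c:] r \<noteq> 0"
  proof
    assume "poly [:d, c:] r = 0"
    then have "a * d + c * (a * r) = 0" by (simp add: algebra_simps) (metis mult_zero_right distrib_left mult.left_commute)
    then show False using det(1) by (simp add: ar algebra_simps)
  qed
  moreover have "poly ([:d, c:] ^ N * [:b', a':] ^ N') r = 0"
    unfolding eq[symmetric] using N ar by (simp add: mult.commute)
  ultimately have "poly [:b', a':] r = 0" using N by (simp add: poly_power)
  then have "a * b' + a' * (a * r) = 0" by (simp add: algebra_simps) (metis mult_zero_right distrib_left mult.left_commute)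
  then show ?thesis by (simp add: ar algebra_simps)
next
  case True
  then have bc: "b \<noteq> 0" "c \<noteq> 0" using det by auto
  have nz: "[:b', a':] \<noteq> 0" "[:d', c':] \<noteq> 0" using det by auto
  have deg: "degree (p ^ N * q ^ N') = N * degree p + N' * degree q"
    if "p \<noteq> 0" "q \<noteq> 0" for p q :: "'a poly"
    using that by (simp add: degree_mult_eq degree_power_eq)
  have nz': "[:b, a:] \<noteq> 0" "[:d, c:] \<noteq> 0" using bc by auto
  have "N' * degree [:d', c':] = N + N' * degree [:b', a':]"
    using deg[OF nz'(1) nz(2)] deg[OF nz'(2) nz(1)] True bc unfolding eq by simp
  then have "a' = 0" using N by (auto split: if_splits)
  then show ?thesis using True by simp
qed

lemma parallel_vectors:
  fixes a b a' b' :: "'a::field"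
  assumes "a' * b = a * b'" "a \<noteq> 0 \<or> b \<noteq> 0" "a' \<noteq> 0 \<or> b' \<noteq> 0"
  obtains r where "r \<noteq> 0" "a' = r * a" "b' = r * b"
proof (cases "a = 0")
  case True
  then show ?thesis using assms that[of "b' / b"] by auto
next
  case False
  then show ?thesis using assms that[of "a' / a"] by (cases "a' = 0") (auto simp: field_simps)
qed

text \<open>
  If powers of two Moebius transformations agree, the transformations have the same zero and the
  same pole, so they are proportional. Comparing multiplicities at the zero or at the pole, one of
  which is finite, shows that the exponents agree, and the factor \<open>r/t\<close> is a root of unity.
\<close>

lemma linear_powers_eq:
  fixes a b c d a' b' c' d' :: "'a::field"
  assumes det: "a * d - b * c \<noteq> 0" "a' * d' - b' * c' \<noteq> 0" and N: "N \<ge> 1" "N' \<ge> 1"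
    and eq: "[:b, a:] ^ N * [:d', c':] ^ N' = [:d, c:] ^ N * [:b', a':] ^ N'"
  obtains r t where "r \<noteq> 0" "t \<noteq> 0" "a' = r * a" "b' = r * b" "c' = t * c" "d' = t * d" "r ^ N = t ^ N"
proof -
  have nz: "a \<noteq> 0 \<or> b \<noteq> 0" "a' \<noteq> 0 \<or> b' \<noteq> 0" "c \<noteq> 0 \<or> d \<noteq> 0" "c' \<noteq> 0 \<or> d' \<noteq> 0" using det by auto
  have "a' * b = a * b'" by (rule linear_power_root[OF det N eq])
  from parallel_vectors[OF this nz(1,2)] obtain r where r: "r \<noteq> 0" "a' = r * a" "b' = r * b" .
  have "c' * d = c * d'"
    using linear_power_root[of c b d a c' b' d' a' N N'] det N eq by (simp add: algebra_simps)
  from parallel_vectors[OF this nz(3,4)] obtain t where t: "t \<noteq> 0" "c' = t * c" "d' = t * d" .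
  let ?P = "[:b, a:]" and ?R = "[:d, c:]"
  have PR: "[:b', a':] = [:r:] * ?P" "[:d', c':] = [:t:] * ?R" using r t by simp_all
  have eq': "[:t:] ^ N' * (?P ^ N * ?R ^ N') = [:r:] ^ N' * (?R ^ N * ?P ^ N')"
    using eq unfolding PR power_mult_distrib by (simp only: mult_ac)
  have nz: "?P \<noteq> 0" "?R \<noteq> 0" using det by auto
  \<comment> \<open>\<open>P\<close> and \<open>R\<close> are coprime and one of them has a root.\<close>
  have "N = N'"
  proof (rule ccontr)
    assume ne: "N \<noteq> N'"
    have *: False if "p \<noteq> 0" "q \<noteq> 0" "poly p x = 0" "poly q x \<noteq> 0" "u \<noteq> 0" "v \<noteq> 0" "i < j"
      "[:u:] * (p ^ i * q ^ j) = [:v:] * (q ^ i * p ^ j)" for p q :: "'a poly" and u v x i j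
    proof -
      have "p ^ j = p ^ i * p ^ (j - i)" using that by (simp flip: power_add)
      then have "p ^ i * ([:u:] * q ^ j) = p ^ i * ([:v:] * q ^ i * p ^ (j - i))"
        using that(8) by (simp only: mult_ac)
      then have "[:u:] * q ^ j = [:v:] * q ^ i * p ^ (j - i)" using that(1) by (subst (asm) mult_cancel_left) simp
      from arg_cong[OF this, of "\<lambda>p. poly p x"] show False using that by (simp add: poly_power power_0_left)
    qed
    have cop: "poly ?R x \<noteq> 0" if "poly ?P x = 0" for x
    proof
      assume "poly ?R x = 0"
      then have "d = - (x * c)" "b = - (x * a)" using that by (auto simp: add_eq_0_iff2)
      then show False using det(1) by simp
    qed
    have T: "[:t:] ^ N' = [:t ^ N':]" "[:r:] ^ N' = [:r ^ N':]" by (simp_all add: poly_const_pow)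
    have "a \<noteq> 0 \<or> c \<noteq> 0" using det by auto
    then consider "a \<noteq> 0" | "c \<noteq> 0" by blast
    then show False
    proof cases
      case 1
      then have x: "poly ?P (- b / a) = 0" by simp
      show False
      proof (cases "N < N'")
        case True
        then show False using *[of ?P ?R "- b / a" "t ^ N'" "r ^ N'" N N'] x cop[OF x] nz r t eq' T by simp
      next
        case False
        then show False using *[of ?P ?R "- b / a" "r ^ N'" "t ^ N'" N' N] x cop[OF x] nz r t eq' T ne
          by (simp add: mult.commute)
      qed
    next
      case 2
      then have x: "poly ?R (- d / c) = 0" by simp
      then have y: "poly ?P (- d / c) \<noteq> 0" using cop by blast
      show False
      proof (cases "N < N'")
        case True
        then show False using *[of ?R ?P "- d / c" "r ^ N'" "t ^ N'" N N'] x y nz r t eq' T by simp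
      next
        case False
        then show False using *[of ?R ?P "- d / c" "t ^ N'" "r ^ N'" N' N] x y nz r t eq' T ne
          by (simp add: mult.commute)
      qed
    qed
  qed
  then have "(?P ^ N * ?R ^ N) * [:t:] ^ N = (?P ^ N * ?R ^ N) * [:r:] ^ N" using eq' by (simp only: mult_ac)
  moreover have "?P ^ N * ?R ^ N \<noteq> 0" using nz by (simp only: no_zero_divisors power_not_zero not_False_eq_True)
  ultimately have "[:t:] ^ N = [:r:] ^ N"
    using mult_left_cancel[of "?P ^ N * ?R ^ N" "[:t:] ^ N" "[:r:] ^ N"] by blast
  then have "r ^ N = t ^ N" by (simp add: poly_const_pow)
  then show ?thesis using r t that by blast
qed

abbreviation num_of :: "'a::field ^ 2 ^ 2 \<Rightarrow> 'a poly" where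
  "num_of A \<equiv> [:A $ 1 $ 2, A $ 1 $ 1:]"

abbreviation den_of :: "'a::field ^ 2 ^ 2 \<Rightarrow> 'a poly" where
  "den_of A \<equiv> [:A $ 2 $ 2, A $ 2 $ 1:]"

lemma invertible_det_2:
  "invertible (A :: 'a::field ^ 2 ^ 2) \<longleftrightarrow> A $ 1 $ 1 * A $ 2 $ 2 - A $ 1 $ 2 * A $ 2 $ 1 \<noteq> 0"
  by (simp add: invertible_det_nz det_2)

text \<open>
  As functions, the two alternatives read \<open>A\<^sup>N = B\<^sup>M\<close> and \<open>A\<^sup>N = B\<^sup>-\<^sup>M\<close> with \<open>M = N'\<close>. The second one
  reduces to the first by exchanging the rows of \<open>B\<close>, the effect of the matrix \<open>J\<close> in the definition.
\<close>

lemma not_essentially_distinctI: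
  fixes A B :: "'a::field ^ 2 ^ 2"
  assumes "invertible A" "invertible B" and N: "N \<ge> 1" "N' \<ge> 1"
    and eq: "num_of A ^ N * den_of B ^ N' = den_of A ^ N * num_of B ^ N' \<or>
      num_of A ^ N * num_of B ^ N' = den_of A ^ N * den_of B ^ N'"
  shows "\<not> essentially_distinct A B"
  using eq
proof
  assume "num_of A ^ N * den_of B ^ N' = den_of A ^ N * num_of B ^ N'"
  then obtain r t where rt: "r \<noteq> 0" "t \<noteq> 0" "B $ 1 $ 1 = r * A $ 1 $ 1" "B $ 1 $ 2 = r * A $ 1 $ 2"
    "B $ 2 $ 1 = t * A $ 2 $ 1" "B $ 2 $ 2 = t * A $ 2 $ 2" "r ^ N = t ^ N"
    using linear_powers_eq[of "A $ 1 $ 1" "A $ 2 $ 2" "A $ 1 $ 2" "A $ 2 $ 1" "B $ 1 $ 1" "B $ 2 $ 2" "B $ 1 $ 2" "B $ 2 $ 1" N N']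
      assms(1,2) N unfolding invertible_det_2 by blast
  have "(r / t) ^ N = 1" using rt by (simp add: power_divide)
  then have "r / t \<in> roots_of_unity" using N unfolding roots_of_unity_def by (auto intro!: exI[of _ N])
  moreover have "B = mat t ** vector [vector [r / t, 0], vector [0, 1]] ** mat 1 ** A"
    using rt by (simp add: vec_eq_iff forall_2 matrix_matrix_mult_def sum_2 mat_def)
  ultimately show ?thesis using rt(2) unfolding essentially_distinct_def by blast
next
  assume "num_of A ^ N * num_of B ^ N' = den_of A ^ N * den_of B ^ N'"
  then obtain r t where rt: "r \<noteq> 0" "t \<noteq> 0" "B $ 2 $ 1 = r * A $ 1 $ 1" "B $ 2 $ 2 = r * A $ 1 $ 2"
    "B $ 1 $ 1 = t * A $ 2 $ 1" "B $ 1 $ 2 = t * A $ 2 $ 2" "r ^ N = t ^ N"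
    using linear_powers_eq[of "A $ 1 $ 1" "A $ 2 $ 2" "A $ 1 $ 2" "A $ 2 $ 1" "B $ 2 $ 1" "B $ 1 $ 2" "B $ 2 $ 2" "B $ 1 $ 1" N N']
      assms(1,2) N unfolding invertible_det_2 by (auto simp: algebra_simps)
  have "(t / r) ^ N = 1" using rt by (simp add: power_divide)
  then have "t / r \<in> roots_of_unity" using N unfolding roots_of_unity_def by (auto intro!: exI[of _ N])
  moreover have "B = mat r ** vector [vector [t / r, 0], vector [0, 1]] ** (vector [vector [0, 1], vector [1, 0]] :: 'a ^ 2 ^ 2) ** A"
    using rt by (simp add: vec_eq_iff forall_2 matrix_matrix_mult_def sum_2 mat_def)
  ultimately show ?thesis using rt(1) unfolding essentially_distinct_def by blast
qed

section \<open>The Wronskian bound\<close>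

definition wronskian :: "'k::field poly \<Rightarrow> 'k poly \<Rightarrow> 'k poly" where
  "wronskian g h = pderiv g * h - g * pderiv h"

text \<open>
  Differentiate \<open>(g - h) \<Phi>(g, h) = g\<^sup>l - h\<^sup>l\<close>, multiply by \<open>h\<close>, and eliminate \<open>h\<^sup>l\<close> with the same equation.
\<close>

lemma wronskian_identity:
  fixes g h :: "'k::field poly"
  assumes "l \<ge> 1"
  shows "of_nat l * g ^ (l - 1) * wronskian g h =
    h * (g - h) * pderiv (Phi_form l g h) +
    (h * pderiv (g - h) - of_nat l * pderiv h * (g - h)) * Phi_form l g h"
proof -
  have l: "g ^ l = g * g ^ (l - 1)" "h ^ l = h * h ^ (l - 1)" using assms by (simp_all flip: power_Suc)
  have P: "(g - h) * Phi_form l g h = g ^ l - h ^ l" by (rule Phi_form_mult)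
  from arg_cong[OF this, of pderiv]
  have 1: "(g - h) * pderiv (Phi_form l g h) + Phi_form l g h * pderiv (g - h)
      = of_nat l * g ^ (l - 1) * pderiv g - of_nat l * h ^ (l - 1) * pderiv h"
    by (simp add: pderiv_mult pderiv_diff pderiv_power of_nat_poly smult_conv_map_poly[symmetric])
  have "h * (g - h) * pderiv (Phi_form l g h) +
      (h * pderiv (g - h) - of_nat l * pderiv h * (g - h)) * Phi_form l g h =
      h * ((g - h) * pderiv (Phi_form l g h) + Phi_form l g h * pderiv (g - h))
      - of_nat l * pderiv h * ((g - h) * Phi_form l g h)"
    by (simp add: algebra_simps)
  also have "\<dots> = of_nat l * g ^ (l - 1) * wronskian g h"
    unfolding 1 P l wronskian_def by (simp add: algebra_simps)
  finally show ?thesis by simp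
qed

text \<open>
  A point of multiplicity \<open>m + 1\<close> is a root of multiplicity at least \<open>m\<close> of both the form and its
  derivative, hence by the identity of \<open>l g\<^bsup>l-1\<^esup> W\<close>, where \<open>l\<close> and \<open>g(y)\<close> are nonzero.
\<close>

lemma order_Phi_form_le:
  fixes g h :: "'k::field poly"
  assumes l: "of_nat l \<noteq> (0 :: 'k)" and Q: "Phi_form l g h \<noteq> 0" and W: "wronskian g h \<noteq> 0"
    and g: "poly g y \<noteq> 0"
  shows "order y (Phi_form l g h) \<le> order y (wronskian g h) + 1"
proof (cases "order y (Phi_form l g h)")
  case (Suc m)
  let ?X = "[:- y, 1:]" and ?Q = "Phi_form l g h"
  have l1: "l \<ge> 1" using l by (cases l) auto
  obtain R where R: "?Q = ?X ^ Suc m * R" using order_1[of y ?Q] Suc by (auto simp: dvd_def)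
  have "?X ^ m dvd ?Q" unfolding R by (intro dvd_mult2 le_imp_power_dvd) simp
  moreover have "?X ^ m dvd pderiv ?Q"
    unfolding R pderiv_mult pderiv_power_Suc
    by (rule dvd_add[OF dvd_mult2[OF le_imp_power_dvd] dvd_mult[OF dvd_mult2[OF dvd_smult[OF dvd_refl]]]]) simp
  ultimately have "?X ^ m dvd of_nat l * g ^ (l - 1) * wronskian g h"
    unfolding wronskian_identity[OF l1] by (intro dvd_add dvd_mult)
  moreover have nz: "of_nat l * g ^ (l - 1) * wronskian g h \<noteq> 0" using l W g by (auto simp: of_nat_poly)
  ultimately have "m \<le> order y (of_nat l * g ^ (l - 1) * wronskian g h)"
    using order_divides by blast
  also have "\<dots> = order y (of_nat l * g ^ (l - 1)) + order y (wronskian g h)"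
    using nz by (rule order_mult)
  also have "order y (of_nat l * g ^ (l - 1)) = 0"
    using l g by (intro order_0I) (simp add: of_nat_poly poly_power)
  finally show ?thesis using Suc by simp
qed simp

lemma degree_pderiv_le: "degree (pderiv p) \<le> degree p - 1"
  by (intro degree_le) (auto simp: coeff_pderiv coeff_eq_0)

lemma degree_wronskian_le:
  assumes "degree g \<le> d" "degree h \<le> d"
  shows "degree (wronskian g h) \<le> 2 * d - 1"
  unfolding wronskian_def
proof (rule degree_diff_le)
  have *: "degree (pderiv p * q) \<le> 2 * d - 1" if "degree p \<le> d" "degree q \<le> d" for p q :: "'a poly"
  proof (cases "degree p = 0")
    case True
    then have "pderiv p = 0" by (metis pderiv_eq_0_iff degree_eq_zeroE pderiv_pCons pderiv_0 mult_zero_right add_0 pCons_0_0 smult_0_right)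
    then show ?thesis by simp
  next
    case False
    then show ?thesis
      using degree_mult_le[of "pderiv p" q] degree_pderiv_le[of p] that by linarith
  qed
  show "degree (pderiv g * h) \<le> 2 * d - 1" using *[OF assms] .
  show "degree (g * pderiv h) \<le> 2 * d - 1" using *[OF assms(2,1)] by (simp add: mult.commute)
qed

lemma degree_eq_sum_order:
  fixes p :: "'k::alg_closed_field poly"
  assumes "p \<noteq> 0"
  shows "(\<Sum>y | poly p y = 0. order y p) = degree p"
  using assms
proof (induction "degree p" arbitrary: p rule: less_induct)
  case less
  show ?case
  proof (cases "degree p = 0")
    case True
    then obtain c where "p = [:c:]" by (rule degree_eq_zeroE)
    then show ?thesis using less.prems by simp
  next
    case False
    then obtain x where x: "poly p x = 0" using alg_closed_imp_poly_has_root[of p] by auto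
    let ?m = "order x p"
    obtain q where q: "p = [:- x, 1:] ^ ?m * q" "\<not> [:- x, 1:] dvd q"
      using order_decomp[OF less.prems] by blast
    have q0: "q \<noteq> 0" "poly q x \<noteq> 0" using q(2) by (auto simp: poly_eq_0_iff_dvd)
    have m: "?m > 0" using x less.prems by (simp add: order_root)
    have deg: "degree p = ?m + degree q"
      using q0 by (subst q(1)) (simp add: degree_mult_eq degree_linear_power)
    have roots: "{y. poly p y = 0} = insert x {y. poly q y = 0}"
      using m by (subst q(1)) (auto simp: poly_power)
    have ord: "order y p = order y q" if "y \<noteq> x" for y
    proof -
      have "order y p = order y ([:- x, 1:] ^ ?m) + order y q"
        using less.prems by (subst q(1), subst order_mult) (auto simp flip: q(1))
      moreover have "order y ([:- x, 1:] ^ ?m) = 0"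
        using that by (intro order_0I) (simp add: poly_power)
      ultimately show ?thesis by simp
    qed
    have "(\<Sum>y | poly p y = 0. order y p) = ?m + (\<Sum>y | poly q y = 0. order y p)"
      unfolding roots using q0 poly_roots_finite[OF q0(1)] by (subst sum.insert) auto
    also have "(\<Sum>y | poly q y = 0. order y p) = (\<Sum>y | poly q y = 0. order y q)"
      using q0 by (intro sum.cong) (auto intro!: ord)
    also have "\<dots> = degree q" using less.hyps[of q] deg m q0 by simp
    finally show ?thesis using deg by simp
  qed
qed

text \<open>
  A substitute for the Riemann--Hurwitz formula. The multiplicities of the \<open>(l - 1) d\<close> fibre points over
  the roots of \<open>\<Phi>\<^sub>l\<close>, each diminished by one, add up to at most the degree of the Wronskian.
  Outside \<open>S\<close> the multiplicities are divisible by \<open>l\<close>, hence at least \<open>l\<close>, and diminishing them by one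
  keeps at least the fraction \<open>(l - 1)/l\<close>. Together this gives \<open>(l - 1)\<^sup>2 (d - n) \<le> l (2 d - 1)\<close>, which is
  impossible for \<open>d > n\<close>. A single multiplicity of at least \<open>l\<close>, diminished by
  one, would then exceed \<open>2 d - 1\<close>.
\<close>

lemma wronskian_degree_bound:
  fixes g h :: "'k::alg_closed_field poly"
  assumes l: "of_nat l \<noteq> (0 :: 'k)" and l5: "l \<ge> 5"
    and W: "wronskian g h \<noteq> 0"
    and d: "degree g \<le> d" "degree h \<le> d" "d \<ge> 1"
    and Q: "Phi_form l g h \<noteq> 0" "degree (Phi_form l g h) = (l - 1) * d"
    and cop: "\<And>y. poly (Phi_form l g h) y = 0 \<Longrightarrow> poly g y \<noteq> 0"
    and S: "finite S" "card S \<le> n * (l - 1)"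
      "\<And>y. poly (Phi_form l g h) y = 0 \<Longrightarrow> \<not> l dvd order y (Phi_form l g h) \<Longrightarrow> y \<in> S"
    and n: "2 * n \<le> l - 3"
  shows "d \<le> n" and "\<And>y. poly (Phi_form l g h) y = 0 \<Longrightarrow> order y (Phi_form l g h) < l"
proof -
  let ?Q = "Phi_form l g h" and ?W = "wronskian g h"
  let ?R = "{y. poly ?Q y = 0}"
  let ?o = "\<lambda>y. order y ?Q"
  have finR: "finite ?R" using poly_roots_finite[OF Q(1)] .
  have le: "?o y \<le> order y ?W + 1" if "y \<in> ?R" for y
    using order_Phi_form_le[OF l Q(1) W] cop that by auto
  have pos: "?o y \<ge> 1" if "y \<in> ?R" for y using that Q(1) by (simp add: order_root Suc_le_eq)
  have sumW: "(\<Sum>y\<in>R. order y ?W) \<le> 2 * d - 1" if "R \<subseteq> ?R" for R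
  proof -
    have "(\<Sum>y\<in>R. order y ?W) = (\<Sum>y\<in>R \<inter> {y. poly ?W y = 0}. order y ?W)"
      using finite_subset[OF that finR] by (intro sum.mono_neutral_right) (simp_all add: order_root W)
    also have "\<dots> \<le> (\<Sum>y | poly ?W y = 0. order y ?W)"
      using poly_roots_finite[OF W] by (intro sum_mono2) auto
    also have "\<dots> \<le> degree ?W" using W by (rule sum_order_le_degree)
    finally show ?thesis using degree_wronskian_le[OF d(1,2)] by linarith
  qed
  have ineq: "(l - 1) * ?o y \<le> l * order y ?W + (if y \<in> S then l - 1 else 0)" if y: "y \<in> ?R" for y
  proof (cases "y \<in> S")
    case True
    have "(l - 1) * ?o y \<le> (l - 1) * (order y ?W + 1)" using le[OF y] by (rule mult_le_mono2)
    also have "\<dots> \<le> l * order y ?W + (l - 1)"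
      by (simp add: distrib_left)
    finally show ?thesis using True by simp
  next
    case False
    then have "l dvd ?o y" using S(3) y by auto
    then have "?o y \<ge> l" using pos[OF y] by (intro dvd_imp_le) auto
    then have "(l - 1) * ?o y \<le> l * (?o y - 1)"
      by (simp add: diff_mult_distrib diff_mult_distrib2)
    also have "\<dots> \<le> l * order y ?W" using le[OF y] by (intro mult_le_mono2) simp
    finally show ?thesis using False by simp
  qed
  have "(l - 1) * ((l - 1) * d) = (\<Sum>y\<in>?R. (l - 1) * ?o y)"
    using degree_eq_sum_order[OF Q(1)] Q(2) by (simp flip: sum_distrib_left)
  also have "\<dots> \<le> (\<Sum>y\<in>?R. l * order y ?W + (if y \<in> S then l - 1 else 0))"
    by (intro sum_mono ineq)
  also have "\<dots> = l * (\<Sum>y\<in>?R. order y ?W) + (\<Sum>y\<in>?R. if y \<in> S then l - 1 else 0)"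
    by (simp add: sum.distrib sum_distrib_left)
  also have "(\<Sum>y\<in>?R. if y \<in> S then l - 1 else 0) = (l - 1) * card (?R \<inter> S)"
    using finR by (simp flip: sum.inter_restrict add: mult.commute)
  also have "\<dots> \<le> (l - 1) * (n * (l - 1))"
    using card_mono[OF S(1), of "?R \<inter> S"] S(2) by (intro mult_le_mono2) auto
  also have "l * (\<Sum>y\<in>?R. order y ?W) \<le> l * (2 * d - 1)"
    using sumW[of ?R] by (intro mult_le_mono2) auto
  finally have main: "(l - 1) * ((l - 1) * d) \<le> l * (2 * d - 1) + (l - 1) * (n * (l - 1))" by simp
  show dn: "d \<le> n"
  proof (rule ccontr)
    assume "\<not> d \<le> n"
    then obtain e where e: "d = n + e" "e \<ge> 1" by (metis add_diff_inverse_nat less_imp_le not_le One_nat_def Suc_le_eq zero_less_diff)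
    \<comment> \<open>The substitutions \<open>d = n + e\<close> and \<open>l = m + 5\<close> remove the truncated subtractions.\<close>
    obtain m where m: "l = m + 5" using l5 by (metis add.commute le_Suc_ex)
    have "int ((l - 1) * ((l - 1) * d)) \<le> int (l * (2 * d - 1) + (l - 1) * (n * (l - 1)))"
      using main by linarith
    then have "(int m + 4) * ((int m + 4) * (int n + int e)) \<le> (int m + 5) * (2 * (int n + int e) - 1) + (int m + 4) * (int n * (int m + 4))"
      using e by (simp add: m of_nat_diff add.commute)
    then have "(int m + 4) * (int m + 4) * int e \<le> (int m + 5) * (2 * int n + 2 * int e - 1)"
      by (simp add: algebra_simps)
    also have "\<dots> \<le> (int m + 5) * ((int m + 2) + 2 * int e - 1)"
      using n m by (intro mult_left_mono) auto
    finally have "((int m + 4) * (int m + 4) - 2 * (int m + 5)) * int e \<le> (int m + 5) * (int m + 1)"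
      by (simp add: algebra_simps)
    moreover have "((int m + 4) * (int m + 4) - 2 * (int m + 5)) * 1 \<le> ((int m + 4) * (int m + 4) - 2 * (int m + 5)) * int e"
      using e by (intro mult_left_mono) (auto simp: algebra_simps)
    ultimately show False by (simp add: algebra_simps)
  qed
  fix y assume y: "poly ?Q y = 0"
  have "order y ?W \<le> 2 * d - 1" using sumW[of "{y}"] y by simp
  then show "?o y < l" using le[of y] y dn n l5 by simp
qed

section \<open>Inseparable substitutions\<close>

text \<open>
  The substitution \<open>x \<mapsto> x\<^sup>q\<close>; for a power \<open>q\<close> of the characteristic it is the inseparable part of a
  rational function.
\<close>

abbreviation subst_pow :: "nat \<Rightarrow> 'k::comm_ring_1 poly \<Rightarrow> 'k poly" where
  "subst_pow q p \<equiv> pcompose p (monom 1 q)"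

lemma pcompose_power: "pcompose (p ^ n) r = pcompose p r ^ n"
  by (induction n) (simp_all add: pcompose_mult pcompose_1)

lemma subst_pow_monom: "subst_pow q (monom c i) = monom c (q * i)"
  by (simp add: monom_altdef pcompose_smult pcompose_power pcompose_pCons power_mult)

lemma subst_pow_1: "subst_pow 1 p = p"
  by (simp add: monom_altdef)

lemma subst_pow_subst_pow: "subst_pow r (subst_pow q p) = subst_pow (r * q) p"
  by (simp add: pcompose_assoc[symmetric] subst_pow_monom)

lemma pcompose_Phi_form: "pcompose (Phi_form l g h) r = Phi_form l (pcompose g r) (pcompose h r)"
  by (simp add: Phi_form_def pcompose_sum pcompose_mult pcompose_power)

lemma pderiv_eq_0_imp_coeff:
  fixes p :: "'k::field poly"
  assumes "pderiv p = 0" "\<not> CHAR('k) dvd k"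
  shows "coeff p k = 0"
proof (cases k)
  case (Suc m)
  have "of_nat (Suc m) * coeff p (Suc m) = coeff (pderiv p) m"
    by (rule coeff_pderiv[symmetric])
  then show ?thesis using assms Suc by (auto simp del: of_nat_Suc simp: of_nat_eq_0_iff_char_dvd)
qed (use assms in auto)

lemma pderiv_eq_0_imp_subst_pow:
  fixes g :: "'k::field poly"
  assumes "pderiv g = 0" "CHAR('k) > 0"
  obtains g1 where "g = subst_pow CHAR('k) g1"
proof
  let ?p = "CHAR('k)" and ?D = "degree g"
  let ?g1 = "\<Sum>i\<le>?D. monom (coeff g (?p * i)) i"
  show "g = subst_pow ?p ?g1"
  proof (rule poly_eqI)
    fix k
    have "coeff (subst_pow ?p ?g1) k = (\<Sum>i\<le>?D. if ?p * i = k then coeff g (?p * i) else 0)"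
      by (simp add: pcompose_sum subst_pow_monom coeff_sum)
    also have "\<dots> = coeff g k"
    proof (cases "?p dvd k")
      case False
      then have "?p * i \<noteq> k" for i by auto
      then show ?thesis using pderiv_eq_0_imp_coeff[OF assms(1) False] by simp
    next
      case True
      then obtain i0 where i0: "k = ?p * i0" by (auto simp: dvd_def)
      have "(\<Sum>i\<le>?D. if ?p * i = k then coeff g (?p * i) else 0)
          = (\<Sum>i\<le>?D. if i = i0 then coeff g k else 0)"
        using assms(2) i0 by (intro sum.cong) auto
      also have "\<dots> = (if i0 \<le> ?D then coeff g k else 0)" by simp
      also have "\<dots> = coeff g k"
      proof -
        have "i0 \<le> k" using assms(2) i0 by (cases ?p) auto
        then show ?thesis by (auto intro!: coeff_eq_0)
      qed
      finally show ?thesis .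
    qed
    finally show "coeff g k = coeff (subst_pow ?p ?g1) k" by simp
  qed
qed

text \<open>
  By coprimality \<open>g\<close> divides its own derivative, which has smaller degree.
\<close>

lemma wronskian_eq_0:
  fixes g h :: "'a::field poly"
  assumes "no_common_root g h" "wronskian g h = 0"
  shows "pderiv g = 0" "pderiv h = 0"
proof -
  have *: "pderiv g = 0" if cop: "no_common_root g h" and W0: "wronskian g h = 0" for g h :: "'a poly"
  proof -
    obtain u v where uv: "u * g + v * h = 1" using no_common_root_bezout[OF cop] .
    have W: "pderiv g * h = g * pderiv h" using W0 by (simp add: wronskian_def)
    have "pderiv g = pderiv g * (u * g + v * h)" by (simp add: uv)
    also have "\<dots> = g * (pderiv g * u) + v * (pderiv g * h)" by (simp add: algebra_simps)
    also have "\<dots> = g * (pderiv g * u + v * pderiv h)" unfolding W by (simp add: algebra_simps)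
    finally have dvd: "g dvd pderiv g" by (metis dvd_triv_left)
    show ?thesis
    proof (rule ccontr)
      assume nz: "pderiv g \<noteq> 0"
      then have "degree g \<le> degree (pderiv g)" using dvd dvd_imp_degree_le by blast
      then have "degree g = 0" using degree_pderiv_le[of g] by linarith
      then obtain c where "g = [:c:]" by (rule degree_eq_zeroE)
      then show False using nz by (simp add: pderiv_pCons)
    qed
  qed
  show "pderiv g = 0" using *[OF assms] .
  have "wronskian h g = - wronskian g h" by (simp add: wronskian_def)
  then show "pderiv h = 0" using *[of h g] assms by (auto simp: no_common_root_def)
qed

lemma char_exp_alg_closure [simp]: "char_exp TYPE('a::field alg_closure) = char_exp TYPE('a)"
  by (simp add: char_exp_def)

text \<open>
  As long as the Wronskian vanishes, both \<open>g\<close> and \<open>h\<close> are polynomials in \<open>x\<^sup>p\<close>; replacing \<open>x\<^sup>p\<close> by \<open>x\<close>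
  lowers the degrees.
\<close>

lemma separable_part:
  fixes g h :: "'a::field poly"
  assumes "no_common_root g h" "degree g > 0 \<or> degree h > 0"
  shows "\<exists>s g1 h1. g = subst_pow (char_exp TYPE('a) ^ s) g1 \<and> h = subst_pow (char_exp TYPE('a) ^ s) h1 \<and>
    wronskian g1 h1 \<noteq> 0 \<and> no_common_root g1 h1 \<and> (degree g1 > 0 \<or> degree h1 > 0)"
  using assms
proof (induction "degree g + degree h" arbitrary: g h rule: less_induct)
  case less
  show ?case
  proof (cases "wronskian g h = 0")
    case False
    then show ?thesis
      using less.prems by (intro exI[of _ 0] exI[of _ g] exI[of _ h]) (simp add: subst_pow_1[unfolded One_nat_def])
  next
    case True
    note d = wronskian_eq_0[OF less.prems(1) True]
    let ?p = "CHAR('a)"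
    have p: "?p > 0"
    proof (rule ccontr)
      assume "\<not> ?p > 0"
      then have "coeff g k = 0 \<and> coeff h k = 0" if "k > 0" for k
        using pderiv_eq_0_imp_coeff[OF d(1), of k] pderiv_eq_0_imp_coeff[OF d(2), of k] that by auto
      then show False using less.prems(2) by (metis leading_coeff_0_iff degree_0 less_irrefl)
    qed
    then have pp: "?p \<ge> 2" using prime_CHAR[where 'e = 'a] prime_ge_2_nat by simp
    obtain g1 where g1: "g = subst_pow ?p g1" using pderiv_eq_0_imp_subst_pow[OF d(1) p] .
    obtain h1 where h1: "h = subst_pow ?p h1" using pderiv_eq_0_imp_subst_pow[OF d(2) p] .
    have deg: "degree g = degree g1 * ?p" "degree h = degree h1 * ?p"
      by (simp_all add: g1 h1 degree_pcompose degree_monom_eq)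
    have pos: "degree g1 > 0 \<or> degree h1 > 0" using less.prems(2) deg by auto
    have lt: "m < m * ?p" if "m > 0" for m using that pp by simp
    have le: "m \<le> m * ?p" for m using pp by simp
    have "degree g1 + degree h1 < degree g + degree h"
      unfolding deg using pos lt[of "degree g1"] lt[of "degree h1"]
        le[of "degree g1"] le[of "degree h1"] by linarith
    moreover have "no_common_root g1 h1"
      unfolding no_common_root_def
    proof
      fix z :: "'a alg_closure"
      obtain w where w: "w ^ ?p = z" using nth_root_exists[OF p] by blast
      have "ev g w = ev g1 z" "ev h w = ev h1 z" by (simp_all add: g1 h1 w)
      then show "ev g1 z \<noteq> 0 \<or> ev h1 z \<noteq> 0" using less.prems(1) by (metis no_common_root_def)
    qed
    ultimately obtain s g2 h2 where IH: "g1 = subst_pow (char_exp TYPE('a) ^ s) g2" "h1 = subst_pow (char_exp TYPE('a) ^ s) h2"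
      "wronskian g2 h2 \<noteq> 0" "no_common_root g2 h2" "degree g2 > 0 \<or> degree h2 > 0"
      using less.hyps[of g1 h1] pos by blast
    have "?p * char_exp TYPE('a) ^ s = char_exp TYPE('a) ^ Suc s" using p by (simp add: char_exp_def)
    then have "g = subst_pow (char_exp TYPE('a) ^ Suc s) g2" "h = subst_pow (char_exp TYPE('a) ^ Suc s) h2"
      using g1 h1 IH(1,2) by (simp_all only: subst_pow_subst_pow)
    then show ?thesis using IH(3-5) by blast
  qed
qed

lemma frobenius_add_poly:
  "(x + y :: 'a::field poly) ^ char_exp TYPE('a) ^ s = x ^ char_exp TYPE('a) ^ s + y ^ char_exp TYPE('a) ^ s"
  using frobenius_add[of x y s] prime_CHAR[where 'e = 'a] by (auto simp: char_exp_def)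

lemma linear_frobenius:
  fixes a b :: "'a::field" and s :: nat
  defines "q \<equiv> char_exp TYPE('a) ^ s"
  shows "[:b, a:] ^ q = subst_pow q [:b ^ q, a ^ q:]"
proof -
  have "[:b, a:] ^ q = ([:b:] + monom a 1) ^ q" by (simp add: monom_altdef)
  also have "\<dots> = [:b:] ^ q + monom a 1 ^ q" unfolding q_def by (rule frobenius_add_poly)
  also have "\<dots> = [:b ^ q:] + monom (a ^ q) q" by (simp add: poly_const_pow monom_power)
  also have "\<dots> = subst_pow q [:b ^ q, a ^ q:]" by (simp add: pcompose_pCons smult_monom mult.commute)
  finally show ?thesis .
qed

text \<open>
  Because \<open>x\<^sup>q - w\<^sup>q = (x - w)\<^sup>q\<close>.
\<close>

lemma order_subst_pow:
  fixes P :: "'a::field poly" and w :: 'a and s :: nat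
  defines "q \<equiv> char_exp TYPE('a) ^ s"
  assumes "P \<noteq> 0"
  shows "order w (subst_pow q P) = q * order (w ^ q) P"
proof -
  let ?z = "w ^ q"
  let ?m = "order ?z P"
  have q0: "q > 0" by (simp add: q_def char_exp_pos)
  obtain R where R: "P = [:- ?z, 1:] ^ ?m * R" "\<not> [:- ?z, 1:] dvd R"
    using order_decomp[OF assms(2)] by blast
  have Rz: "poly R ?z \<noteq> 0" using R(2) by (simp add: poly_eq_0_iff_dvd)
  have neg: "(- w) ^ q = - ?z"
  proof -
    have "(w + (- w)) ^ q = w ^ q + (- w) ^ q" unfolding q_def by (rule frobenius_add_field)
    then have "w ^ q + (- w) ^ q = 0" using q0 by (simp add: power_0_left)
    then show ?thesis by (simp add: eq_neg_iff_add_eq_0 add.commute)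
  qed
  have "subst_pow q [:- ?z, 1:] = [:- w, 1:] ^ q"
    using linear_frobenius[of "- w" 1 s] neg by (simp add: q_def)
  then have "subst_pow q P = [:- w, 1:] ^ (q * ?m) * subst_pow q R"
    by (subst R(1)) (simp add: pcompose_mult pcompose_power power_mult)
  moreover have Rw: "poly (subst_pow q R) w \<noteq> 0" using Rz by (simp add: poly_pcompose poly_monom)
  moreover have "subst_pow q R \<noteq> 0" using Rw by auto
  ultimately have "order w (subst_pow q P)
      = order w ([:- w, 1:] ^ (q * ?m)) + order w (subst_pow q R)"
    by (simp add: order_mult)
  then show ?thesis using order_0I[OF Rw] by (simp add: order_power_n_n)
qed

section \<open>Functions whose cyclotomic fibres come from Moebius transformations\<close>

context irreducible_cyclotomic
begin

lemma char_exp_power_not_dvd: "\<not> l dvd char_exp TYPE('a) ^ s"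
proof
  assume "l dvd char_exp TYPE('a) ^ s"
  then have *: "l dvd char_exp TYPE('a)" using prime_l prime_dvd_power by blast
  then have c: "CHAR('a) \<noteq> 0" using l_ge_5 by (auto simp: char_exp_def split: if_splits)
  then have "l = CHAR('a)" using * prime_l prime_CHAR[where 'e = 'a] by (simp add: char_exp_def primes_dvd_imp_eq)
  then show False using of_nat_l by simp
qed

text \<open>
  The equation is linear in \<open>y\<close>, and its leading coefficient \<open>a - c t\<close> can only vanish for \<open>t \<in> F\<close>.
\<close>

lemma base_root_exists:
  fixes A :: "'a ^ 2 ^ 2"
  assumes A: "invertible A" and t: "t \<notin> range to_ac"
  shows "\<exists>y. ev (num_of A) y = t * ev (den_of A) y"
    and "ev (num_of A) y = t * ev (den_of A) y \<Longrightarrow>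
      y = (to_ac (A $ 2 $ 2) * t - to_ac (A $ 1 $ 2)) / (to_ac (A $ 1 $ 1) - to_ac (A $ 2 $ 1) * t)"
proof -
  have nz: "to_ac (A $ 1 $ 1) - to_ac (A $ 2 $ 1) * t \<noteq> 0"
  proof
    assume *: "to_ac (A $ 1 $ 1) - to_ac (A $ 2 $ 1) * t = 0"
    show False
    proof (cases "A $ 2 $ 1 = 0")
      case True
      then show ?thesis using * A by (simp add: invertible_det_2)
    next
      case False
      then have "t = to_ac (A $ 1 $ 1 / A $ 2 $ 1)" using * by (simp add: field_simps)
      then show ?thesis using t by blast
    qed
  qed
  have eq: "ev (num_of A) y = t * ev (den_of A) y \<longleftrightarrow>
      y * (to_ac (A $ 1 $ 1) - to_ac (A $ 2 $ 1) * t) = to_ac (A $ 2 $ 2) * t - to_ac (A $ 1 $ 2)" for y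
    by (auto simp: algebra_simps)
  show "ev (num_of A) y = t * ev (den_of A) y \<Longrightarrow>
      y = (to_ac (A $ 2 $ 2) * t - to_ac (A $ 1 $ 2)) / (to_ac (A $ 1 $ 1) - to_ac (A $ 2 $ 1) * t)"
    unfolding eq using nz by (simp add: field_simps)
  show "\<exists>y. ev (num_of A) y = t * ev (den_of A) y"
    unfolding eq using nz
    by (intro exI[of _ "(to_ac (A $ 2 $ 2) * t - to_ac (A $ 1 $ 2)) / (to_ac (A $ 1 $ 1) - to_ac (A $ 2 $ 1) * t)"]) simp
qed

lemma den_nonzero:
  fixes A :: "'a ^ 2 ^ 2"
  assumes A: "invertible A" and y: "ev (num_of A) y = t * ev (den_of A) y"
  shows "ev (den_of A) y \<noteq> 0"
proof
  assume d: "ev (den_of A) y = 0"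
  then have n: "ev (num_of A) y = 0" using y by simp
  have "to_ac (A $ 1 $ 1 * A $ 2 $ 2 - A $ 1 $ 2 * A $ 2 $ 1)
      = to_ac (A $ 1 $ 1) * ev (den_of A) y - to_ac (A $ 2 $ 1) * ev (num_of A) y"
    by (simp add: algebra_simps)
  then have "to_ac (A $ 1 $ 1 * A $ 2 $ 2 - A $ 1 $ 2 * A $ 2 $ 1) = 0" using d n by simp
  then show False using A unfolding invertible_det_2 to_ac_eq_0_iff by blast
qed

lemma no_common_root_mobius:
  fixes A :: "'a ^ 2 ^ 2"
  assumes "invertible A"
  shows "no_common_root (num_of A) (den_of A)"
  unfolding no_common_root_def using den_nonzero[OF assms, of _ 0] by auto

lemma mobius_fibre_finite:
  fixes A :: "nat \<Rightarrow> 'a ^ 2 ^ 2"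
  assumes "\<And>i. i < n \<Longrightarrow> invertible (A i)"
  defines "Y \<equiv> {y. \<exists>i<n. \<exists>s\<in>roots_Phi. ev (num_of (A i)) y = s * ev (den_of (A i)) y}"
  shows "finite Y" "card Y \<le> n * (l - 1)"
proof -
  let ?f = "\<lambda>(i, t). (to_ac (A i $ 2 $ 2) * t - to_ac (A i $ 1 $ 2)) / (to_ac (A i $ 1 $ 1) - to_ac (A i $ 2 $ 1) * t)"
  have sub: "Y \<subseteq> ?f ` ({..<n} \<times> roots_Phi)"
  proof
    fix y assume "y \<in> Y"
    then obtain i s where i: "i < n" "s \<in> roots_Phi" "ev (num_of (A i)) y = s * ev (den_of (A i)) y"
      by (auto simp: Y_def)
    moreover have "s \<notin> range to_ac" using i roots_Phi_not_in_base by auto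
    ultimately have "y = ?f (i, s)" using base_root_exists(2)[OF assms(1)[OF i(1)]] by simp
    then show "y \<in> ?f ` ({..<n} \<times> roots_Phi)" using i by blast
  qed
  have fin: "finite ({..<n} \<times> roots_Phi)" using finite_roots_Phi by simp
  show "finite Y" using sub fin finite_surj by blast
  have "card Y \<le> card ({..<n} \<times> roots_Phi)" using sub fin by (rule surj_card_le[rotated])
  then show "card Y \<le> n * (l - 1)" by (simp add: card_cartesian_product card_roots_Phi)
qed

lemma inverse_power_in_roots_Phi:
  assumes "t \<in> roots_Phi"
  shows "t ^ (l - 1) \<in> roots_Phi" "t * t ^ (l - 1) = 1"
proof -
  have "\<not> l dvd l - 1" using l_ge_5 by (auto dest: dvd_imp_le)
  then show "t ^ (l - 1) \<in> roots_Phi" using assms by (simp add: roots_Phi_power_iff)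
  show "t * t ^ (l - 1) = 1" using assms l_ge_1 by (simp add: roots_Phi_iff flip: power_Suc)
qed

text \<open>
  Write \<open>g = g\<^sub>1(x\<^sup>q)\<close> and \<open>h = h\<^sub>1(x\<^sup>q)\<close> with nonzero Wronskian of \<open>g\<^sub>1\<close> and \<open>h\<^sub>1\<close>. The Wronskian bound
  applies to them with the \<open>q\<close>-th powers of the fibre points of the \<open>A\<^sub>i\<close> as the exceptional set, so their
  degree is at most \<open>n\<close> and all multiplicities are below \<open>l\<close>. Hence every fibre point of \<open>g/h\<close> is one of
  some \<open>A\<^sub>i\<close>. At such a point the relation of
  small degree gives \<open>g/h = A\<^sub>i\<^sup>J\<close> up to inversion with \<open>J = q j\<close>. If \<open>J\<close> were not a power of the
  characteristic exponent, there would be an \<open>\<omega> \<noteq> 1\<close> with \<open>\<omega>\<^sup>J = 1\<close>, and the point where \<open>A\<^sub>i\<close> takes the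
  value \<open>\<omega> s\<close> would lie in the fibre as well. It belongs to some \<open>A\<^sub>j\<close>: for \<open>j = i\<close>, \<open>\<omega>\<close> would
  be an \<open>l\<close>-th root of unity, but \<open>l\<close> does not divide \<open>J\<close>; for \<open>j \<noteq> i\<close>, powers of \<open>A\<^sub>i\<close> and \<open>A\<^sub>j\<close> would
  agree up to inversion, contradicting essential distinctness.
\<close>

lemma mobius_fibre_classification:
  fixes A :: "nat \<Rightarrow> 'a ^ 2 ^ 2" and g h :: "'a poly"
  assumes n: "2 * n \<le> l - 3"
    and inv: "\<And>i. i < n \<Longrightarrow> invertible (A i)"
    and ed: "\<And>i j. i < n \<Longrightarrow> j < n \<Longrightarrow> i \<noteq> j \<Longrightarrow> essentially_distinct (A i) (A j)"
    and cop: "no_common_root g h"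
    and deg: "degree g > 0 \<or> degree h > 0"
    and fib: "\<And>y. ev (Phi_form l g h) y = 0 \<Longrightarrow> \<not> l dvd order y (mp (Phi_form l g h)) \<Longrightarrow>
      \<exists>i<n. \<exists>s\<in>roots_Phi. ev (num_of (A i)) y = s * ev (den_of (A i)) y"
  obtains i k where "i < n"
    "g * den_of (A i) ^ (char_exp TYPE('a) ^ k) = h * num_of (A i) ^ (char_exp TYPE('a) ^ k) \<or>
     h * den_of (A i) ^ (char_exp TYPE('a) ^ k) = g * num_of (A i) ^ (char_exp TYPE('a) ^ k)"
proof -
  let ?Q = "Phi_form l g h"
  define Y where "Y = {y. \<exists>i<n. \<exists>s\<in>roots_Phi. ev (num_of (A i)) y = s * ev (den_of (A i)) y}"
  have Y: "finite Y" "card Y \<le> n * (l - 1)"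
    unfolding Y_def using mobius_fibre_finite[of n A] inv by blast+
  obtain s0 g1 h1 where sep: "g = subst_pow (char_exp TYPE('a) ^ s0) g1" "h = subst_pow (char_exp TYPE('a) ^ s0) h1"
    "wronskian g1 h1 \<noteq> 0" "no_common_root g1 h1" "degree g1 > 0 \<or> degree h1 > 0"
    using separable_part[OF cop deg] by blast
  define q where "q = char_exp TYPE('a) ^ s0"
  have q0: "q > 0" by (simp add: q_def char_exp_pos)
  have lq: "\<not> l dvd q" unfolding q_def by (rule char_exp_power_not_dvd)
  let ?Q1 = "Phi_form l g1 h1"
  have g: "g = subst_pow q g1" and h: "h = subst_pow q h1" using sep by (simp_all add: q_def)
  have Q_Q1: "?Q = subst_pow q ?Q1" by (simp add: g h pcompose_Phi_form)
  have nz1: "g1 \<noteq> 0 \<or> h1 \<noteq> 0" using sep(5) by auto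
  note Q1 = degree_Phi_form[OF nz1]
  let ?d = "max (degree g1) (degree h1)"
  have mpQ1: "mp ?Q1 = Phi_form l (mp g1) (mp h1)" by (simp add: Phi_form_def)
  have evQ: "ev ?Q y = 0 \<longleftrightarrow> ev ?Q1 (y ^ q) = 0" for y by (simp add: g h)
  have ordQ: "order y (mp ?Q) = q * order (y ^ q) (mp ?Q1)" for y
  proof -
    have "mp ?Q = subst_pow q (mp ?Q1)" by (simp only: Q_Q1 mp_pcompose mp_monom to_ac_1)
    then show ?thesis using order_subst_pow[of "mp ?Q1" y s0] Q1(2) by (simp add: q_def)
  qed
  have W: "wronskian (mp g1) (mp h1) = mp (wronskian g1 h1)" by (simp add: wronskian_def)
  have S3: "z \<in> (\<lambda>y. y ^ q) ` Y" if "poly (mp ?Q1) z = 0" "\<not> l dvd order z (mp ?Q1)" for z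
  proof -
    obtain w where w: "w ^ q = z" using nth_root_exists[OF q0] by blast
    have "ev ?Q w = 0" using that(1) w evQ by (simp add: ev_def)
    moreover have "\<not> l dvd order w (mp ?Q)"
      unfolding ordQ w using that(2) lq prime_l by (simp add: prime_dvd_mult_iff)
    ultimately have "w \<in> Y" using fib[of w] by (simp add: Y_def)
    then show ?thesis using w by blast
  qed
  have cop1: "poly (mp g1) z \<noteq> 0" if "poly (mp ?Q1) z = 0" for z
    using Phi_form_root_nonzero(1)[OF _ sep(4) l_ge_1, of z] that unfolding ev_Phi_form[symmetric] by (simp add: ev_def)
  have bound: "?d \<le> n" and ord_lt: "\<And>z. poly (mp ?Q1) z = 0 \<Longrightarrow> order z (mp ?Q1) < l"
    using wronskian_degree_bound[of l "mp g1" "mp h1" ?d "(\<lambda>y. y ^ q) ` Y" n]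
      of_nat_l_ac l_ge_5 sep(3,5) Q1 cop1 S3 Y card_image_le[OF Y(1), of "\<lambda>y. y ^ q"] n
    unfolding W mpQ1[symmetric] by (auto simp: not_less)
  have rootY: "y \<in> Y" if "ev ?Q y = 0" for y
  proof -
    have *: "poly (mp ?Q1) (y ^ q) = 0" using that evQ by (simp add: ev_def)
    have "order (y ^ q) (mp ?Q1) > 0" using * Q1(2) by (simp add: order_root)
    then have "\<not> l dvd order (y ^ q) (mp ?Q1)" using ord_lt[OF *] by (auto dest: dvd_imp_le)
    then have "\<not> l dvd order y (mp ?Q)"
      unfolding ordQ using lq prime_l by (simp add: prime_dvd_mult_iff)
    then show ?thesis using fib[OF that] by (simp add: Y_def)
  qed
  \<comment> \<open>Each fibre point yields a representation of \<open>g/h\<close> as a power of a Moebius transformation.\<close>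
  have form: "\<exists>j. 1 \<le> j \<and> j < l \<and>
      (g * den_of (A i) ^ (q * j) = h * num_of (A i) ^ (q * j) \<or> h * den_of (A i) ^ (q * j) = g * num_of (A i) ^ (q * j))"
    if y: "ev ?Q y = 0" and i: "i < n" and s: "s \<in> roots_Phi" "ev (num_of (A i)) y = s * ev (den_of (A i)) y" for y i s
  proof -
    let ?a = "A i $ 1 $ 1" and ?b = "A i $ 1 $ 2" and ?c = "A i $ 2 $ 1" and ?d' = "A i $ 2 $ 2"
    \<comment> \<open>The matrix with entries raised to the \<open>q\<close>-th power maps \<open>y\<^sup>q\<close> to \<open>s\<^sup>q\<close>.\<close>
    have frob: "ev [:b ^ q, a ^ q:] (y ^ q) = ev [:b, a:] y ^ q" for a b :: 'a
      using arg_cong[OF linear_frobenius[of b a s0], of "\<lambda>p. ev p y"] by (simp add: q_def)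
    have "(?a * ?d') ^ q = (?a * ?d' - ?b * ?c) ^ q + (?b * ?c) ^ q"
      using frobenius_add_field[of "?a * ?d' - ?b * ?c" "?b * ?c" s0] by (simp add: q_def)
    then have "?a ^ q * ?d' ^ q - ?b ^ q * ?c ^ q = (?a * ?d' - ?b * ?c) ^ q" by (simp add: power_mult_distrib)
    then have det: "?a ^ q * ?d' ^ q - ?b ^ q * ?c ^ q \<noteq> 0" using inv[OF i] by (simp add: invertible_det_2)
    have sq: "s ^ q \<in> roots_Phi" using s(1) lq by (simp add: roots_Phi_power_iff)
    have root: "ev [:?b ^ q, ?a ^ q:] (y ^ q) = s ^ q * ev [:?d' ^ q, ?c ^ q:] (y ^ q)"
      unfolding frob s(2) by (simp add: power_mult_distrib)
    obtain s' where s': "s' \<in> roots_Phi" "ev g y = s' * ev h y" using y Phi_form_root_iff[OF cop] by blast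
    then have "ev g1 (y ^ q) = s' * ev h1 (y ^ q)" by (simp add: g h)
    moreover have "2 * ?d \<le> l - 3" using bound n by linarith
    ultimately obtain j where j: "1 \<le> j" "j < l"
      "g1 * [:?d' ^ q, ?c ^ q:] ^ j = h1 * [:?b ^ q, ?a ^ q:] ^ j \<or> h1 * [:?d' ^ q, ?c ^ q:] ^ j = g1 * [:?b ^ q, ?a ^ q:] ^ j"
      using mobius_power_form[OF det sq root s'(1), of g1 h1 ?d] by (metis max.cobounded1 max.cobounded2)
    have lin: "subst_pow q ([:b ^ q, a ^ q:] ^ j) = [:b, a:] ^ (q * j)" for a b :: 'a
      using linear_frobenius[of b a s0] by (simp add: pcompose_power q_def power_mult)
    have "subst_pow q (p1 * [:?d' ^ q, ?c ^ q:] ^ j) = subst_pow q p1 * den_of (A i) ^ (q * j)"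
      "subst_pow q (p1 * [:?b ^ q, ?a ^ q:] ^ j) = subst_pow q p1 * num_of (A i) ^ (q * j)" for p1
      by (simp_all only: pcompose_mult lin)
    then show ?thesis using j(3) unfolding g h by (intro exI[of _ j] conjI j(1,2)) metis
  qed
  \<comment> \<open>A first fibre point.\<close>
  have "degree (mp ?Q1) > 0" using Q1(1) sep(5) l_ge_5 by (auto simp: less_max_iff_disj)
  from alg_closed_imp_poly_has_root[OF this] obtain z0 where "poly (mp ?Q1) z0 = 0" by blast
  moreover obtain y0 where "y0 ^ q = z0" using nth_root_exists[OF q0] by blast
  ultimately have y0: "ev ?Q y0 = 0" using evQ by (simp add: ev_def)
  then obtain i s where i: "i < n" "s \<in> roots_Phi" "ev (num_of (A i)) y0 = s * ev (den_of (A i)) y0"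
    using rootY[OF y0] by (auto simp: Y_def)
  obtain j where j: "1 \<le> j" "j < l" and
    J: "g * den_of (A i) ^ (q * j) = h * num_of (A i) ^ (q * j) \<or> h * den_of (A i) ^ (q * j) = g * num_of (A i) ^ (q * j)"
    using form[OF y0 i] by blast
  have lJ: "\<not> l dvd q * j" using lq j prime_l by (auto simp: prime_dvd_mult_iff dest: dvd_imp_le)
  \<comment> \<open>Split off the largest power of the characteristic: \<open>m\<close> is invertible in \<open>F\<close>.\<close>
  obtain k m where km: "q * j = char_exp TYPE('a) ^ k * m" "of_nat m \<noteq> (0 :: 'a)"
  proof (cases "CHAR('a) = 0")
    case True
    then show ?thesis using that[of 0 "q * j"] q0 j by (simp add: of_nat_eq_0_iff_char_dvd)
  next
    case False
    obtain m where m: "q * j = CHAR('a) ^ multiplicity CHAR('a) (q * j) * m" "\<not> CHAR('a) dvd m"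
    proof (rule multiplicity_decompose')
      show "q * j \<noteq> 0" using q0 j by simp
      show "\<not> CHAR('a) dvd 1" using prime_CHAR[OF False] by (simp add: prime_nat_iff)
    qed blast
    then show ?thesis using False that by (simp add: char_exp_def of_nat_eq_0_iff_char_dvd)
  qed
  have m0: "m \<noteq> 0" using km(2) by (cases m) auto
  show ?thesis
  proof (cases "m = 1")
    case True
    then show ?thesis using J km(1) i(1) that by simp
  next
    case False
    then have m2: "m \<ge> 2" using m0 by simp
    \<comment> \<open>A nontrivial \<open>m\<close>-th root of unity moves the fibre point to another one.\<close>
    obtain \<omega> :: "'a alg_closure" where \<omega>: "Phi_val m \<omega> = 0"
    proof -
      let ?P = "\<Sum>r<m. monom (1 :: 'a alg_closure) r"
      have "coeff ?P (m - 1) = 1" using m0 by (simp add: coeff_sum)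
      then have "degree ?P \<ge> m - 1" by (intro le_degree) simp
      then have "degree ?P > 0" using m2 by linarith
      from alg_closed_imp_poly_has_root[OF this] show ?thesis
        using that by (auto simp: poly_sum poly_monom Phi_val_def)
    qed
    have \<omega>m: "\<omega> ^ m = 1" using Phi_val_mult[of \<omega> m] \<omega> by simp
    have \<omega>1: "\<omega> \<noteq> 1"
    proof
      assume "\<omega> = 1"
      then have "of_nat m = (0 :: 'a alg_closure)" using \<omega> by (simp add: Phi_val_def)
      then show False using km(2) by (simp add: to_ac_of_nat_eq_0_iff)
    qed
    let ?J = "q * j"
    define t where "t = \<omega> * s"
    have tJ: "t ^ ?J = s ^ ?J"
      unfolding t_def power_mult_distrib km(1) by (simp add: mult.commute[of _ m] power_mult \<omega>m)
    have tU: "t ^ ?J \<in> roots_Phi" unfolding tJ using i(2) lJ by (simp add: roots_Phi_power_iff)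
    have tb: "t \<notin> range to_ac"
      using tU roots_Phi_not_in_base by (auto simp flip: to_ac_power)
    obtain y' where y': "ev (num_of (A i)) y' = t * ev (den_of (A i)) y'"
      using base_root_exists(1)[OF inv[OF i(1)] tb] by blast
    note d' = den_nonzero[OF inv[OF i(1)] y']
    have "\<exists>s\<in>roots_Phi. ev g y' = s * ev h y'"
      using J
    proof
      assume "g * den_of (A i) ^ ?J = h * num_of (A i) ^ ?J"
      from arg_cong[OF this, of "\<lambda>p. ev p y'"]
      have "ev g y' * ev (den_of (A i)) y' ^ ?J = (t ^ ?J * ev h y') * ev (den_of (A i)) y' ^ ?J"
        unfolding ev_simps(5,6) y' by (simp add: power_mult_distrib mult_ac)
      then have "ev g y' = t ^ ?J * ev h y'" using d' by (subst (asm) mult_right_cancel) simp_all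
      then show ?thesis using tU by blast
    next
      assume "h * den_of (A i) ^ ?J = g * num_of (A i) ^ ?J"
      from arg_cong[OF this, of "\<lambda>p. ev p y'"]
      have "ev h y' * ev (den_of (A i)) y' ^ ?J = (t ^ ?J * ev g y') * ev (den_of (A i)) y' ^ ?J"
        unfolding ev_simps(5,6) y' by (simp add: power_mult_distrib mult_ac)
      then have "ev h y' = t ^ ?J * ev g y'" using d' by (subst (asm) mult_right_cancel) simp_all
      then have "(t ^ ?J) ^ (l - 1) * ev h y' = ev g y'"
        using inverse_power_in_roots_Phi(2)[OF tU] by (simp add: mult.assoc[symmetric] mult.commute)
      then show ?thesis using inverse_power_in_roots_Phi(1)[OF tU] by metis
    qed
    then have Qy': "ev ?Q y' = 0" using Phi_form_root_iff[OF cop] by blast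
    then obtain i' s' where i': "i' < n" "s' \<in> roots_Phi" "ev (num_of (A i')) y' = s' * ev (den_of (A i')) y'"
      using rootY[OF Qy'] unfolding Y_def by blast
    show ?thesis
    proof (cases "i' = i")
      case True
      then have "t = s'" using i'(3) y' d' by simp
      then have "\<omega> ^ l * s ^ l = 1" using i'(2) by (simp add: t_def roots_Phi_iff flip: power_mult_distrib)
      then have "\<omega> \<in> roots_Phi" using i(2) \<omega>1 by (simp add: roots_Phi_iff)
      then have "l dvd m" using \<omega>m roots_Phi_power_eq_1_iff by blast
      then show ?thesis using lJ km(1) by simp
    next
      case ne: False
      obtain j' where j': "1 \<le> j'" and
        J': "g * den_of (A i') ^ (q * j') = h * num_of (A i') ^ (q * j') \<or> h * den_of (A i') ^ (q * j') = g * num_of (A i') ^ (q * j')"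
        using form[OF Qy' i'] by blast
      let ?N = "q * j'"
      have gh0: "g \<noteq> 0" "h \<noteq> 0" using Phi_form_root_nonzero[OF _ cop l_ge_1, of y0] y0 by auto
      have "\<not> essentially_distinct (A i) (A i')"
      proof (rule not_essentially_distinctI[OF inv[OF i(1)] inv[OF i'(1)]])
        show "1 \<le> ?J" "1 \<le> ?N" using q0 j j' by (simp_all add: Suc_le_eq)
        let ?n = "num_of (A i) ^ ?J" and ?e = "den_of (A i) ^ ?J" and ?n' = "num_of (A i') ^ ?N" and ?e' = "den_of (A i') ^ ?N"
        have c1: "?n * ?e' = ?e * ?n'" if "u * ?e = v * ?n" "u * ?e' = v * ?n'" "u \<noteq> 0" "v \<noteq> 0" for u v
        proof -
          have "(u * v) * (?n * ?e') = (v * ?n) * (u * ?e')" by (simp only: mult_ac)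
          also have "\<dots> = (u * v) * (?e * ?n')" unfolding that(1)[symmetric] that(2) by (simp only: mult_ac)
          finally show ?thesis using that(3,4) mult_left_cancel[of "u * v"] by (metis no_zero_divisors)
        qed
        have c2: "?n * ?n' = ?e * ?e'" if "u * ?e = v * ?n" "v * ?e' = u * ?n'" "u \<noteq> 0" "v \<noteq> 0" for u v
        proof -
          have "(u * v) * (?n * ?n') = (v * ?n) * (u * ?n')" by (simp only: mult_ac)
          also have "\<dots> = (u * v) * (?e * ?e')" unfolding that(1)[symmetric] that(2)[symmetric] by (simp only: mult_ac)
          finally show ?thesis using that(3,4) mult_left_cancel[of "u * v"] by (metis no_zero_divisors)
        qed
        show "?n * ?e' = ?e * ?n' \<or> ?n * ?n' = ?e * ?e'"
          using J J' c1[of g h] c1[of h g] c2[of g h] c2[of h g] gh0 by blast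
      qed
      then show ?thesis using ed[OF i(1) i'(1)] ne by simp
    qed
  qed
qed

end

section \<open>Subgroups of an elementary abelian group with prescribed elements\<close>

text \<open>
  A family that is a basis, over the field with \<open>l\<close> elements, of the group it generates.
\<close>

locale independent_family = comm_group G for G (structure) +
  fixes u :: "nat \<Rightarrow> 'a" and n l :: nat
  assumes prime_exp: "prime l"
    and u_closed: "i < n \<Longrightarrow> u i \<in> carrier G"
    and u_pow: "i < n \<Longrightarrow> u i [^] l = \<one>"
    and independent: "finprod G (\<lambda>i. u i [^] (t i :: nat)) {..<n} = \<one> \<Longrightarrow> i < n \<Longrightarrow> l dvd t i"
begin

definition comb :: "(nat \<Rightarrow> nat) \<Rightarrow> 'a" where
  "comb t = finprod G (\<lambda>i. u i [^] t i) {..<n}"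

lemma l_pos: "l > 0" and l_gt_1: "l > 1"
  using prime_gt_0_nat[OF prime_exp] prime_gt_1_nat[OF prime_exp] by auto

lemma comb_closed [simp]: "comb t \<in> carrier G"
  unfolding comb_def by (auto intro!: finprod_closed u_closed)

lemma comb_cong: "(\<And>i. i < n \<Longrightarrow> t i = t' i) \<Longrightarrow> comb t = comb t'"
  unfolding comb_def by (rule finprod_cong') (auto intro!: u_closed)

lemma comb_add: "comb (\<lambda>i. t i + t' i) = comb t \<otimes> comb t'"
proof -
  have "comb (\<lambda>i. t i + t' i) = finprod G (\<lambda>i. u i [^] t i \<otimes> u i [^] t' i) {..<n}"
    unfolding comb_def by (rule finprod_cong') (auto simp: nat_pow_mult u_closed)
  also have "\<dots> = comb t \<otimes> comb t'"
    unfolding comb_def by (rule finprod_multf) (auto intro!: u_closed)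
  finally show ?thesis .
qed

lemma comb_zero: "comb (\<lambda>i. 0) = \<one>"
  unfolding comb_def by simp

lemma comb_mult: "comb (\<lambda>i. k * t i) = comb t [^] k"
proof (induction k)
  case (Suc k)
  have "comb (\<lambda>i. Suc k * t i) = comb (\<lambda>i. k * t i + t i)" by (rule comb_cong) simp
  then show ?case using Suc by (simp add: comb_add)
qed (simp add: comb_zero)

lemma comb_pow_l: "comb t [^] l = \<one>"
proof -
  have "comb t [^] l = finprod G (\<lambda>i. u i [^] (l * t i)) {..<n}"
    by (simp add: comb_mult[symmetric]) (simp add: comb_def)
  also have "\<dots> = finprod G (\<lambda>i. \<one>) {..<n}"
    by (rule finprod_cong') (auto simp: u_pow u_closed simp flip: nat_pow_pow)
  finally show ?thesis by simp
qed

lemma comb_eq_iff: "comb t = comb t' \<longleftrightarrow> (\<forall>i<n. [t i = t' i] (mod l))"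
proof
  assume eq: "comb t = comb t'"
  \<comment> \<open>Multiplication by \<open>l - 1\<close> replaces negation of natural exponents.\<close>
  have "comb (\<lambda>i. t i + (l - 1) * t' i) = comb t' [^] (Suc (l - 1))"
    by (simp add: comb_add comb_mult eq m_comm)
  then have 1: "comb (\<lambda>i. t i + (l - 1) * t' i) = \<one>" using l_pos comb_pow_l by simp
  show "\<forall>i<n. [t i = t' i] (mod l)"
  proof (intro allI impI)
    fix i assume "i < n"
    then have "l dvd t i + (l - 1) * t' i" using independent[of "\<lambda>i. t i + (l - 1) * t' i" i] 1 by (simp add: comb_def)
    then have "[t i + (l - 1) * t' i = 0] (mod l)" by (simp add: cong_0_iff)
    then have "[t i + (l - 1) * t' i + t' i = 0 + t' i] (mod l)" by (intro cong_add) auto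
    moreover have "t i + (l - 1) * t' i + t' i = t i + l * t' i" using l_pos by (cases l) auto
    ultimately have "[t i + l * t' i = t' i] (mod l)" by (simp only: add_0)
    then show "[t i = t' i] (mod l)" by (simp add: cong_def)
  qed
next
  assume *: "\<forall>i<n. [t i = t' i] (mod l)"
  have red: "comb t = comb (\<lambda>i. t i mod l)" for t
  proof -
    have "comb t = comb (\<lambda>i. l * (t i div l) + t i mod l)" by (rule comb_cong) simp
    also have "\<dots> = comb (\<lambda>i. t i mod l)"
      unfolding comb_add comb_mult comb_pow_l by simp
    finally show ?thesis .
  qed
  show "comb t = comb t'"
    unfolding red[of t] red[of t'] using * by (intro comb_cong) (simp add: cong_def)
qed

definition single :: "nat \<Rightarrow> nat \<Rightarrow> nat \<Rightarrow> nat" where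
  "single i a = (\<lambda>j. if j = i then a else 0)"

lemma comb_single:
  assumes "i < n"
  shows "comb (single i a) = u i [^] a"
proof -
  have "comb (single i a) = finprod G (\<lambda>j. if i = j then u j [^] a else \<one>) {..<n}"
    unfolding comb_def single_def by (rule finprod_cong') (use assms in \<open>auto intro!: u_closed\<close>)
  also have "\<dots> = u i [^] a" using assms by (intro finprod_singleton) (auto intro!: u_closed)
  finally show ?thesis .
qed

lemma u_pow_eq_iff:
  assumes "i < n" "j < n"
  shows "u i [^] (a::nat) = u j [^] (b::nat) \<longleftrightarrow> (if i = j then [a = b] (mod l) else l dvd a \<and> l dvd b)"
proof -
  have "u i [^] a = u j [^] b \<longleftrightarrow> (\<forall>k<n. [single i a k = single j b k] (mod l))"
    by (simp add: comb_eq_iff flip: comb_single[OF assms(1)] comb_single[OF assms(2)])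
  also have "\<dots> \<longleftrightarrow> (if i = j then [a = b] (mod l) else l dvd a \<and> l dvd b)"
  proof (cases "i = j")
    case True
    then show ?thesis using assms by (auto simp: single_def)
  next
    case False
    then have "(\<forall>k<n. [single i a k = single j b k] (mod l)) \<longleftrightarrow> [a = 0] (mod l) \<and> [b = 0] (mod l)"
      using assms cong_sym_eq[of 0 b l] by (auto simp: single_def)
    then show ?thesis using False by (simp add: cong_0_iff)
  qed
  finally show ?thesis .
qed

lemma u_pow_eq_one_iff: "i < n \<Longrightarrow> u i [^] (a::nat) = \<one> \<longleftrightarrow> l dvd a"
  using u_pow_eq_iff[of i i a 0] by (simp add: cong_0_iff)

lemma generate_eq_comb: "generate G (u ` {..<n}) = range comb"
proof
  have "u i \<in> range comb" if "i < n" for i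
    using comb_single[OF that, of 1] u_closed[OF that] by (metis nat_pow_eone rangeI)
  show "generate G (u ` {..<n}) \<subseteq> range comb"
  proof
    fix x assume "x \<in> generate G (u ` {..<n})"
    then show "x \<in> range comb"
    proof (induction rule: generate.induct)
      case one
      show ?case using comb_zero by (metis rangeI)
    next
      case (incl h)
      then show ?case using \<open>\<And>i. i < n \<Longrightarrow> u i \<in> range comb\<close> by auto
    next
      case (inv h)
      then obtain i where i: "i < n" "h = u i" by auto
      have "u i [^] (l - 1) \<otimes> u i = \<one>"
        using u_pow[OF i(1)] l_pos by (metis Suc_diff_1 nat_pow_Suc)
      then have "inv (u i) = u i [^] (l - 1)" using i by (intro inv_equality) (auto intro: u_closed)
      then show ?case using comb_single[OF i(1), of "l - 1"] i by (metis rangeI)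
    next
      case (eng h1 h2)
      then obtain t1 t2 where "h1 = comb t1" "h2 = comb t2" by auto
      then have "h1 \<otimes> h2 = comb (\<lambda>i. t1 i + t2 i)" by (simp add: comb_add)
      then show ?case by simp
    qed
  qed
  have sub: "subgroup (generate G (u ` {..<n})) G"
    by (rule generate_is_subgroup) (auto intro!: u_closed)
  interpret H: subgroup "generate G (u ` {..<n})" G by (rule sub)
  have pow: "u i [^] (k::nat) \<in> generate G (u ` {..<n})" if "i < n" for i k
  proof -
    have "u i \<in> generate G (u ` {..<n})" using that by (intro generate.incl) auto
    then show ?thesis by (induction k) auto
  qed
  have "finprod G (\<lambda>i. u i [^] t i) A \<in> generate G (u ` {..<n})" if "A \<subseteq> {..<n}" for t :: "nat \<Rightarrow> nat" and A
    using finite_subset[OF that finite_lessThan] that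
  proof (induction A rule: finite_induct)
    case (insert i A)
    then have "finprod G (\<lambda>i. u i [^] t i) (insert i A) = u i [^] t i \<otimes> finprod G (\<lambda>i. u i [^] t i) A"
      by (intro finprod_insert) (auto intro!: u_closed)
    then show ?case using insert pow[of i "t i"] by auto
  qed simp
  then show "range comb \<subseteq> generate G (u ` {..<n})" unfolding comb_def by auto
qed

text \<open>
  The description of the span, applied to the family that consists of \<open>u i\<close> alone.
\<close>

lemma generate_single:
  assumes i: "i < n"
  shows "generate G {u i} = (\<lambda>t. u i [^] t) ` {..<l}"
proof -
  interpret one: independent_family G "\<lambda>_. u i" 1 l
  proof unfold_locales
    show "l dvd t j" if "finprod G (\<lambda>k. u i [^] t k) {..<1} = \<one>" "j < 1" for t :: "nat \<Rightarrow> nat" and j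
      using that u_closed[OF i] u_pow_eq_one_iff[OF i] by (simp add: lessThan_Suc)
  qed (auto intro: prime_exp u_closed[OF i] u_pow[OF i])
  have comb: "one.comb t = u i [^] t 0" for t
    unfolding one.comb_def using u_closed[OF i] by (simp add: lessThan_Suc)
  have "generate G {u i} = range one.comb" using one.generate_eq_comb by (simp add: lessThan_Suc)
  also have "\<dots> = range (\<lambda>t::nat. u i [^] t)" unfolding comb by auto
  also have "\<dots> = (\<lambda>t. u i [^] t) ` {..<l}"
  proof -
    have "u i [^] t \<in> (\<lambda>t. u i [^] t) ` {..<l}" for t :: nat
      using u_pow_eq_iff[OF i i] l_pos by (intro image_eqI[of _ _ "t mod l"]) (simp_all add: cong_def)
    then show ?thesis by auto
  qed
  finally show ?thesis .
qed

lemma card_generate_single: "i < n \<Longrightarrow> card (generate G {u i}) = l"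
  unfolding generate_single by (subst card_image) (auto simp: inj_on_def u_pow_eq_iff cong_def)

lemma inj_generate_single: "inj_on (\<lambda>i. generate G {u i}) {..<n}"
proof (rule inj_onI)
  fix i j assume ij: "i \<in> {..<n}" "j \<in> {..<n}" "generate G {u i} = generate G {u j}"
  then have "u i \<in> generate G {u j}" using generate.incl[of "u i" "{u i}" G] by simp
  then obtain t :: nat where t: "u i = u j [^] t" using generate_single[of j] ij by auto
  then have "u i [^] (1::nat) = u j [^] t" using u_closed ij by simp
  then show "i = j" using u_pow_eq_iff[of i j 1 t] ij l_gt_1 by (auto split: if_splits)
qed

lemma mem_of_power_mem:
  assumes "subgroup H G" "i < n" "u i [^] t \<in> H" "\<not> l dvd (t::nat)"
  shows "u i \<in> H"
proof -
  interpret H: subgroup H G by fact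
  have "coprime t l" using assms(4) prime_exp by (metis coprime_commute prime_imp_coprime)
  then obtain x where x: "[t * x = 1] (mod l)" using cong_solve_coprime_nat by auto
  have "(u i [^] t) [^] x \<in> H" by (induction x) (use assms(3) in auto)
  also have "(u i [^] t) [^] x = u i [^] (t * x)" using u_closed[OF assms(2)] by (simp add: nat_pow_pow)
  also have "\<dots> = u i [^] (1::nat)" using u_pow_eq_iff[OF assms(2,2), of "t * x" 1] x by (simp only: refl if_True)
  finally show ?thesis using u_closed[OF assms(2)] by simp
qed

text \<open>
  In the application \<open>C\<close> is the set of cyclotomic elements and \<open>T\<close> the set of residues \<open>\<plusminus>p\<^sup>2\<^sup>m\<close>.
\<close>

context
  fixes C :: "'a set" and T :: "nat set"
  assumes T_sub: "T \<subseteq> {1..<l}" and C_one: "\<one> \<in> C"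
    and C_iff: "{x \<in> generate G (u ` {..<n}). x \<in> C \<and> x \<noteq> \<one>} = (\<lambda>(i, t). u i [^] t) ` ({..<n} \<times> T)"
begin

lemma card_elements:
  "finite {x \<in> generate G (u ` {..<n}). x \<in> C \<and> x \<noteq> \<one>}"
  "card {x \<in> generate G (u ` {..<n}). x \<in> C \<and> x \<noteq> \<one>} = n * card T"
proof -
  have fin: "finite T" using T_sub finite_subset by blast
  show "finite {x \<in> generate G (u ` {..<n}). x \<in> C \<and> x \<noteq> \<one>}" unfolding C_iff using fin by simp
  have "inj_on (\<lambda>(i, t). u i [^] t) ({..<n} \<times> T)"
  proof (rule inj_onI, clarify)
    fix i a j b assume *: "i < n" "j < n" "a \<in> T" "b \<in> T" "u i [^] a = u j [^] b"
    then have ab: "1 \<le> a" "a < l" "1 \<le> b" "b < l" using T_sub by auto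
    then have "\<not> l dvd a" by (auto dest: dvd_imp_le)
    then have "i = j" "[a = b] (mod l)" using *(5) u_pow_eq_iff[OF *(1,2)] by (auto split: if_splits)
    then show "i = j \<and> a = b" using ab by (simp add: cong_def)
  qed
  then show "card {x \<in> generate G (u ` {..<n}). x \<in> C \<and> x \<noteq> \<one>} = n * card T"
    unfolding C_iff by (simp add: card_image card_cartesian_product)
qed

text \<open>
  A subgroup inside \<open>C\<close> that contains some \<open>u i [^] t \<noteq> \<one>\<close> contains \<open>u i\<close>. It cannot contain \<open>u j\<close> for
  another \<open>j\<close>, since \<open>u i \<otimes> u j\<close> is not a power of a single \<open>u k\<close>. So it consists of all powers
  of \<open>u i\<close>, and these lie in \<open>C\<close> only if \<open>T\<close> contains all exponents.
\<close>

lemma subgroups_within: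
  "{H. H \<subseteq> generate G (u ` {..<n}) \<and> subgroup H G \<and> H \<subseteq> C \<and> H \<noteq> {\<one>}} =
    (if T = {1..<l} then (\<lambda>i. generate G {u i}) ` {..<n} else {})"
proof -
  have elem: "\<exists>i<n. \<exists>t\<in>T. x = u i [^] t" if "x \<in> generate G (u ` {..<n})" "x \<in> C" "x \<noteq> \<one>" for x
  proof -
    have "x \<in> (\<lambda>(i, t). u i [^] t) ` ({..<n} \<times> T)" unfolding C_iff[symmetric] using that by simp
    then show ?thesis by auto
  qed
  have T_dvd: "\<not> l dvd t" if "t \<in> T" for t
    using that T_sub nat_dvd_not_less[of t l] by (auto simp: subset_iff)
  have fwd: "T = {1..<l} \<and> (\<exists>i<n. H = generate G {u i})"
    if H: "H \<subseteq> generate G (u ` {..<n})" "subgroup H G" "H \<subseteq> C" "H \<noteq> {\<one>}" for H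
  proof -
    interpret H: subgroup H G by fact
    obtain x where x: "x \<in> H" "x \<noteq> \<one>" using H(4) H.one_closed by blast
    obtain i t where i: "i < n" "t \<in> T" "x = u i [^] t" using elem[of x] x H by blast
    have ui: "u i \<in> H" using mem_of_power_mem[OF H(2) i(1)] x i T_dvd by blast
    have pow: "u i [^] (k::nat) \<in> H" for k by (induction k) (use ui in auto)
    have only: "j = i" if j: "j < n" "s \<in> T" "u j [^] s \<in> H" for j s
    proof (rule ccontr)
      assume ne: "j \<noteq> i"
      have uj: "u j \<in> H" using mem_of_power_mem[OF H(2) j(1,3)] T_dvd[OF j(2)] by blast
      have eq: "u i \<otimes> u j = comb (\<lambda>k. single i 1 k + single j 1 k)"
        using comb_single[OF i(1), of 1] comb_single[OF j(1), of 1] i j by (simp add: comb_add u_closed)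
      have uij: "u i \<otimes> u j \<in> H" using ui uj by simp
      have "u i \<otimes> u j \<noteq> \<one>"
      proof
        assume "u i \<otimes> u j = \<one>"
        then have "comb (\<lambda>k. single i 1 k + single j 1 k) = comb (\<lambda>k. 0)" by (simp add: eq comb_zero)
        then have "[single i 1 i + single j 1 i = 0] (mod l)" using i(1) by (auto simp: comb_eq_iff)
        then show False using ne l_gt_1 by (simp add: single_def cong_0_iff)
      qed
      then obtain k r where k: "k < n" "r \<in> T" "u i \<otimes> u j = u k [^] r" using elem[of "u i \<otimes> u j"] uij H by blast
      then have "comb (\<lambda>m. single i 1 m + single j 1 m) = comb (single k r)" using eq comb_single[OF k(1)] by simp
      then have *: "[single i 1 m + single j 1 m = single k r m] (mod l)" if "m < n" for m using that by (auto simp: comb_eq_iff)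
      show False
      proof (cases "k = i")
        case True
        then show False using *[OF j(1)] ne l_gt_1 by (simp add: single_def cong_0_iff)
      next
        case False
        then show False using *[OF i(1)] ne l_gt_1 by (simp add: single_def cong_0_iff)
      qed
    qed
    have "H = generate G {u i}"
    proof
      show "generate G {u i} \<subseteq> H" unfolding generate_single[OF i(1)] using pow by auto
      show "H \<subseteq> generate G {u i}"
      proof
        fix y assume y: "y \<in> H"
        show "y \<in> generate G {u i}"
        proof (cases "y = \<one>")
          case True
          then show ?thesis by (simp add: generate.one)
        next
          case False
          then obtain j s where j: "j < n" "s \<in> T" "y = u j [^] s" using elem[of y] y H by blast
          then have "j = i" using only[of j s] y by simp
          then show ?thesis using j T_sub unfolding generate_single[OF i(1)] by auto
        qed
      qed
    qed
    moreover have "T = {1..<l}"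
    proof
      show "{1..<l} \<subseteq> T"
      proof
        fix t assume t: "t \<in> {1..<l}"
        then have nd: "\<not> l dvd t" by (auto dest: dvd_imp_le)
        then have "u i [^] t \<noteq> \<one>" using u_pow_eq_one_iff[OF i(1)] by simp
        then obtain j s where j: "j < n" "s \<in> T" "u i [^] t = u j [^] s" using elem[of "u i [^] t"] pow[of t] H by blast
        then have "[t = s] (mod l)" using u_pow_eq_iff[OF i(1) j(1)] nd by (auto split: if_splits)
        then have "t = s" using t j(2) T_sub by (auto simp: cong_def subset_iff)
        then show "t \<in> T" using j by simp
      qed
    qed (rule T_sub)
    ultimately show ?thesis using i(1) by blast
  qed
  have bwd: "generate G {u i} \<subseteq> generate G (u ` {..<n}) \<and> subgroup (generate G {u i}) G \<and>
      generate G {u i} \<subseteq> C \<and> generate G {u i} \<noteq> {\<one>}" if i: "i < n" and T: "T = {1..<l}" for i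
  proof (intro conjI)
    show sub: "generate G {u i} \<subseteq> generate G (u ` {..<n})" using i by (intro mono_generate) auto
    show "subgroup (generate G {u i}) G" using i by (intro generate_is_subgroup) (auto intro: u_closed)
    show "generate G {u i} \<subseteq> C"
    proof
      fix x assume "x \<in> generate G {u i}"
      then obtain t where t: "t < l" "x = u i [^] t" unfolding generate_single[OF i] by auto
      show "x \<in> C"
      proof (cases "t = 0")
        case True
        then show ?thesis using t C_one by simp
      next
        case False
        then have "(i, t) \<in> {..<n} \<times> T" using T t i by auto
        then have "x \<in> {x \<in> generate G (u ` {..<n}). x \<in> C \<and> x \<noteq> \<one>}" unfolding C_iff using t by force
        then show ?thesis by simp
      qed
    qed
    show "generate G {u i} \<noteq> {\<one>}"
    proof
      assume "generate G {u i} = {\<one>}"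
      then have "l = card {\<one>}" using card_generate_single[OF i] by simp
      then show False using l_gt_1 by simp
    qed
  qed
  let ?L = "{H. H \<subseteq> generate G (u ` {..<n}) \<and> subgroup H G \<and> H \<subseteq> C \<and> H \<noteq> {\<one>}}"
  show ?thesis
  proof (cases "T = {1..<l}")
    case True
    have "?L \<subseteq> (\<lambda>i. generate G {u i}) ` {..<n}"
    proof
      fix H assume "H \<in> ?L"
      then obtain i where "i < n" "H = generate G {u i}" using fwd[of H] by blast
      then show "H \<in> (\<lambda>i. generate G {u i}) ` {..<n}" by simp
    qed
    moreover have "(\<lambda>i. generate G {u i}) ` {..<n} \<subseteq> ?L" using bwd[OF _ True] by auto
    ultimately show ?thesis using True by simp
  next
    case False
    then have "?L = {}" using fwd by blast
    then show ?thesis using False by simp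
  qed
qed

end

end

lemma (in group) cyclic_group_generate:
  assumes "x \<in> carrier G"
  shows "cyclic_group (G\<lparr>carrier := generate G {x}\<rparr>)"
proof -
  let ?H = "generate G {x}"
  have sub: "subgroup ?H G" using assms by (intro generate_is_subgroup) auto
  interpret H: group "G\<lparr>carrier := ?H\<rparr>" by (rule subgroup_imp_group[OF sub])
  have x: "x \<in> ?H" by (rule generate.incl) simp
  have "?H = range (\<lambda>k::int. x [^] k)" using generate_pow[OF assms] by auto
  also have "\<dots> = range (\<lambda>k::int. x [^]\<^bsub>G\<lparr>carrier := ?H\<rparr>\<^esub> k)" using int_pow_consistent[OF sub x] by simp
  finally show ?thesis unfolding H.cyclic_group using x by auto
qed

section \<open>Cyclotomic elements in the span of Moebius elements\<close>

lemma hom_mult_group_pow: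
  assumes "tm \<in> hom K2 (mult_group :: 'k::field monoid)" "x \<in> carrier K2"
  shows "tm (x [^]\<^bsub>K2\<^esub> (k::nat)) = tm x ^ k"
proof -
  interpret H: comm_group "mult_group :: 'k monoid" by (rule comm_group_mult_group)
  interpret tm: group_hom K2 "mult_group :: 'k monoid" tm by unfold_locales (rule assms)
  show ?thesis
    by (induction k) (use assms(2) tm.hom_one in \<open>simp_all add: tm.hom_mult mult.commute\<close>)
qed

lemma hom_mult_group_finprod:
  assumes "tm \<in> hom K2 (mult_group :: 'k::field monoid)" "finite A" "f \<in> A \<rightarrow> carrier K2"
  shows "tm (finprod K2 f A) = (\<Prod>i\<in>A. tm (f i))"
proof -
  interpret H: comm_group "mult_group :: 'k monoid" by (rule comm_group_mult_group)
  interpret tm: group_hom K2 "mult_group :: 'k monoid" tm by unfold_locales (rule assms)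
  show ?thesis
    using assms(2,3)
  proof (induction A rule: finite_induct)
    case empty
    then show ?case using tm.hom_one by simp
  next
    case (insert x F)
    then have *: "finprod K2 f F \<in> carrier K2" "f x \<in> carrier K2" by (auto intro!: K2.finprod_closed)
    have "finprod K2 f (insert x F) = f x \<otimes>\<^bsub>K2\<^esub> finprod K2 f F"
      using insert by (intro K2.finprod_insert) auto
    then show ?case using insert * tm.hom_mult[OF *(2,1)] by auto
  qed
qed

lemma Fract_eq_0_iff: "b \<noteq> 0 \<Longrightarrow> Fract a b = 0 \<longleftrightarrow> a = 0"
  by (simp add: Zero_fract_def eq_fract)

context irreducible_cyclotomic
begin

lemma mobius_eq:
  fixes A :: "'a ^ 2 ^ 2"
  assumes "invertible A"
  shows "mobius A = Fract (num_of A) (den_of A)" "num_of A \<noteq> 0" "den_of A \<noteq> 0"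
    "mobius A \<noteq> 0" "Phi_val l (mobius A) \<noteq> 0"
proof -
  show m: "mobius A = Fract (num_of A) (den_of A)" by (simp add: mobius_def)
  show nz: "num_of A \<noteq> 0" "den_of A \<noteq> 0" using assms by (auto simp: invertible_det_2)
  show "mobius A \<noteq> 0" using nz by (simp add: m Zero_fract_def eq_fract)
  show "Phi_val l (mobius A) \<noteq> 0"
    using degree_Phi_form(2)[of "num_of A" "den_of A"] nz(1)
    unfolding m Phi_val_Fract[OF nz(2) l_ge_1] Fract_eq_0_iff[OF power_not_zero[OF nz(2)]] by blast
qed

text \<open>
  The Wronskian of \<open>a x + b\<close> and \<open>c x + d\<close> is the determinant, so there is no ramification.
\<close>

lemma order_mobius:
  fixes A :: "'a ^ 2 ^ 2"
  assumes A: "invertible A" and y: "s \<in> roots_Phi" "ev (num_of A) y = s * ev (den_of A) y"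
  shows "order y (mp (Phi_form l (num_of A) (den_of A))) = 1"
proof -
  let ?g = "mp (num_of A)" and ?h = "mp (den_of A)"
  let ?det = "A $ 1 $ 1 * A $ 2 $ 2 - A $ 1 $ 2 * A $ 2 $ 1"
  have nz: "num_of A \<noteq> 0 \<or> den_of A \<noteq> 0" using mobius_eq(2)[OF A] by blast
  have Q: "mp (Phi_form l (num_of A) (den_of A)) = Phi_form l ?g ?h" by (simp only: Phi_form_def mp_sum mp_mult mp_power)
  have Q0: "Phi_form l ?g ?h \<noteq> 0" unfolding Q[symmetric] mp_eq_0_iff by (rule degree_Phi_form(2)[OF nz])
  have W: "wronskian ?g ?h = [:to_ac ?det:]"
    by (simp add: wronskian_def pderiv_pCons algebra_simps)
  have det: "?det \<noteq> 0" using A by (simp add: invertible_det_2)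
  have root: "ev (Phi_form l (num_of A) (den_of A)) y = 0"
    using Phi_form_root_iff[OF no_common_root_mobius[OF A]] y by blast
  then have "Phi_form l (ev (num_of A) y) (ev (den_of A) y) = 0" unfolding ev_Phi_form .
  from Phi_form_root_nonzero(1)[OF this no_common_root_mobius[OF A] l_ge_1]
  have gy: "poly ?g y \<noteq> 0" unfolding ev_def .
  have W0: "wronskian ?g ?h \<noteq> 0" using det unfolding W by (simp del: to_ac_diff to_ac_mult)
  have "order y (wronskian ?g ?h) = 0"
    using det unfolding W by (intro order_0I) (simp del: to_ac_diff to_ac_mult)
  then have "order y (Phi_form l ?g ?h) \<le> 1"
    using order_Phi_form_le[OF of_nat_l_ac Q0 W0 gy] by simp
  moreover have "order y (Phi_form l ?g ?h) \<noteq> 0"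
    using root Q0 unfolding ev_def Q by (simp add: order_root)
  ultimately show ?thesis unfolding Q by simp
qed

end

lemma char_exp_fract: "char_exp TYPE('a::field poly fract) = char_exp TYPE('a)"
proof -
  have "CHAR('a poly fract) = CHAR('a)"
  proof (rule CHAR_eqI)
    show "of_nat CHAR('a) = (0 :: 'a poly fract)"
      by (simp add: of_nat_fract of_nat_poly Zero_fract_def)
    show "CHAR('a) dvd r" if "of_nat r = (0 :: 'a poly fract)" for r
      using that by (simp add: of_nat_fract of_nat_poly Zero_fract_def eq_fract of_nat_eq_0_iff_char_dvd)
  qed
  then show ?thesis by (simp add: char_exp_def)
qed

locale mobius_family = irreducible_cyclotomic l field_type
  for l and field_type :: "'a::field itself" +
  fixes n :: nat and A :: "nat \<Rightarrow> 'a ^ 2 ^ 2"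
  assumes n_bound: "2 * n \<le> l - 3"
    and inv: "i < n \<Longrightarrow> invertible (A i)"
    and distinct: "i < n \<Longrightarrow> j < n \<Longrightarrow> i \<noteq> j \<Longrightarrow> essentially_distinct (A i) (A j)"
begin

abbreviation u :: "nat \<Rightarrow> ('a poly fract \<times> 'a poly fract \<Rightarrow>\<^sub>0 int) set" where
  "u i \<equiv> cyc l (mobius (A i))"

lemma u_carrier: "i < n \<Longrightarrow> u i \<in> carrier K2"
  using mobius_eq(4,5)[OF inv] by (intro cyc_closed[OF prime_l])

text \<open>
  What is needed of a tame symbol at \<open>y\<close>: its values on cyclotomic elements.
\<close>

definition tame_formula where
  "tame_formula tm y \<longleftrightarrow> (\<forall>g h :: 'a poly. g \<noteq> 0 \<longrightarrow> h \<noteq> 0 \<longrightarrow> no_common_root g h \<longrightarrow>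
    tm (cyc l (Fract g h)) =
      (if ev (Phi_form l g h) y = 0 then (ev g y / ev h y) ^ order y (mp (Phi_form l g h)) else 1))"

lemma tame_symbol_exists: "\<exists>tm. tm \<in> hom K2 (mult_group :: 'a alg_closure monoid) \<and> tame_formula tm y"
proof -
  obtain tm where tm: "tm \<in> hom K2 (mult_group :: 'a alg_closure monoid)"
    "\<And>g h. \<lbrakk>g \<noteq> 0; h \<noteq> 0; no_common_root g h; Phi_form l g h \<noteq> 0\<rbrakk> \<Longrightarrow>
      tm (cyc l (Fract g h)) =
        (if ev (Phi_form l g h) y = 0 then (ev g y / ev h y) ^ order y (mp (Phi_form l g h)) else 1)"
    using tame_symbol_at[OF prime_l odd_l, of y] by blast
  then have "tame_formula tm y" unfolding tame_formula_def using degree_Phi_form(2) by blast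
  then show ?thesis using tm(1) by blast
qed

lemma tame_u:
  assumes tm: "tame_formula tm y" and i: "i < n"
  shows "s \<in> roots_Phi \<Longrightarrow> ev (num_of (A i)) y = s * ev (den_of (A i)) y \<Longrightarrow> tm (u i) = s"
    and "\<nexists>s. s \<in> roots_Phi \<and> ev (num_of (A i)) y = s * ev (den_of (A i)) y \<Longrightarrow> tm (u i) = 1"
proof -
  note cop = no_common_root_mobius[OF inv[OF i]] and m = mobius_eq[OF inv[OF i]]
  have eq: "tm (u i) = (if ev (Phi_form l (num_of (A i)) (den_of (A i))) y = 0
      then (ev (num_of (A i)) y / ev (den_of (A i)) y) ^ order y (mp (Phi_form l (num_of (A i)) (den_of (A i)))) else 1)"
    using tm m(2,3) cop unfolding m(1) tame_formula_def by blast
  show "tm (u i) = s" if s: "s \<in> roots_Phi" "ev (num_of (A i)) y = s * ev (den_of (A i)) y"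
  proof -
    have "ev (Phi_form l (num_of (A i)) (den_of (A i))) y = 0" using Phi_form_root_iff[OF cop] s by blast
    then have "tm (u i) = ev (num_of (A i)) y / ev (den_of (A i)) y"
      unfolding eq order_mobius[OF inv[OF i] s] by simp
    then show ?thesis using den_nonzero[OF inv[OF i] s(2)] unfolding s(2) by simp
  qed
  show "tm (u i) = 1" if "\<nexists>s. s \<in> roots_Phi \<and> ev (num_of (A i)) y = s * ev (den_of (A i)) y"
  proof -
    have "ev (Phi_form l (num_of (A i)) (den_of (A i))) y \<noteq> 0" using Phi_form_root_iff[OF cop] that by blast
    then show ?thesis unfolding eq by (rule if_not_P)
  qed
qed

text \<open>
  At a common fibre point, the relation of small degree, applied to \<open>A j\<close> in the role of \<open>g/h\<close>, would make
  \<open>A j\<close> a power of \<open>A i\<close> up to inversion.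
\<close>

lemma fibres_disjoint:
  assumes ij: "i < n" "j < n" "i \<noteq> j"
    and s: "s \<in> roots_Phi" "ev (num_of (A i)) y = s * ev (den_of (A i)) y"
  shows "\<nexists>s'. s' \<in> roots_Phi \<and> ev (num_of (A j)) y = s' * ev (den_of (A j)) y"
proof
  assume "\<exists>s'. s' \<in> roots_Phi \<and> ev (num_of (A j)) y = s' * ev (den_of (A j)) y"
  then obtain s' where s': "s' \<in> roots_Phi" "ev (num_of (A j)) y = s' * ev (den_of (A j)) y" by blast
  have det: "A i $ 1 $ 1 * A i $ 2 $ 2 - A i $ 1 $ 2 * A i $ 2 $ 1 \<noteq> 0"
    using inv[OF ij(1)] by (simp add: invertible_det_2)
  have deg: "degree (num_of (A j)) \<le> 1" "degree (den_of (A j)) \<le> 1" by simp_all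
  have "2 * 1 \<le> l - 3" using l_ge_5 by simp
  from mobius_power_form[OF det s s' deg this]
  obtain k where k: "1 \<le> k" "num_of (A j) * den_of (A i) ^ k = den_of (A j) * num_of (A i) ^ k \<or>
      den_of (A j) * den_of (A i) ^ k = num_of (A j) * num_of (A i) ^ k" by metis
  then have "num_of (A i) ^ k * den_of (A j) ^ 1 = den_of (A i) ^ k * num_of (A j) ^ 1 \<or>
      num_of (A i) ^ k * num_of (A j) ^ 1 = den_of (A i) ^ k * den_of (A j) ^ 1"
    unfolding power_one_right by (metis mult.commute)
  then have "\<not> essentially_distinct (A i) (A j)"
    using not_essentially_distinctI[OF inv[OF ij(1)] inv[OF ij(2)] k(1) order_refl] by blast
  then show False using distinct ij by blast
qed

lemma tame_comb:
  assumes "tm \<in> hom K2 (mult_group :: 'k::field monoid)"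
  shows "tm (finprod K2 (\<lambda>i. u i [^]\<^bsub>K2\<^esub> (t i :: nat)) {..<n}) = (\<Prod>i<n. tm (u i) ^ t i)"
  by (subst hom_mult_group_finprod[OF assms])
    (auto intro!: prod.cong u_carrier hom_mult_group_pow[OF assms])

text \<open>
  The tame symbol at a fibre point of \<open>A i\<close> ignores all other generators and sends \<open>u i\<close> to a root of
  unity of order \<open>l\<close>; it is the \<open>i\<close>-th coordinate function of the family.
\<close>

lemma tame_coordinate:
  assumes i: "i < n"
  obtains tm y s where "tm \<in> hom K2 (mult_group :: 'a alg_closure monoid)" "tame_formula tm y" "s \<in> roots_Phi"
    "\<And>t. tm (finprod K2 (\<lambda>i. u i [^]\<^bsub>K2\<^esub> (t i :: nat)) {..<n}) = s ^ t i"
proof -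
  obtain s where s: "s \<in> roots_Phi" using roots_Phi_nonempty by blast
  then have "s \<notin> range to_ac" using roots_Phi_not_in_base by auto
  then obtain y where y: "ev (num_of (A i)) y = s * ev (den_of (A i)) y"
    using base_root_exists(1)[OF inv[OF i]] by blast
  obtain tm where tm: "tm \<in> hom K2 (mult_group :: 'a alg_closure monoid)" "tame_formula tm y"
    using tame_symbol_exists by blast
  have tmi: "tm (u i) = s" using tame_u(1)[OF tm(2) i s y] .
  have tmj: "tm (u j) = 1" if "j < n" "j \<noteq> i" for j
    using tame_u(2)[OF tm(2) that(1) fibres_disjoint[OF i that(1) _ s y]] that(2) by simp
  have "tm (finprod K2 (\<lambda>i. u i [^]\<^bsub>K2\<^esub> (t i :: nat)) {..<n}) = s ^ t i" for t
  proof -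
    have "(\<Prod>j<n. tm (u j) ^ t j) = (\<Prod>j<n. if j = i then s ^ t j else 1)"
      by (intro prod.cong) (auto simp: tmi tmj)
    then show ?thesis using i by (simp add: tame_comb[OF tm(1)])
  qed
  then show ?thesis using that[OF tm s] by blast
qed

sublocale fam: independent_family K2 u n l
proof unfold_locales
  show "prime l" by (rule prime_l)
  show "u i \<in> carrier K2" if "i < n" for i using u_carrier that .
  show "u i [^]\<^bsub>K2\<^esub> l = \<one>\<^bsub>K2\<^esub>" if "i < n" for i
    using mobius_eq(4,5)[OF inv[OF that]] by (intro cyc_pow_l[OF prime_l])
  show "l dvd t i" if 1: "finprod K2 (\<lambda>i. u i [^]\<^bsub>K2\<^esub> t i) {..<n} = \<one>\<^bsub>K2\<^esub>" and i: "i < n" for t :: "nat \<Rightarrow> nat" and i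
  proof -
    obtain tm y s where tm: "tm \<in> hom K2 (mult_group :: 'a alg_closure monoid)" "tame_formula tm y" "s \<in> roots_Phi"
      "\<And>t. tm (finprod K2 (\<lambda>i. u i [^]\<^bsub>K2\<^esub> (t i :: nat)) {..<n}) = s ^ t i"
      using tame_coordinate[OF i] by blast
    have "tm \<one>\<^bsub>K2\<^esub> = 1"
      using hom_mult_group_pow[OF tm(1) K2.one_closed, of 0] by simp
    then have "s ^ t i = 1" using tm(4)[of t] 1 by simp
    then show ?thesis using roots_Phi_power_eq_1_iff[OF tm(3)] by simp
  qed
qed

text \<open>
  Where all \<open>u i\<close> have trivial tame symbol, so has \<open>c\<^sub>l(f)\<close>; hence the fibre points of \<open>f\<close> of multiplicity
  prime to \<open>l\<close> are fibre points of the family, and the classification determines \<open>f\<close>. It applies to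
  nonconstant \<open>f\<close> only, but for constant \<open>f\<close> all tame symbols, and so all coordinates, are trivial.
\<close>

lemma cyclotomic_in_span:
  assumes f: "f \<noteq> 0" "Phi_val l f \<noteq> 0" and comb: "cyc l f = fam.comb t" and nontriv: "cyc l f \<noteq> \<one>\<^bsub>K2\<^esub>"
  obtains i k where "i < n"
    "cyc l f = u i [^]\<^bsub>K2\<^esub> (char_exp TYPE('a) ^ (2 * k)) \<or>
     cyc l f = inv\<^bsub>K2\<^esub> (u i [^]\<^bsub>K2\<^esub> (char_exp TYPE('a) ^ (2 * k)))"
proof -
  obtain g h where gh: "f = Fract g h" "h \<noteq> 0" "no_common_root g h" by (rule coprime_fraction)
  have g0: "g \<noteq> 0" using f(1) gh by (auto simp: Zero_fract_def eq_fract)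
  note Q = degree_Phi_form[of g h]
  let ?Q = "Phi_form l g h"
  have fib: "\<exists>i<n. \<exists>s\<in>roots_Phi. ev (num_of (A i)) y = s * ev (den_of (A i)) y"
    if y: "ev ?Q y = 0" "\<not> l dvd order y (mp ?Q)" for y
  proof (rule ccontr)
    assume none: "\<not> ?thesis"
    obtain tm where tm: "tm \<in> hom K2 (mult_group :: 'a alg_closure monoid)" "tame_formula tm y"
      using tame_symbol_exists by blast
    have "tm (u i) = 1" if "i < n" for i using tame_u(2)[OF tm(2) that] none that by blast
    then have "tm (cyc l f) = 1" unfolding comb fam.comb_def tame_comb[OF tm(1)] by simp
    moreover have "tm (cyc l f) = (ev g y / ev h y) ^ order y (mp ?Q)"
      using tm(2) g0 gh y(1) unfolding tame_formula_def gh(1) by simp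
    moreover have "ev g y / ev h y \<in> roots_Phi"
    proof -
      have *: "Phi_form l (ev g y) (ev h y) = 0" using y(1) by simp
      show ?thesis using Phi_form_eq_0_imp[OF *] Phi_form_root_nonzero(2)[OF * gh(3) l_ge_1] by simp
    qed
    ultimately show False using roots_Phi_power_eq_1_iff y(2) by metis
  qed
  have deg: "degree g > 0 \<or> degree h > 0"
  proof (rule ccontr)
    assume "\<not> ?thesis"
    then have "degree ?Q = 0" using Q(1) g0 by simp
    then obtain c where c: "?Q = [:c:]" by (rule degree_eq_zeroE)
    then have noroot: "ev ?Q y \<noteq> 0" for y using Q(2) g0 by (simp del: ev_Phi_form)
    have "l dvd t i" if i: "i < n" for i
    proof -
      obtain tm y s where tm: "tm \<in> hom K2 (mult_group :: 'a alg_closure monoid)" "tame_formula tm y" "s \<in> roots_Phi"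
        "\<And>t. tm (finprod K2 (\<lambda>i. u i [^]\<^bsub>K2\<^esub> (t i :: nat)) {..<n}) = s ^ t i"
        using tame_coordinate[OF i] by blast
      have "tm (cyc l f) = 1" using tm(2) g0 gh noroot[of y] unfolding tame_formula_def gh(1) by simp
      then have "s ^ t i = 1" using tm(4)[of t] unfolding comb fam.comb_def by simp
      then show ?thesis using roots_Phi_power_eq_1_iff[OF tm(3)] by simp
    qed
    then have "fam.comb t = fam.comb (\<lambda>_. 0)" by (simp add: fam.comb_eq_iff cong_0_iff)
    then show False using nontriv comb fam.comb_zero by simp
  qed
  obtain i k where i: "i < n" and
    ik: "g * den_of (A i) ^ (char_exp TYPE('a) ^ k) = h * num_of (A i) ^ (char_exp TYPE('a) ^ k) \<or>
     h * den_of (A i) ^ (char_exp TYPE('a) ^ k) = g * num_of (A i) ^ (char_exp TYPE('a) ^ k)"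
    using mobius_fibre_classification[OF n_bound inv distinct gh(3) deg fib] by blast
  let ?q = "char_exp TYPE('a) ^ k"
  note m = mobius_eq[OF inv[OF i]]
  have frob: "cyc l (mobius (A i) ^ ?q) = u i [^]\<^bsub>K2\<^esub> (char_exp TYPE('a) ^ (2 * k))"
    using cyc_frobenius[OF prime_l m(4,5), of k] by (simp add: char_exp_fract)
  have mq: "mobius (A i) ^ ?q \<noteq> 0" "Phi_val l (mobius (A i) ^ ?q) \<noteq> 0"
    using m(4,5) Phi_val_frobenius[of l "mobius (A i)" k] by (simp_all add: char_exp_fract)
  have pw: "mobius (A i) ^ ?q = Fract (num_of (A i) ^ ?q) (den_of (A i) ^ ?q)"
    unfolding m(1) by (rule Fract_power)
  show ?thesis
    using ik
  proof
    assume "g * den_of (A i) ^ ?q = h * num_of (A i) ^ ?q"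
    then have "f = mobius (A i) ^ ?q"
      unfolding pw gh(1) eq_fract(1)[OF gh(2) power_not_zero[OF m(3)]] by (simp only: mult.commute)
    then show ?thesis using that[OF i] frob by blast
  next
    assume "h * den_of (A i) ^ ?q = g * num_of (A i) ^ ?q"
    then have "f = inverse (mobius (A i) ^ ?q)"
      unfolding pw gh(1) inverse_fract eq_fract(1)[OF gh(2) power_not_zero[OF m(2)]]
      by (simp only: mult.commute)
    then show ?thesis using that[OF i] cyc_inverse(2)[OF prime_l odd_l mq] frob by metis
  qed
qed

end

section \<open>The exponents of cyclotomic elements\<close>

text \<open>
  The residues \<open>\<plusminus>e\<^sup>2\<^sup>m\<close> modulo \<open>l\<close>, represented by positive numbers below \<open>l\<close>.
\<close>

definition cyc_exponents :: "nat \<Rightarrow> nat \<Rightarrow> nat set" where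
  "cyc_exponents l e = {t \<in> {1..<l}. \<exists>m. [t = e ^ (2 * m)] (mod l) \<or> [t + e ^ (2 * m) = 0] (mod l)}"

lemma cyc_exponents_subset: "cyc_exponents l e \<subseteq> {1..<l}"
  by (auto simp: cyc_exponents_def)

lemma cyc_exponents_1: "l \<ge> 3 \<Longrightarrow> cyc_exponents l 1 = {1, l - 1}"
  by (auto simp: cyc_exponents_def cong_def mod_Suc split: if_splits)

lemma trivial_cyc_exponents:
  assumes "l \<ge> 3"
  shows "{1, l - 1} \<subseteq> cyc_exponents l e"
proof -
  have "[1 = e ^ (2 * 0)] (mod l)" "[l - 1 + e ^ (2 * 0) = 0] (mod l)"
    using assms by (simp_all add: cong_0_iff)
  moreover have "1 \<in> {1..<l}" "l - 1 \<in> {1..<l}" using assms by auto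
  ultimately show ?thesis unfolding cyc_exponents_def by blast
qed

text \<open>
  \<open>Z_set\<close> leaves out the residues \<open>\<plusminus>1\<close>, which arise from \<open>m = 0\<close>.
\<close>

lemma card_cyc_exponents:
  assumes "l \<ge> 3"
  shows "card (cyc_exponents l p) = 2 + card (Z_set l p)"
proof -
  have fin: "finite (cyc_exponents l p)" by (simp add: cyc_exponents_def)
  have iff: "int t \<in> Z_set l p \<longleftrightarrow> t \<in> cyc_exponents l p - {1, l - 1}" for t
  proof -
    have 1: "[int t = int p ^ (2 * m)] (mod int l) \<longleftrightarrow> [t = p ^ (2 * m)] (mod l)" for m
      by (simp flip: cong_int_iff)
    have 2: "[int t = - (int p ^ (2 * m))] (mod int l) \<longleftrightarrow> [t + p ^ (2 * m) = 0] (mod l)" for m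
    proof -
      have "[int t = - (int p ^ (2 * m))] (mod int l) \<longleftrightarrow> [int (t + p ^ (2 * m)) = int 0] (mod int l)"
        by (simp add: cong_iff_dvd_diff)
      then show ?thesis by (simp only: cong_int_iff)
    qed
    show ?thesis unfolding Z_set_def cyc_exponents_def using assms by (auto simp: 1 2)
  qed
  have "Z_set l p = int ` (cyc_exponents l p - {1, l - 1})"
  proof (intro equalityI subsetI)
    fix x assume x: "x \<in> Z_set l p"
    then have "x = int (nat x)" by (auto simp: Z_set_def)
    then show "x \<in> int ` (cyc_exponents l p - {1, l - 1})" using x iff by (metis imageI)
  qed (use iff in auto)
  then have "card (Z_set l p) = card (cyc_exponents l p - {1, l - 1})" by (simp add: card_image)
  also have "\<dots> = card (cyc_exponents l p) - 2"
    using trivial_cyc_exponents[OF assms] assms fin by (subst card_Diff_subset) auto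
  finally show ?thesis
    using card_mono[OF fin trivial_cyc_exponents[OF assms]] assms by simp
qed

text \<open>
  The power is a square root of 1 modulo \<open>l\<close>, and it is not 1 by the order of \<open>p\<close>.
\<close>

lemma primroot_half_power:
  assumes l: "prime l" "l \<ge> 5" and p: "residue_primroot l p"
  shows "[p ^ ((l - 1) div 2) + 1 = 0] (mod l)"
proof -
  let ?h = "(l - 1) div 2"
  have odd: "odd l" using l by (simp add: prime_odd_nat)
  then have h: "2 * ?h = l - 1" by (auto elim: oddE)
  have ord: "ord l p = l - 1" using p l by (simp add: residue_primroot_def totient_prime)
  have h0: "0 < ?h" "?h < l - 1" using h l by auto
  have "[p ^ (2 * ?h) = 1] (mod l)" using ord_works[of p l] ord h by simp
  then have "int l dvd int (p ^ (2 * ?h)) - 1" by (simp flip: cong_iff_dvd_diff add: cong_int_iff[symmetric])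
  also have "int (p ^ (2 * ?h)) - 1 = (int (p ^ ?h) - 1) * (int (p ^ ?h) + 1)"
    by (simp add: algebra_simps power_mult power2_eq_square mult_2 power_add)
  finally have "int l dvd int (p ^ ?h) - 1 \<or> int l dvd int (p ^ ?h) + 1"
    using l(1) by (simp add: prime_dvd_mult_iff)
  moreover have "\<not> int l dvd int (p ^ ?h) - 1"
  proof
    assume "int l dvd int (p ^ ?h) - 1"
    then have "[int (p ^ ?h) = int 1] (mod int l)" by (simp add: cong_iff_dvd_diff)
    then have "[p ^ ?h = 1] (mod l)" by (simp only: cong_int_iff)
    then show False using ord_works[of p l] ord h0 by metis
  qed
  ultimately have "int l dvd int (p ^ ?h + 1)" by (simp add: add.commute)
  then show ?thesis by (simp only: cong_0_iff int_dvd_int_iff)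
qed

text \<open>
  By the preceding lemma, \<open>-p\<^sup>k\<close> is \<open>p\<close> to the power \<open>k + (l - 1)/2\<close>. So the set consists of all residues iff
  negation exchanges even and odd powers of \<open>p\<close>, that is iff \<open>(l - 1)/2\<close> is odd; otherwise \<open>p\<close> itself is missing.
\<close>

lemma cyc_exponents_full_iff:
  assumes l: "prime l" "l \<ge> 5" and p: "residue_primroot l p"
  shows "cyc_exponents l p = {1..<l} \<longleftrightarrow> [l = 3] (mod 4)"
proof -
  let ?h = "(l - 1) div 2"
  have odd: "odd l" using l by (simp add: prime_odd_nat)
  have cop: "coprime l p" and ord: "ord l p = l - 1"
    using p l by (simp_all add: residue_primroot_def totient_prime)
  have l_mod: "[l = 3] (mod 4) \<longleftrightarrow> \<not> even ?h" using odd by (auto elim!: oddE simp: cong_def)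
  note half = primroot_half_power[OF l p]
  have neg: "[t + p ^ k = 0] (mod l) \<longleftrightarrow> [t = p ^ (k + ?h)] (mod l)" for t k
  proof -
    have *: "[p ^ (k + ?h) + p ^ k = 0] (mod l)"
      using cong_scalar_left[OF half, of "p ^ k"] by (simp add: power_add distrib_left add.commute)
    show ?thesis
    proof
      assume "[t + p ^ k = 0] (mod l)"
      then have "[t + p ^ k = p ^ (k + ?h) + p ^ k] (mod l)" by (rule cong_trans[OF _ cong_sym[OF *]])
      then show "[t = p ^ (k + ?h)] (mod l)" by (simp add: cong_add_rcancel_nat)
    next
      assume "[t = p ^ (k + ?h)] (mod l)"
      then have "[t + p ^ k = p ^ (k + ?h) + p ^ k] (mod l)" by (intro cong_add) auto
      then show "[t + p ^ k = 0] (mod l)" by (rule cong_trans[OF _ *])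
    qed
  qed
  show ?thesis
  proof
    assume full: "cyc_exponents l p = {1..<l}"
    show "[l = 3] (mod 4)"
    proof (rule ccontr)
      assume "\<not> [l = 3] (mod 4)"
      then have ev: "even ?h" using l_mod by simp
      have "\<not> l dvd p" using cop l(1) by (metis coprime_def dvd_refl not_prime_unit)
      then have "p mod l \<in> {1..<l}" using l by (auto simp: dvd_eq_mod_eq_0 Suc_le_eq)
      then have "p mod l \<in> cyc_exponents l p" unfolding full .
      then obtain m where m: "[p mod l = p ^ (2 * m)] (mod l) \<or> [p mod l + p ^ (2 * m) = 0] (mod l)"
        by (auto simp: cyc_exponents_def)
      then obtain k where k: "even k" "[p mod l = p ^ k] (mod l)"
      proof -
        have "even (2 * m)" "even (2 * m + ?h)" using ev by simp_all
        moreover have "[p mod l = p ^ (2 * m)] (mod l) \<or> [p mod l = p ^ (2 * m + ?h)] (mod l)"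
          using m unfolding neg .
        ultimately show ?thesis using that by blast
      qed
      then have "[p ^ 1 = p ^ k] (mod l)" by (simp add: cong_def)
      then have "[1 = k] (mod (l - 1))" using order_divides_expdiff[OF cop] ord by metis
      then have "[1 = k] (mod 2)" by (rule cong_dvd_modulus_nat) (use odd in simp)
      then show False using k(1) by (simp add: cong_def)
    qed
  next
    assume "[l = 3] (mod 4)"
    then have oddh: "odd ?h" using l_mod by simp
    have "{1..<l} \<subseteq> cyc_exponents l p"
    proof
      fix t assume t: "t \<in> {1..<l}"
      then have "\<not> l dvd t" using nat_dvd_not_less[of t l] by auto
      then have "coprime t l" using prime_imp_coprime[OF l(1), of t] by (simp add: coprime_commute)
      then have "t \<in> totatives l" using t by (simp add: totatives_def Suc_le_eq)
      then have "t \<in> (\<lambda>i. p ^ i mod l) ` {..<totient l}"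
        using residue_primroot_is_generator[of l p] p l by (simp add: bij_betw_def)
      then obtain i where i: "t = p ^ i mod l" by blast
      then have ti: "[t = p ^ i] (mod l)" by (simp add: cong_def)
      have "\<exists>m. [t = p ^ (2 * m)] (mod l) \<or> [t + p ^ (2 * m) = 0] (mod l)"
      proof (cases "even i")
        case True
        then show ?thesis using ti by (metis dvd_def)
      next
        case False
        have "[t + p ^ (i + ?h) = 0] (mod l)"
          unfolding neg
        proof -
          have "2 * ?h = l - 1" using odd by (auto elim: oddE)
          then have "[i = i + ?h + ?h] (mod (l - 1))" by (simp add: cong_def add.assoc flip: mult_2)
          then have "[p ^ i = p ^ (i + ?h + ?h)] (mod l)" using order_divides_expdiff[OF cop] ord by metis
          then show "[t = p ^ (i + ?h + ?h)] (mod l)" using ti cong_trans by blast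
        qed
        moreover have "even (i + ?h)" using False oddh by simp
        ultimately show ?thesis by (metis dvd_def)
      qed
      then show "t \<in> cyc_exponents l p" using t by (simp add: cyc_exponents_def)
    qed
    then show "cyc_exponents l p = {1..<l}" by (auto simp: cyc_exponents_def)
  qed
qed

text \<open>
  The polynomial \<open>X\<^sup>p - X\<close> has at most \<open>p\<close> roots, and the elements of the prime field are \<open>p\<close> of them.
\<close>

lemma frobenius_fixed_in_base:
  fixes c :: "'a::field alg_closure"
  assumes p: "CHAR('a) = p" "prime p" and c: "c ^ p = c"
  shows "c \<in> range to_ac"
proof -
  let ?P = "monom 1 p - [:0, 1:] :: 'a alg_closure poly"
  have pc: "prime CHAR('a alg_closure)" using p by simp
  have p1: "p > 1" using p(2) by (rule prime_gt_1_nat)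
  have "coeff ?P p = 1" using p1 by (simp add: coeff_pCons split: nat.split)
  then have P0: "?P \<noteq> 0" by (metis coeff_0 zero_neq_one)
  have deg: "degree ?P \<le> p" using p1 by (intro degree_diff_le) (auto simp: degree_monom_eq)
  have fixed: "(of_nat i :: 'a alg_closure) ^ p = of_nat i" for i
  proof (induction i)
    case (Suc i)
    have "(of_nat (Suc i) :: 'a alg_closure) ^ p = 1 ^ p + of_nat i ^ p"
      unfolding of_nat_Suc by (rule freshmans_dream[OF pc]) (simp add: p)
    then show ?case using Suc by simp
  qed (use p1 in \<open>simp add: power_0_left\<close>)
  have sub: "of_nat ` {..<p} \<subseteq> {x. poly ?P x = 0}" by (auto simp: poly_monom fixed)
  have inj: "inj_on (of_nat :: nat \<Rightarrow> 'a alg_closure) {..<p}"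
    by (auto simp: inj_on_def of_nat_eq_iff_cong_CHAR p cong_def)
  have "card {x. poly ?P x = 0} \<le> card (of_nat ` {..<p} :: 'a alg_closure set)"
    using card_poly_roots_bound[OF P0] deg by (simp add: card_image[OF inj])
  then have "{x. poly ?P x = 0} = of_nat ` {..<p}"
    using card_seteq[OF poly_roots_finite[OF P0] sub] by simp
  moreover have "poly ?P c = 0" using c by (simp add: poly_monom)
  ultimately obtain i where "c = of_nat i" by blast
  then have "c = to_ac (of_nat i)" by simp
  then show ?thesis by blast
qed

context irreducible_cyclotomic
begin

text \<open>
  Let \<open>k\<close> be the order of \<open>p\<close> modulo \<open>l\<close> and \<open>s\<close> a root of \<open>\<Phi>\<^sub>l\<close>. The product of the \<open>X - s^(p^i)\<close> for \<open>i < k\<close>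
  is invariant under Frobenius, so its coefficients lie in \<open>F\<close>. It has the root \<open>s\<close> and degree \<open>k\<close>, so
  \<open>k \<ge> l - 1\<close> by irreducibility of \<open>\<Phi>\<^sub>l\<close>.
\<close>

lemma CHAR_primroot:
  assumes "CHAR('a) \<noteq> 0"
  shows "residue_primroot l CHAR('a)"
proof -
  define p where "p = CHAR('a)"
  have p: "prime p" unfolding p_def by (rule prime_CHAR[OF assms])
  have pc: "prime CHAR('a alg_closure)" using p by (simp add: p_def)
  have cop: "coprime l p"
  proof -
    have "l \<noteq> p" using of_nat_l by (auto simp: p_def)
    then show ?thesis using prime_l p by (simp add: primes_coprime)
  qed
  define k where "k = ord l p"
  have k0: "k > 0" using cop by (simp add: k_def)
  obtain s where s: "s \<in> roots_Phi" using roots_Phi_nonempty by blast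
  define c where "c i = s ^ (p ^ i)" for i
  have c_Suc: "c i ^ p = c (Suc i)" for i by (simp add: c_def mult.commute flip: power_mult)
  have "[p ^ k = 1] (mod l)" using ord_works[of p l] by (simp add: k_def)
  then have ck: "c k = c 0" using roots_Phi_power_eq_iff[OF s, of "p ^ k" 1] by (simp add: c_def)
  define P where "P = (\<Prod>i<k. [:- c i, 1:])"
  have frob: "poly P y ^ p = poly P (y ^ p)" for y
  proof -
    have dist: "(y - c i) ^ p = y ^ p - c (Suc i)" for i
      using freshmans_dream[OF pc, of p "y - c i" "c i"] by (simp add: p_def c_Suc[unfolded p_def])
    have "poly P y ^ p = (\<Prod>i<k. (y - c i) ^ p)" by (simp add: P_def poly_prod prod_power_distrib)
    also have "\<dots> = (\<Prod>i<k. y ^ p - c (Suc i))" by (simp only: dist)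
    also have "\<dots> = (\<Prod>i<k. y ^ p - c i)"
    proof -
      have "(\<Prod>i<Suc k. y ^ p - c i) = (y ^ p - c 0) * (\<Prod>i<k. y ^ p - c (Suc i))"
        by (rule prod.lessThan_Suc_shift)
      moreover have "(\<Prod>i<Suc k. y ^ p - c i) = (\<Prod>i<k. y ^ p - c i) * (y ^ p - c k)" by simp
      moreover have "(\<Prod>i<k. y ^ p - c (Suc i)) = (\<Prod>i\<in>{1..k}. y ^ p - c i)"
        by (rule prod.reindex_bij_witness[of _ "\<lambda>i. i - 1" Suc]) auto
      moreover have "(\<Prod>i<k. y ^ p - c i) = (\<Prod>i\<in>{1..k}. y ^ p - c i)"
        by (rule prod.reindex_bij_witness[of _ "\<lambda>i. if i = k then 0 else i" "\<lambda>i. if i = 0 then k else i"])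
          (use k0 ck in auto)
      ultimately show ?thesis by simp
    qed
    also have "\<dots> = poly P (y ^ p)" by (simp add: P_def poly_prod)
    finally show ?thesis .
  qed
  have "map_poly (\<lambda>x. x ^ p) P = P"
  proof -
    have p0: "p > 0" using p by (rule prime_gt_0_nat)
    have "poly (map_poly (\<lambda>x. x ^ p) P - P) z = 0" for z
    proof -
      obtain y where y: "y ^ p = z" using nth_root_exists[OF p0] by blast
      have "poly P y ^ p = (\<Sum>i\<le>degree P. (coeff P i * y ^ i) ^ p)"
        unfolding poly_altdef by (rule freshmans_dream_sum[OF pc]) (simp add: p_def)
      also have "\<dots> = (\<Sum>i\<le>degree P. coeff P i ^ p * z ^ i)"
        by (simp add: power_mult_distrib mult.commute flip: y power_mult)
      also have "\<dots> = poly (map_poly (\<lambda>x. x ^ p) P) z"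
      proof -
        have "degree (map_poly (\<lambda>x. x ^ p) P) = degree P"
          by (rule degree_map_poly) simp
        then show ?thesis unfolding poly_altdef using p0 by (simp add: coeff_map_poly power_0_left)
      qed
      finally show ?thesis using frob[of y] y by simp
    qed
    then have "map_poly (\<lambda>x. x ^ p) P - P = 0" by (intro poly_zero_cofinite[of 1]) simp_all
    then show ?thesis by simp
  qed
  then have "coeff P i ^ p = coeff P i" for i
    using arg_cong[of _ _ "\<lambda>q. coeff q i"] p by (metis coeff_map_poly power_0_left prime_gt_0_nat less_irrefl)
  then have base: "coeff P i \<in> range to_ac" for i
    using frobenius_fixed_in_base[OF p_def[symmetric] p] by blast
  define N where "N = map_poly of_ac P"
  have "mp N = P"
    by (rule poly_eqI) (simp add: N_def coeff_map_poly to_ac_of_ac[OF base])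
  have degP: "degree P = k" unfolding P_def by (subst degree_prod_eq_sum_degree) auto
  have "ev N s = 0" unfolding ev_def \<open>mp N = P\<close> P_def using k0
    by (auto simp: poly_prod c_def intro!: prod_zero bexI[of _ 0])
  moreover have "N \<noteq> 0" using \<open>mp N = P\<close> degP k0 by auto
  moreover have "degree N = k" using degP unfolding \<open>mp N = P\<close>[symmetric] by simp
  ultimately have "k \<ge> l - 1" using roots_Phi_min_degree[OF s, of N] by fastforce
  moreover have "k dvd totient l" unfolding k_def by (rule order_divides_totient[OF cop])
  then have "k \<le> l - 1" using prime_l l_ge_5 by (auto simp: totient_prime dest: dvd_imp_le)
  ultimately have "ord l p = totient l" using prime_l by (simp add: k_def totient_prime)
  then show ?thesis using cop l_ge_5 by (simp add: residue_primroot_def p_def)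
qed

lemma cyc_exponents_full_iff_CHAR:
  "cyc_exponents l (char_exp TYPE('a)) = {1..<l} \<longleftrightarrow>
    CHAR('a) \<noteq> 0 \<and> [l = 3] (mod 4) \<and> residue_primroot l CHAR('a)"
proof (cases "CHAR('a) = 0")
  case True
  have "2 \<in> {1..<l}" "2 \<notin> {1, l - 1}" using l_ge_5 by auto
  moreover have "cyc_exponents l 1 = {1, l - 1}" using l_ge_5 by (intro cyc_exponents_1) simp
  ultimately have "cyc_exponents l 1 \<noteq> {1..<l}" by blast
  then show ?thesis using True by (simp add: char_exp_def)
next
  case False
  then show ?thesis
    using cyc_exponents_full_iff[OF prime_l l_ge_5 CHAR_primroot[OF False]] CHAR_primroot[OF False]
    by (simp add: char_exp_def)
qed

end

context mobius_family
begin

text \<open>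
  \<open>1 = c\<^sub>l(1)\<close>, as \<open>\<Phi>\<^sub>l(1) = l\<close> is nonzero in \<open>F\<close>.
\<close>

lemma one_cyclotomic: "\<one>\<^bsub>K2\<^esub> \<in> (cyclotomic_elements l :: ('a poly fract \<times> 'a poly fract \<Rightarrow>\<^sub>0 int) set set)"
proof -
  have "Phi_val l 1 \<noteq> (0 :: 'a poly fract)"
    using of_nat_l by (simp add: Phi_val_def of_nat_fract of_nat_poly Zero_fract_def eq_fract)
  moreover have "cyc l 1 = (\<one>\<^bsub>K2\<^esub> :: ('a poly fract \<times> 'a poly fract \<Rightarrow>\<^sub>0 int) set)"
    using calculation by (simp add: cyc_prime[OF prime_l])
  ultimately show ?thesis
    unfolding cyclotomic_elements_def poly_cyclotomic_poly_prime[OF prime_l] by force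
qed

text \<open>
  One inclusion is \<open>cyclotomic_in_span\<close>; for the other, \<open>u i\<close> to the power \<open>e\<^sup>2\<^sup>m\<close> is the cyclotomic element of
  the function \<open>A\<^sub>i\<close> raised to the power \<open>e\<^sup>m\<close>, and its inverse is that of the inverse function.
\<close>

lemma cyclotomic_elements_in_generate:
  "{x \<in> generate K2 (u ` {..<n}). x \<in> cyclotomic_elements l \<and> x \<noteq> \<one>\<^bsub>K2\<^esub>} =
    (\<lambda>(i, t). u i [^]\<^bsub>K2\<^esub> t) ` ({..<n} \<times> cyc_exponents l (char_exp TYPE('a)))"
proof -
  let ?e = "char_exp TYPE('a)" and ?T = "cyc_exponents l (char_exp TYPE('a))"
  have inv_u: "inv\<^bsub>K2\<^esub> (u i [^]\<^bsub>K2\<^esub> a) = u i [^]\<^bsub>K2\<^esub> b" if i: "i < n" and ab: "[b + a = 0] (mod l)" for i and a b :: nat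
  proof -
    have "u i [^]\<^bsub>K2\<^esub> b \<otimes>\<^bsub>K2\<^esub> u i [^]\<^bsub>K2\<^esub> a = u i [^]\<^bsub>K2\<^esub> (b + a)" using u_carrier[OF i] by (rule K2.nat_pow_mult)
    also have "\<dots> = \<one>\<^bsub>K2\<^esub>" using ab fam.u_pow_eq_one_iff[OF i] by (simp add: cong_0_iff)
    finally show ?thesis using u_carrier[OF i] by (intro K2.inv_equality) auto
  qed
  have cyc_in: "u i [^]\<^bsub>K2\<^esub> (?e ^ (2 * m)) \<in> cyclotomic_elements l"
    "inv\<^bsub>K2\<^esub> (u i [^]\<^bsub>K2\<^esub> (?e ^ (2 * m))) \<in> cyclotomic_elements l" if i: "i < n" for i m
  proof -
    note m = mobius_eq(4,5)[OF inv[OF i]]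
    let ?f = "mobius (A i) ^ (?e ^ m)"
    have f: "?f \<noteq> 0" "Phi_val l ?f \<noteq> 0"
      using m Phi_val_frobenius[of l "mobius (A i)" m] by (simp_all add: char_exp_fract)
    have c: "cyc l ?f = u i [^]\<^bsub>K2\<^esub> (?e ^ (2 * m))"
      using cyc_frobenius[OF prime_l m, of m] by (simp add: char_exp_fract)
    show "u i [^]\<^bsub>K2\<^esub> (?e ^ (2 * m)) \<in> cyclotomic_elements l"
      unfolding cyclotomic_elements_def poly_cyclotomic_poly_prime[OF prime_l] c[symmetric] using f by blast
    show "inv\<^bsub>K2\<^esub> (u i [^]\<^bsub>K2\<^esub> (?e ^ (2 * m))) \<in> cyclotomic_elements l"
      unfolding cyclotomic_elements_def poly_cyclotomic_poly_prime[OF prime_l] c[symmetric]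
        cyc_inverse(2)[OF prime_l odd_l f, symmetric]
      using f(1) cyc_inverse(1)[OF prime_l odd_l f] nonzero_imp_inverse_nonzero by blast
  qed
  show ?thesis
  proof (intro equalityI subsetI)
    fix x assume x: "x \<in> {x \<in> generate K2 (u ` {..<n}). x \<in> cyclotomic_elements l \<and> x \<noteq> \<one>\<^bsub>K2\<^esub>}"
    then obtain t where t: "x = fam.comb t" using fam.generate_eq_comb by auto
    obtain f where f: "f \<noteq> 0" "Phi_val l f \<noteq> 0" "x = cyc l f"
      using x unfolding cyclotomic_elements_def poly_cyclotomic_poly_prime[OF prime_l] by blast
    obtain i k where i: "i < n" and ik: "x = u i [^]\<^bsub>K2\<^esub> (?e ^ (2 * k)) \<or> x = inv\<^bsub>K2\<^esub> (u i [^]\<^bsub>K2\<^esub> (?e ^ (2 * k)))"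
      using cyclotomic_in_span[OF f(1,2), of t] t x f(3) by auto
    have nd: "\<not> l dvd ?e ^ (2 * k)" by (rule char_exp_power_not_dvd)
    obtain r where r: "r \<in> ?T" "x = u i [^]\<^bsub>K2\<^esub> r"
    proof -
      let ?r0 = "?e ^ (2 * k) mod l"
      have r0: "1 \<le> ?r0" "?r0 < l" using nd l_ge_5 by (auto simp: dvd_eq_mod_eq_0 Suc_le_eq)
      show ?thesis
        using ik
      proof
        assume "x = u i [^]\<^bsub>K2\<^esub> (?e ^ (2 * k))"
        also have "\<dots> = u i [^]\<^bsub>K2\<^esub> ?r0" using fam.u_pow_eq_iff[OF i i] by (simp add: cong_def)
        finally have "x = u i [^]\<^bsub>K2\<^esub> ?r0" .
        moreover have "?r0 \<in> ?T" using r0 by (auto simp: cyc_exponents_def cong_def)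
        ultimately show ?thesis using that by blast
      next
        assume x: "x = inv\<^bsub>K2\<^esub> (u i [^]\<^bsub>K2\<^esub> (?e ^ (2 * k)))"
        have "[(l - ?r0) + ?r0 = 0] (mod l)" using r0 by (simp add: cong_0_iff)
        then have c: "[(l - ?r0) + ?e ^ (2 * k) = 0] (mod l)" by (simp add: cong_def mod_add_right_eq)
        then have "x = u i [^]\<^bsub>K2\<^esub> (l - ?r0)" using inv_u[OF i] x by blast
        moreover have "l - ?r0 \<in> ?T" using r0 c by (auto simp: cyc_exponents_def)
        ultimately show ?thesis using that by blast
      qed
    qed
    then show "x \<in> (\<lambda>(i, t). u i [^]\<^bsub>K2\<^esub> t) ` ({..<n} \<times> ?T)" using i by auto
  next
    fix x assume "x \<in> (\<lambda>(i, t). u i [^]\<^bsub>K2\<^esub> t) ` ({..<n} \<times> ?T)"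
    then obtain i t where it: "i < n" "t \<in> ?T" "x = u i [^]\<^bsub>K2\<^esub> t" by auto
    then obtain m where t: "1 \<le> t" "t < l" and m: "[t = ?e ^ (2 * m)] (mod l) \<or> [t + ?e ^ (2 * m) = 0] (mod l)"
      by (auto simp: cyc_exponents_def)
    have "\<not> l dvd t" using t nat_dvd_not_less[of t l] by auto
    then have ne: "x \<noteq> \<one>\<^bsub>K2\<^esub>" using it fam.u_pow_eq_one_iff by simp
    have gen: "x \<in> generate K2 (u ` {..<n})"
      unfolding fam.generate_eq_comb it(3) fam.comb_single[OF it(1), symmetric] by simp
    have "x \<in> cyclotomic_elements l"
      using m
    proof
      assume "[t = ?e ^ (2 * m)] (mod l)"
      then have "x = u i [^]\<^bsub>K2\<^esub> (?e ^ (2 * m))" using it fam.u_pow_eq_iff[OF it(1,1)] by simp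
      then show ?thesis using cyc_in(1)[OF it(1)] by simp
    next
      assume "[t + ?e ^ (2 * m) = 0] (mod l)"
      then have "x = inv\<^bsub>K2\<^esub> (u i [^]\<^bsub>K2\<^esub> (?e ^ (2 * m)))" using inv_u[OF it(1)] it(3) by simp
      then show ?thesis using cyc_in(2)[OF it(1)] by simp
    qed
    then show "x \<in> {x \<in> generate K2 (u ` {..<n}). x \<in> cyclotomic_elements l \<and> x \<noteq> \<one>\<^bsub>K2\<^esub>}"
      using gen ne by simp
  qed
qed

lemmas card_cyclotomic_elements =
  fam.card_elements[OF cyc_exponents_subset one_cyclotomic cyclotomic_elements_in_generate]

lemmas cyclotomic_subgroups_eq =
  fam.subgroups_within[OF cyc_exponents_subset one_cyclotomic cyclotomic_elements_in_generate]

end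

theorem theorem1p1:
  fixes l n :: nat
    and G :: "('a::field poly fract \<times> 'a poly fract \<Rightarrow>\<^sub>0 int) set set"
  assumes "prime l" and "l \<ge> 5"
    and "irreducible (cyclotomic_poly l :: 'a poly)"
    and "n \<ge> 1" and "real n \<le> (real l - 3) / 2"
    and "G \<in> generated_subgroups l n"
  shows
    "finite (nontrivial_cyclotomic_elements_in l G) \<and>
     finite (nontrivial_cyclotomic_subgroups_in l G) \<and>
     (CHAR('a) = 0 \<longrightarrow>
        num_cyclotomic_elements l G = 2 * n \<and> num_cyclotomic_subgroups l G = 0) \<and>
     (CHAR('a) \<noteq> 0 \<longrightarrow>
        num_cyclotomic_elements l G = n * (2 + card (Z_set l CHAR('a)))) \<and>
     (CHAR('a) \<noteq> 0 \<longrightarrow>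
        (num_cyclotomic_subgroups l G > 0 \<longleftrightarrow>
           [l = 3] (mod 4) \<and> residue_primroot l CHAR('a)) \<and>
        ([l = 3] (mod 4) \<and> residue_primroot l CHAR('a) \<longrightarrow>
           num_cyclotomic_subgroups l G = n)) \<and>
     (\<forall>H \<in> nontrivial_cyclotomic_subgroups_in l G.
        cyclic_group (K2\<lparr>carrier := H\<rparr>) \<and> card H = l \<and> H \<in> generated_subgroups l 1)"
proof -
  obtain A :: "nat \<Rightarrow> 'a ^ 2 ^ 2" where G: "G = generate K2 ((\<lambda>i. cyc l (mobius (A i))) ` {..<n})"
    and A: "\<And>i. i < n \<Longrightarrow> invertible (A i)" "\<And>i. i < n \<Longrightarrow> cyc l (mobius (A i)) \<noteq> \<one>\<^bsub>K2\<^esub>"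
      "\<And>i j. i < n \<Longrightarrow> j < n \<Longrightarrow> i \<noteq> j \<Longrightarrow> essentially_distinct (A i) (A j)"
    using assms(6) unfolding generated_subgroups_def by blast
  have "real (2 * n + 3) \<le> real l" using assms(5) by (simp add: field_simps)
  then have "2 * n \<le> l - 3" by linarith
  then interpret mobius_family l "TYPE('a)" n A
    using assms(1-3) A by unfold_locales auto
  let ?T = "cyc_exponents l (char_exp TYPE('a))"
  have elems: "nontrivial_cyclotomic_elements_in l G =
      {x \<in> generate K2 (u ` {..<n}). x \<in> cyclotomic_elements l \<and> x \<noteq> \<one>\<^bsub>K2\<^esub>}"
    by (simp add: nontrivial_cyclotomic_elements_in_def G)
  have subs: "nontrivial_cyclotomic_subgroups_in l G =
      (if ?T = {1..<l} then (\<lambda>i. generate K2 {u i}) ` {..<n} else {})"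
    unfolding nontrivial_cyclotomic_subgroups_in_def cyclotomic_subgroup_def G cyclotomic_subgroups_eq[symmetric]
    by auto
  have card_T: "CHAR('a) = 0 \<Longrightarrow> card ?T = 2" "CHAR('a) \<noteq> 0 \<Longrightarrow> card ?T = 2 + card (Z_set l CHAR('a))"
    using assms(2) cyc_exponents_1[of l] card_cyc_exponents[of l "CHAR('a)"] by (auto simp: char_exp_def card_insert_if)
  have num_el: "num_cyclotomic_elements l G = n * card ?T"
    unfolding num_cyclotomic_elements_def elems by (rule card_cyclotomic_elements(2))
  have num_sub: "num_cyclotomic_subgroups l G = (if ?T = {1..<l} then n else 0)"
    unfolding num_cyclotomic_subgroups_def subs using card_image[OF fam.inj_generate_single] by simp
  have gen: "cyclic_group (K2\<lparr>carrier := H\<rparr>) \<and> card H = l \<and> H \<in> generated_subgroups l 1"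
    if H: "H \<in> nontrivial_cyclotomic_subgroups_in l G" for H
  proof -
    obtain i where i: "i < n" "H = generate K2 {u i}" using H unfolding subs by (auto split: if_splits)
    have "H \<in> generated_subgroups l 1"
      unfolding generated_subgroups_def
      by (intro CollectI exI[of _ "\<lambda>_. A i"]) (use i A in \<open>simp add: lessThan_Suc\<close>)
    then show ?thesis
      using K2.cyclic_group_generate[OF u_carrier[OF i(1)]] fam.card_generate_single[OF i(1)] i(2) by simp
  qed
  have fin: "finite (nontrivial_cyclotomic_elements_in l G)" "finite (nontrivial_cyclotomic_subgroups_in l G)"
    unfolding elems subs using card_cyclotomic_elements(1) by simp_all
  show ?thesis
    using fin gen num_el num_sub card_T cyc_exponents_full_iff_CHAR assms(4) by (auto simp: mult.commute)
qed

end
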